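(* Let $m\in\mathbb Z$, $n\in\mathbb N$, and let $y_n=\sum_{r=0}^{n}y_{m+r+1,m-r}E_{m+r+1,m-r}\in(\mathfrak g_n^m)^*$ with all $y_{m+r+1,m-r}\ne0$, $0\le r\le n$. Let $T^{m,y_n}$ be the induced representation of the group $G_n^m$ corresponding to the generic orbit generated by $y_n$, i.e. the representation in $\mathcal H^{m,n}=L^2(X,\mu)$, $X=B(m,n)\backslash G^m_n\cong B_{m,n}\times B^{(m,n)}$, given by $$(T^{m,y_n}_tf)(x)=S(h(x,t))\left(\frac{d\mu(xt)}{d\mu(x)}\right)^{1/2}f(xt),\qquad f\in L^2(X,\mu),\ x\in X,\ t\in G_n^m .$$ Then $T^{m,y_n}$ is irreducible. Moreover, the generators $A_{kr}=\frac{d}{dt}T^{m,y_n}_{I+tE_{kr}}\big|_{t=0}$ of the one-parameter groups $t\mapsto T^{m,y_n}_{I+tE_{kr}}$ are $$A_{kr}=\sum_{s=m-n}^{k-1}x_{sk}D_{sr}+D_{kr},\ (k,r)\in\Delta^{(m,n)},\qquad A_{kr}=\sum_{s=m+1}^{k-1}x_{sk}D_{sr}+D_{kr},\ (k,r)\in\Delta_{m,n},$$ and for $(k,r)\in\Delta(m,n)$ the operator $A_{kr}$ is multiplication by $2\pi i\,S_{kr}(x)$, where $$(2\pi i)^{-1}\big(A_{kr}\big)_{(k,r)\in\Delta(m,n)}=\big(S_{kr}\big)_{(k,r)\in\Delta(m,n)}=\big(x_m^{-1}\,y_n\,x^{(m)}\big)^T .$$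
   Context: $E_{kr}$ are matrix units. $G_n^m=\{I+\sum_{m-n\le k<r\le m+n+1}x_{kr}E_{kr}: x_{kr}\in\mathbb R\}$ is the group of real upper unitriangular matrices of order $2n+2$ with rows and columns indexed by $m-n,\dots,m+n+1$; its Lie algebra $\mathfrak g_n^m$ consists of the strictly upper triangular matrices, and the dual $(\mathfrak g_n^m)^*$ is identified with strictly lower triangular matrices via $\langle y,x\rangle=\mathrm{tr}(xy)$. Index sets: $\Delta(m,n)=\{(k,r): m-n\le k\le m<r\le m+n+1\}$, $\Delta_{m,n}=\{(k,r): m+1\le k<r\le m+n+1\}$, $\Delta^{(m,n)}=\{(k,r): m-n\le k<r\le m\}$. $B(m,n)$, $B_{m,n}$, $B^{(m,n)}$ are the subgroups of $G_n^m$ of matrices $I+\sum x_{kr}E_{kr}$ with sum over $\Delta(m,n)$, $\Delta_{m,n}$, $\Delta^{(m,n)}$ respectively. $B(m,n)$ is commutative and elements of $B_{m,n}$ and $B^{(m,n)}$ commute. Every element of $G_n^m$ is uniquely $h\,x_m\,x^{(m)}$ with $h\in B(m,n)$, $x_m\in B_{m,n}$, $x^{(m)}\in B^{(m,n)}$, so $X\cong B_{m,n}\times B^{(m,n)}$. With $s(x)=x_mx^{(m)}$ for $x=(x_m,x^{(m)})$, the elements $h(x,t)\in B(m,n)$ and $xt\in X$ are defined by $s(x)t=h(x,t)s(xt)$. $\mu$ is Lebesgue measure $\bigotimes_{(k,r)\in\Delta_{m,n}\cup\Delta^{(m,n)}}dx_{kr}$, i.e. the Haar measure of $B_{m,n}\times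 B^{(m,n)}$. $S$ is the unitary character $S(h)=\exp(2\pi i\langle y_n,h-I\rangle)$ of $B(m,n)$. $D_{kr}=\partial/\partial x_{kr}$. For $(k,r)\in\Delta(m,n)$, $S_{kr}(x)=\langle y_n,h(x,I+E_{kr})-I\rangle$; the identity $(S_{kr})=(x_m^{-1}y_nx^{(m)})^T$ means $S_{kr}(x)=(x_m^{-1}y_nx^{(m)})_{rk}$, where $x=(x_m,x^{(m)})$. The formulas for $A_{kr}$ are understood on smooth compactly supported functions. *)

theory Defs
  imports "HOL-Analysis.Analysis" "HOL-Algebra.Group"
begin

text \<open>
  Matrices whose rows and columns are indexed by \<open>m - n, \<dots>, m + n + 1\<close> are functions
  \<open>int \<Rightarrow> int \<Rightarrow> real\<close> that vanish outside this index range, so that equality of matrices is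
  equality of functions, and the topology of the function type is that of entrywise convergence.
\<close>

type_synonym imat = "int \<Rightarrow> int \<Rightarrow> real"

definition idx :: "int \<Rightarrow> nat \<Rightarrow> int set" where
  "idx m n = {m - int n .. m + int n + 1}"

definition Imat :: "int \<Rightarrow> nat \<Rightarrow> imat" where
  "Imat m n = (\<lambda>i j. if i = j \<and> i \<in> idx m n then 1 else 0)"

definition E :: "int \<Rightarrow> int \<Rightarrow> imat" where
  "E k r = (\<lambda>i j. if i = k \<and> j = r then 1 else 0)"

definition mmul :: "int \<Rightarrow> nat \<Rightarrow> imat \<Rightarrow> imat \<Rightarrow> imat" where
  "mmul m n a b = (\<lambda>i j. \<Sum>l\<in>idx m n. a i l * b l j)"

definition mtrace :: "int \<Rightarrow> nat \<Rightarrow> imat \<Rightarrow> real" where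
  "mtrace m n a = (\<Sum>i\<in>idx m n. a i i)"

definition Delta_all :: "int \<Rightarrow> nat \<Rightarrow> (int \<times> int) set" where
  "Delta_all m n = {(k, r). m - int n \<le> k \<and> k < r \<and> r \<le> m + int n + 1}"

text \<open>\<open>\<Delta>(m,n)\<close>, \<open>\<Delta>\<^sub>m\<^sub>,\<^sub>n\<close> (lower right block) and \<open>\<Delta>\<^sup>(\<^sup>m\<^sup>,\<^sup>n\<^sup>)\<close> (upper left block).\<close>

definition Delta_rect :: "int \<Rightarrow> nat \<Rightarrow> (int \<times> int) set" where
  "Delta_rect m n = {(k, r). m - int n \<le> k \<and> k \<le> m \<and> m < r \<and> r \<le> m + int n + 1}"

definition Delta_sub :: "int \<Rightarrow> nat \<Rightarrow> (int \<times> int) set" where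
  "Delta_sub m n = {(k, r). m + 1 \<le> k \<and> k < r \<and> r \<le> m + int n + 1}"

definition Delta_sup :: "int \<Rightarrow> nat \<Rightarrow> (int \<times> int) set" where
  "Delta_sup m n = {(k, r). m - int n \<le> k \<and> k < r \<and> r \<le> m}"

definition unip :: "int \<Rightarrow> nat \<Rightarrow> (int \<times> int) set \<Rightarrow> (int \<times> int \<Rightarrow> real) \<Rightarrow> imat" where
  "unip m n D x = (\<lambda>i j. Imat m n i j + (\<Sum>(k, r)\<in>D. x (k, r) * E k r i j))"

definition G :: "int \<Rightarrow> nat \<Rightarrow> imat monoid" where
  "G m n = \<lparr>carrier = range (unip m n (Delta_all m n)), mult = mmul m n, one = Imat m n\<rparr>"

definition B_rect :: "int \<Rightarrow> nat \<Rightarrow> imat set" where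
  "B_rect m n = range (unip m n (Delta_rect m n))"

definition pairing :: "int \<Rightarrow> nat \<Rightarrow> imat \<Rightarrow> imat \<Rightarrow> real" where
  "pairing m n y x = mtrace m n (mmul m n x y)"

definition y_functional :: "int \<Rightarrow> nat \<Rightarrow> (int \<Rightarrow> int \<Rightarrow> real) \<Rightarrow> imat" where
  "y_functional m n y =
     (\<lambda>i j. \<Sum>r = 0..n. y (m + int r + 1) (m - int r) * E (m + int r + 1) (m - int r) i j)"

text \<open>
  A point of \<open>X = B(m,n) \ G \<cong> B\<^sub>m\<^sub>,\<^sub>n \<times> B\<^sup>(\<^sup>m\<^sup>,\<^sup>n\<^sup>)\<close> is given by its coordinates \<open>x\<^sub>k\<^sub>r\<close>, that is, by an
  extensional function on \<open>\<Delta>\<^sub>m\<^sub>,\<^sub>n \<union> \<Delta>\<^sup>(\<^sup>m\<^sup>,\<^sup>n\<^sup>)\<close>; the corresponding pair of matrices is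
  \<open>(x_sub m n x, x_sup m n x)\<close>.
\<close>

type_synonym coords = "int \<times> int \<Rightarrow> real"

definition Delta_X :: "int \<Rightarrow> nat \<Rightarrow> (int \<times> int) set" where
  "Delta_X m n = Delta_sub m n \<union> Delta_sup m n"

definition X :: "int \<Rightarrow> nat \<Rightarrow> coords set" where
  "X m n = (\<Pi>\<^sub>E p\<in>Delta_X m n. UNIV)"

definition mu :: "int \<Rightarrow> nat \<Rightarrow> coords measure" where
  "mu m n = Pi\<^sub>M (Delta_X m n) (\<lambda>_. lborel)"

definition x_sub :: "int \<Rightarrow> nat \<Rightarrow> coords \<Rightarrow> imat" where
  "x_sub m n x = unip m n (Delta_sub m n) x"

definition x_sup :: "int \<Rightarrow> nat \<Rightarrow> coords \<Rightarrow> imat" where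
  "x_sup m n x = unip m n (Delta_sup m n) x"

definition sect :: "int \<Rightarrow> nat \<Rightarrow> coords \<Rightarrow> imat" where
  "sect m n x = x_sub m n x \<otimes>\<^bsub>G m n\<^esub> x_sup m n x"

text \<open>
  The pair \<open>(h(x,t), x t)\<close> is the unique pair in \<open>B(m,n) \<times> X\<close> with \<open>s(x) t = h(x,t) s(x t)\<close>.
\<close>

definition decomp :: "int \<Rightarrow> nat \<Rightarrow> coords \<Rightarrow> imat \<Rightarrow> imat \<times> coords" where
  "decomp m n x t = (THE (h, z). h \<in> B_rect m n \<and> z \<in> X m n \<and>
     sect m n x \<otimes>\<^bsub>G m n\<^esub> t = h \<otimes>\<^bsub>G m n\<^esub> sect m n z)"

definition hcoc :: "int \<Rightarrow> nat \<Rightarrow> coords \<Rightarrow> imat \<Rightarrow> imat" where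
  "hcoc m n x t = fst (decomp m n x t)"

definition act :: "int \<Rightarrow> nat \<Rightarrow> coords \<Rightarrow> imat \<Rightarrow> coords" where
  "act m n x t = snd (decomp m n x t)"

definition S_char :: "int \<Rightarrow> nat \<Rightarrow> imat \<Rightarrow> imat \<Rightarrow> complex" where
  "S_char m n y h =
     exp (2 * of_real pi * \<i> * of_real (pairing m n y (\<lambda>i j. h i j - Imat m n i j)))"

text \<open>
  The measure \<open>A \<mapsto> \<mu>(A t)\<close> is the image of \<open>\<mu>\<close> under \<open>x \<mapsto> x t\<inverse>\<close>.
\<close>

definition dmu :: "int \<Rightarrow> nat \<Rightarrow> imat \<Rightarrow> coords \<Rightarrow> real" where
  "dmu m n t x = enn2real (RN_deriv (mu m n)
     (distr (mu m n) (mu m n) (\<lambda>z. act m n z (inv\<^bsub>G m n\<^esub> t))) x)"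

definition T :: "int \<Rightarrow> nat \<Rightarrow> imat \<Rightarrow> imat \<Rightarrow> (coords \<Rightarrow> complex) \<Rightarrow> coords \<Rightarrow> complex" where
  "T m n y t f = (\<lambda>x. S_char m n y (hcoc m n x t) * of_real (sqrt (dmu m n t x)) * f (act m n x t))"

definition one_param :: "int \<Rightarrow> nat \<Rightarrow> int \<Rightarrow> int \<Rightarrow> real \<Rightarrow> imat" where
  "one_param m n k r t = (\<lambda>i j. Imat m n i j + t * E k r i j)"

definition S_coord :: "int \<Rightarrow> nat \<Rightarrow> imat \<Rightarrow> int \<Rightarrow> int \<Rightarrow> coords \<Rightarrow> real" where
  "S_coord m n y k r x =
     pairing m n y (\<lambda>i j. hcoc m n x (one_param m n k r 1) i j - Imat m n i j)"

text \<open>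
  The Hilbert space \<open>L\<^sup>2(M)\<close> is represented by the square-integrable functions, without passing to
  classes modulo null functions; equality of its elements is equality almost everywhere.
\<close>

definition L2 :: "'x measure \<Rightarrow> ('x \<Rightarrow> complex) set" where
  "L2 M = {f \<in> borel_measurable M. integrable M (\<lambda>x. (cmod (f x))\<^sup>2)}"

definition l2_inner :: "'x measure \<Rightarrow> ('x \<Rightarrow> complex) \<Rightarrow> ('x \<Rightarrow> complex) \<Rightarrow> complex" where
  "l2_inner M f g = (\<integral>x. f x * cnj (g x) \<partial>M)"

definition l2_norm :: "'x measure \<Rightarrow> ('x \<Rightarrow> complex) \<Rightarrow> real" where
  "l2_norm M f = sqrt (\<integral>x. (cmod (f x))\<^sup>2 \<partial>M)"

definition unitary_on_L2 :: "'x measure \<Rightarrow> (('x \<Rightarrow> complex) \<Rightarrow> 'x \<Rightarrow> complex) \<Rightarrow> bool" where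
  "unitary_on_L2 M U \<longleftrightarrow>
     (\<forall>f\<in>L2 M. U f \<in> L2 M) \<and>
     (\<forall>f\<in>L2 M. \<forall>g\<in>L2 M. \<forall>a b. AE x in M. U (\<lambda>z. a * f z + b * g z) x = a * U f x + b * U g x) \<and>
     (\<forall>f\<in>L2 M. \<forall>g\<in>L2 M. l2_inner M (U f) (U g) = l2_inner M f g) \<and>
     (\<forall>g\<in>L2 M. \<exists>f\<in>L2 M. AE x in M. U f x = g x)"

text \<open>Unitary representations are understood to be strongly continuous.\<close>

definition unitary_rep ::
  "('g::topological_space) monoid \<Rightarrow> 'x measure \<Rightarrow> ('g \<Rightarrow> ('x \<Rightarrow> complex) \<Rightarrow> 'x \<Rightarrow> complex) \<Rightarrow> bool"
where
  "unitary_rep H M R \<longleftrightarrow>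
     group H \<and>
     (\<forall>t\<in>carrier H. unitary_on_L2 M (R t)) \<and>
     (\<forall>f\<in>L2 M. AE x in M. R \<one>\<^bsub>H\<^esub> f x = f x) \<and>
     (\<forall>s\<in>carrier H. \<forall>t\<in>carrier H. \<forall>f\<in>L2 M. AE x in M. R (s \<otimes>\<^bsub>H\<^esub> t) f x = R s (R t f) x) \<and>
     (\<forall>f\<in>L2 M. \<forall>t\<in>carrier H.
        ((\<lambda>u. l2_norm M (\<lambda>x. R u f x - R t f x)) \<longlongrightarrow> 0) (at t within carrier H))"

text \<open>
  Closedness with respect to the seminorm makes a closed subspace a union of classes modulo null
  functions, so these sets correspond to the closed subspaces of the Hilbert space of classes.
\<close>

definition closed_subspace_L2 :: "'x measure \<Rightarrow> ('x \<Rightarrow> complex) set \<Rightarrow> bool" where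
  "closed_subspace_L2 M V \<longleftrightarrow>
     V \<subseteq> L2 M \<and> (\<lambda>x. 0) \<in> V \<and>
     (\<forall>f\<in>V. \<forall>g\<in>V. \<forall>a b. (\<lambda>x. a * f x + b * g x) \<in> V) \<and>
     (\<forall>F f. range F \<subseteq> V \<and> f \<in> L2 M \<and> (\<lambda>j::nat. l2_norm M (\<lambda>x. F j x - f x)) \<longlonglongrightarrow> 0 \<longrightarrow> f \<in> V)"

definition irreducible_unitary_rep ::
  "('g::topological_space) monoid \<Rightarrow> 'x measure \<Rightarrow> ('g \<Rightarrow> ('x \<Rightarrow> complex) \<Rightarrow> 'x \<Rightarrow> complex) \<Rightarrow> bool"
where
  "irreducible_unitary_rep H M R \<longleftrightarrow>
     unitary_rep H M R \<and>
     (\<exists>f\<in>L2 M. \<not> (AE x in M. f x = 0)) \<and>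
     (\<forall>V. closed_subspace_L2 M V \<and> (\<forall>t\<in>carrier H. \<forall>f\<in>V. R t f \<in> V) \<longrightarrow>
        V = {f \<in> L2 M. AE x in M. f x = 0} \<or> V = L2 M)"

text \<open>
  \<open>l2_generator M U f g\<close>: \<open>f\<close> lies in the domain of the generator \<open>A = d/dt U\<^sub>t |\<^sub>t\<^sub>=\<^sub>0\<close> (the
  derivative being taken in the \<open>L\<^sup>2\<close> norm) and \<open>A f = g\<close>.
\<close>

definition l2_generator ::
  "'x measure \<Rightarrow> (real \<Rightarrow> ('x \<Rightarrow> complex) \<Rightarrow> 'x \<Rightarrow> complex) \<Rightarrow> ('x \<Rightarrow> complex) \<Rightarrow> ('x \<Rightarrow> complex) \<Rightarrow> bool"
where
  "l2_generator M U f g \<longleftrightarrow>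
     f \<in> L2 M \<and> g \<in> L2 M \<and> (\<forall>t. U t f \<in> L2 M) \<and>
     ((\<lambda>t. l2_norm M (\<lambda>x. (U t f x - f x) / of_real t - g x)) \<longlongrightarrow> 0) (at 0)"

definition D :: "int \<Rightarrow> int \<Rightarrow> (coords \<Rightarrow> complex) \<Rightarrow> coords \<Rightarrow> complex" where
  "D k r f = (\<lambda>x. vector_derivative (\<lambda>u. f (x((k, r) := u))) (at (x (k, r))))"

text \<open>
  \<open>C\<^sub>c\<^sup>\<infinity>(X)\<close>: all iterated partial derivatives exist and are continuous, and the support is contained
  in a compact subset of \<open>X\<close>.
\<close>

definition Cc_infty :: "int \<Rightarrow> nat \<Rightarrow> (coords \<Rightarrow> complex) set" where
  "Cc_infty m n = {f.
     (\<forall>ps. set ps \<subseteq> Delta_X m n \<longrightarrow>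
        (let g = foldr (\<lambda>(k, r). D k r) ps f in
           continuous_on (X m n) g \<and>
           (\<forall>p\<in>Delta_X m n. \<forall>x\<in>X m n. (\<lambda>u. g (x(p := u))) differentiable (at (x p))))) \<and>
     (\<exists>K. compact K \<and> K \<subseteq> X m n \<and> (\<forall>x\<in>X m n - K. f x = 0))}"

end

theory Submission
  imports Defs
begin

text \<open>
  The action on \<open>X\<close> is triangular with unit diagonal in the coordinates, so \<open>\<mu>\<close> is invariant and the
  density is \<open>1\<close> almost everywhere. For irreducibility, the elements of \<open>B(m,n)\<close> act as multiplication by
  \<open>exp(2 \<pi> i s S\<^sub>k\<^sub>r)\<close>, so that a closed invariant subspace is stable under multiplication by indicator
  functions of sets in the \<open>\<sigma>\<close>-algebra generated by the \<open>S\<^sub>k\<^sub>r\<close>. As all antidiagonal entries of \<open>y\<^sub>n\<close> are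
  nonzero, Gaussian elimination recovers the coordinates \<open>x\<^sub>k\<^sub>r\<close> from the entries of
  \<open>x\<^sub>m\<^sup>-\<^sup>1 y\<^sub>n x\<^sup>(\<^sup>m\<^sup>)\<close>, so this is the full \<open>\<sigma>\<close>-algebra, and transitivity of the action on \<open>X\<close> excludes
  supports that are neither null nor conull. Strong continuity is obtained in the same way: the
  functions with continuous orbit form a closed subspace stable under multiplication by
  \<open>exp(i s x\<^sub>k\<^sub>r)\<close>, and it contains a nowhere vanishing function. For the generators, the difference quotients
  converge pointwise and are dominated by a multiple of the indicator function of a box.
\<close>

section \<open>Closed subspaces of square-integrable functions and their multipliers\<close>

text \<open>Elements of L2 are functions, and irreducibility is proved for closed subspaces
  directly, without projections or commutants; closedness in the seminorm supplies saturation under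
  null sets. Of the inversion of the map from coordinates to the \<open>S_kr\<close> only this is
  used: each coordinate is a polynomial in the \<open>S_kr\<close>. The elimination divides by the
  constants y alone, the other pivots being diagonal entries 1, so it runs in any ring of real
  functions that contains the constants, in particular in the functions measurable for the
  \<sigma>-algebra attached to the subspace. Transitivity cannot be used pointwise: translating the
  support of an element by one group element gives information only outside a null set depending on
  that group element. It enters through Fubini on pairs (x, z) with x outside the joint support U
  and x s(z) in the support of one nonzero element, where (x, z) \<mapsto> x s(z) preserves \<mu> in
  each variable. Strong continuity is reduced to a single nowhere vanishing function, for which
  constant norms along the orbit replace a dominating function.\<close>

lemma L2D [dest]:
  assumes "f \<in> L2 M"
  shows "f \<in> borel_measurable M" "integrable M (\<lambda>x. (cmod (f x))\<^sup>2)"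
  using assms by (auto simp: L2_def)

lemma L2I:
  assumes "f \<in> borel_measurable M" "integrable M w" "AE x in M. (cmod (f x))\<^sup>2 \<le> w x"
  shows "f \<in> L2 M"
proof -
  have "integrable M (\<lambda>x. (cmod (f x))\<^sup>2)"
    using assms by (intro Bochner_Integration.integrable_bound[OF assms(2)]) auto
  then show ?thesis using assms by (simp add: L2_def)
qed

lemma cmod_add_square_le: "(cmod (a + b))\<^sup>2 \<le> 2 * (cmod a)\<^sup>2 + 2 * (cmod b)\<^sup>2"
proof -
  have "(cmod (a + b))\<^sup>2 \<le> (cmod a + cmod b)\<^sup>2"
    by (intro power_mono norm_triangle_ineq) auto
  also have "\<dots> \<le> 2 * (cmod a)\<^sup>2 + 2 * (cmod b)\<^sup>2"
    using sum_squares_bound[of "cmod a" "cmod b"] by (simp add: power2_sum)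
  finally show ?thesis .
qed

lemma cmod_diff_square_le: "(cmod (a - b))\<^sup>2 \<le> 2 * (cmod a)\<^sup>2 + 2 * (cmod b)\<^sup>2"
  using cmod_add_square_le[of a "- b"] by simp

lemma L2_add:
  assumes "f \<in> L2 M" "g \<in> L2 M"
  shows "(\<lambda>x. f x + g x) \<in> L2 M"
  by (rule L2I[where w = "\<lambda>x. 2 * (cmod (f x))\<^sup>2 + 2 * (cmod (g x))\<^sup>2"])
     (use L2D[OF assms(1)] L2D[OF assms(2)] cmod_add_square_le in auto)

lemma L2_mult_bounded:
  assumes "\<phi> \<in> borel_measurable M" "\<And>x. x \<in> space M \<Longrightarrow> cmod (\<phi> x) \<le> C" "f \<in> L2 M"
  shows "(\<lambda>x. \<phi> x * f x) \<in> L2 M"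
  by (rule L2I[where w = "\<lambda>x. C\<^sup>2 * (cmod (f x))\<^sup>2"])
     (use assms(1) L2D[OF assms(3)] in
       \<open>auto intro!: AE_I2 mult_mono power_mono assms(2) simp: norm_mult power_mult_distrib\<close>)

lemma L2_scale: "f \<in> L2 M \<Longrightarrow> (\<lambda>x. c * f x) \<in> L2 M"
  by (rule L2_mult_bounded[where C = "cmod c"]) auto

lemma L2_diff: "f \<in> L2 M \<Longrightarrow> g \<in> L2 M \<Longrightarrow> (\<lambda>x. f x - g x) \<in> L2 M"
  using L2_add[OF _ L2_scale[of g M "-1"], of f] by simp

text \<open>The squared norm is handled instead of the norm: |a + b|^2 \<le> 2 |a|^2 + 2 |b|^2 then
  replaces the triangle inequality in the convergence arguments.\<close>

lemma l2_norm_tendsto_0_iff: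
  "((\<lambda>i. l2_norm M (F i)) \<longlongrightarrow> 0) A \<longleftrightarrow> ((\<lambda>i. \<integral>x. (cmod (F i x))\<^sup>2 \<partial>M) \<longlongrightarrow> 0) A"
proof
  assume "((\<lambda>i. l2_norm M (F i)) \<longlongrightarrow> 0) A"
  from tendsto_power[OF this, of 2] show "((\<lambda>i. \<integral>x. (cmod (F i x))\<^sup>2 \<partial>M) \<longlongrightarrow> 0) A"
    by (simp add: l2_norm_def)
next
  assume "((\<lambda>i. \<integral>x. (cmod (F i x))\<^sup>2 \<partial>M) \<longlongrightarrow> 0) A"
  from tendsto_real_sqrt[OF this] show "((\<lambda>i. l2_norm M (F i)) \<longlongrightarrow> 0) A"
    by (simp add: l2_norm_def)
qed

lemma l2_norm_eq_0_AE:
  assumes "AE x in M. f x = 0"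
  shows "l2_norm M f = 0"
proof -
  have "(\<integral>x. (cmod (f x))\<^sup>2 \<partial>M) = 0"
    by (rule integral_eq_zero_AE) (use assms in auto)
  then show ?thesis by (simp add: l2_norm_def)
qed

lemma l2_square_add_le:
  assumes f: "f \<in> L2 M" and g: "g \<in> L2 M"
  shows "(\<integral>x. (cmod (f x + g x))\<^sup>2 \<partial>M) \<le> 2 * (\<integral>x. (cmod (f x))\<^sup>2 \<partial>M) + 2 * (\<integral>x. (cmod (g x))\<^sup>2 \<partial>M)"
proof -
  have "(\<integral>x. (cmod (f x + g x))\<^sup>2 \<partial>M) \<le> (\<integral>x. 2 * (cmod (f x))\<^sup>2 + 2 * (cmod (g x))\<^sup>2 \<partial>M)"
    using L2D[OF f] L2D[OF g] L2D(2)[OF L2_add[OF f g]] cmod_add_square_le by (intro integral_mono) auto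
  also have "\<dots> = 2 * (\<integral>x. (cmod (f x))\<^sup>2 \<partial>M) + 2 * (\<integral>x. (cmod (g x))\<^sup>2 \<partial>M)"
    using L2D[OF f] L2D[OF g] by simp
  finally show ?thesis .
qed

lemma l2_norm_tendsto_add:
  assumes F: "\<forall>\<^sub>F i in A. F i \<in> L2 M" and H: "\<forall>\<^sub>F i in A. H i \<in> L2 M"
    and "((\<lambda>i. l2_norm M (F i)) \<longlongrightarrow> 0) A" "((\<lambda>i. l2_norm M (H i)) \<longlongrightarrow> 0) A"
  shows "((\<lambda>i. l2_norm M (\<lambda>x. F i x + H i x)) \<longlongrightarrow> 0) A"
proof -
  let ?n = "\<lambda>f. \<integral>x. (cmod (f x))\<^sup>2 \<partial>M"
  have lim: "((\<lambda>i. 2 * ?n (F i) + 2 * ?n (H i)) \<longlongrightarrow> 0) A"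
    using tendsto_add[OF tendsto_mult[OF tendsto_const[of 2] assms(3)[unfolded l2_norm_tendsto_0_iff]]
      tendsto_mult[OF tendsto_const[of 2] assms(4)[unfolded l2_norm_tendsto_0_iff]]] by simp
  have le: "\<forall>\<^sub>F i in A. ?n (\<lambda>x. F i x + H i x) \<le> 2 * ?n (F i) + 2 * ?n (H i)"
    using F H by eventually_elim (rule l2_square_add_le)
  show ?thesis
    unfolding l2_norm_tendsto_0_iff
    by (rule tendsto_sandwich[OF _ le tendsto_const lim]) auto
qed

lemma l2_dominated_convergence:
  assumes [measurable]: "f \<in> borel_measurable M" "\<And>i. F i \<in> borel_measurable M"
    and w: "integrable M w"
    and lim: "AE x in M. (\<lambda>i. F i x) \<longlonglongrightarrow> f x"
    and bound: "\<And>i. AE x in M. (cmod (F i x))\<^sup>2 \<le> w x"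
  shows "(\<lambda>i::nat. l2_norm M (\<lambda>x. F i x - f x)) \<longlonglongrightarrow> 0"
proof -
  have bf: "AE x in M. (cmod (f x))\<^sup>2 \<le> w x"
  proof -
    have "AE x in M. \<forall>i. (cmod (F i x))\<^sup>2 \<le> w x"
      using bound by (simp add: AE_all_countable)
    with lim show ?thesis
    proof eventually_elim
      case (elim x)
      show ?case
        by (rule LIMSEQ_le_const2[OF tendsto_power[OF tendsto_norm[OF elim(1)]]]) (use elim in auto)
    qed
  qed
  have "(\<lambda>i. \<integral>x. (cmod (F i x - f x))\<^sup>2 \<partial>M) \<longlonglongrightarrow> (\<integral>x. 0 \<partial>M)"
  \<comment> \<open>|F - f|^2 \<le> 2 |F|^2 + 2 |f|^2, and the limit inherits the bound
    \<open>w\<close>; hence the factor 4.\<close>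
  proof (rule integral_dominated_convergence[where w = "\<lambda>x. 4 * w x"])
    show "AE x in M. (\<lambda>i. (cmod (F i x - f x))\<^sup>2) \<longlonglongrightarrow> 0"
      using lim
    proof eventually_elim
      case (elim x)
      from tendsto_power[OF tendsto_norm[OF tendsto_diff[OF elim tendsto_const[of "f x"]]], of 2]
      show ?case by simp
    qed
    show "AE x in M. norm ((cmod (F i x - f x))\<^sup>2) \<le> 4 * w x" for i
      using bound[of i] bf
    proof eventually_elim
      case (elim x)
      with cmod_diff_square_le[of "F i x" "f x"] show ?case by simp
    qed
  qed (use w in auto)
  then show ?thesis by (simp add: l2_norm_tendsto_0_iff)
qed

lemma closed_subspace_L2D:
  assumes "closed_subspace_L2 M V"
  shows "V \<subseteq> L2 M" "(\<lambda>x. 0) \<in> V"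
    "\<And>f g. f \<in> V \<Longrightarrow> g \<in> V \<Longrightarrow> (\<lambda>x. f x + g x) \<in> V"
    "\<And>f c. f \<in> V \<Longrightarrow> (\<lambda>x. c * f x) \<in> V"
    "\<And>F f. (\<And>j. F j \<in> V) \<Longrightarrow> f \<in> L2 M \<Longrightarrow> (\<lambda>j::nat. l2_norm M (\<lambda>x. F j x - f x)) \<longlonglongrightarrow> 0 \<Longrightarrow> f \<in> V"
proof -
  have *: "\<And>f g a b. f \<in> V \<Longrightarrow> g \<in> V \<Longrightarrow> (\<lambda>x. a * f x + b * g x) \<in> V"
    and z: "(\<lambda>x. 0) \<in> V"
    and l: "\<And>F f. range F \<subseteq> V \<Longrightarrow> f \<in> L2 M \<Longrightarrow> (\<lambda>j::nat. l2_norm M (\<lambda>x. F j x - f x)) \<longlonglongrightarrow> 0 \<Longrightarrow> f \<in> V"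
    using assms by (simp_all add: closed_subspace_L2_def)
  show "V \<subseteq> L2 M" "(\<lambda>x. 0) \<in> V" using assms by (simp_all add: closed_subspace_L2_def)
  show "(\<lambda>x. f x + g x) \<in> V" if "f \<in> V" "g \<in> V" for f g using *[OF that, of 1 1] by simp
  show "(\<lambda>x. c * f x) \<in> V" if "f \<in> V" for f c using *[OF that z, of c 0] by simp
  show "f \<in> V" if "\<And>j. F j \<in> V" "f \<in> L2 M" "(\<lambda>j::nat. l2_norm M (\<lambda>x. F j x - f x)) \<longlonglongrightarrow> 0" for F f
    using l[of F f] that by blast
qed

text \<open>The constant sequence \<open>f\<close> converges to \<open>g\<close> in the seminorm, so
  closed subspaces are saturated under equality almost everywhere.\<close>

lemma closed_subspace_AE:
  assumes V: "closed_subspace_L2 M V" and f: "f \<in> V" and g: "g \<in> L2 M"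
    and eq: "AE x in M. f x = g x"
  shows "g \<in> V"
proof (rule closed_subspace_L2D(5)[OF V, of "\<lambda>_. f"])
  have "l2_norm M (\<lambda>x. f x - g x) = 0"
    using eq by (intro l2_norm_eq_0_AE) auto
  then show "(\<lambda>j::nat. l2_norm M (\<lambda>x. f x - g x)) \<longlonglongrightarrow> 0" by simp
qed (use f g in auto)

lemma closed_subspace_limit:
  assumes V: "closed_subspace_L2 M V" and F: "\<And>i::nat. F i \<in> V"
    and f: "f \<in> borel_measurable M" and w: "integrable M w"
    and lim: "AE x in M. (\<lambda>i. F i x) \<longlonglongrightarrow> f x"
    and bound: "\<And>i. AE x in M. (cmod (F i x))\<^sup>2 \<le> w x"
  shows "f \<in> V"
proof (rule closed_subspace_L2D(5)[OF V F])
  have [measurable]: "F i \<in> borel_measurable M" for i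
    using F closed_subspace_L2D(1)[OF V] by blast
  show "(\<lambda>i. l2_norm M (\<lambda>x. F i x - f x)) \<longlonglongrightarrow> 0"
    by (rule l2_dominated_convergence[OF f _ w lim bound]) auto
  show "f \<in> L2 M"
  proof (rule L2I[OF f w])
    have "AE x in M. \<forall>i. (cmod (F i x))\<^sup>2 \<le> w x"
      using bound by (simp add: AE_all_countable)
    with lim show "AE x in M. (cmod (f x))\<^sup>2 \<le> w x"
    proof eventually_elim
      case (elim x)
      show ?case
        by (rule LIMSEQ_le_const2[OF tendsto_power[OF tendsto_norm[OF elim(1)]]]) (use elim in auto)
    qed
  qed
qed

section \<open>Multiplication operators preserving a closed subspace\<close>

definition multipliers :: "'x measure \<Rightarrow> ('x \<Rightarrow> complex) set \<Rightarrow> ('x \<Rightarrow> complex) set" where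
  "multipliers M V = {\<phi> \<in> borel_measurable M.
     (\<exists>C. \<forall>x\<in>space M. cmod (\<phi> x) \<le> C) \<and> (\<forall>f\<in>V. (\<lambda>x. \<phi> x * f x) \<in> V)}"

definition mult_sets :: "'x measure \<Rightarrow> ('x \<Rightarrow> complex) set \<Rightarrow> 'x set set" where
  "mult_sets M V = {A \<in> sets M. (\<lambda>x. of_real (indicator A x)) \<in> multipliers M V}"

text \<open>
  Bounded polynomials converging pointwise to the indicator of \<open>x < 1/2\<close>: they turn multiplication by
  a bounded function into multiplication by the indicator functions of its level sets.
\<close>

lemma sharp_polynomial_tendsto:
  fixes x :: real
  assumes "0 \<le> x" "x \<le> 1"
  shows "x < 1 / 2 \<Longrightarrow> (\<lambda>k. (1 - x ^ k) ^ (2 ^ k)) \<longlonglongrightarrow> 1"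
    and "x > 1 / 2 \<Longrightarrow> (\<lambda>k. (1 - x ^ k) ^ (2 ^ k)) \<longlonglongrightarrow> 0"
proof -
  have x1: "x ^ k \<le> 1" "0 \<le> x ^ k" for k using assms by (auto intro: power_le_one)
  assume "x < 1 / 2"
  then have "(\<lambda>k. (2 * x) ^ k) \<longlonglongrightarrow> 0" using assms by (intro LIMSEQ_power_zero) simp
  from tendsto_diff[OF tendsto_const[of 1] this] have l: "(\<lambda>k. 1 - (2 * x) ^ k) \<longlonglongrightarrow> 1" by simp
  have "1 - (2 * x) ^ k \<le> (1 - x ^ k) ^ (2 ^ k)" for k
    using Bernoulli_inequality[of "- (x ^ k)" "2 ^ k"] x1[of k] by (simp add: power_mult_distrib)
  moreover have "(1 - x ^ k) ^ (2 ^ k) \<le> 1" for k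
    using x1[of k] by (intro power_le_one) auto
  ultimately show "(\<lambda>k. (1 - x ^ k) ^ (2 ^ k)) \<longlonglongrightarrow> 1"
    by (intro tendsto_sandwich[OF _ _ l tendsto_const]) auto
next
  have x1: "x ^ k \<le> 1" "0 \<le> x ^ k" for k using assms by (auto intro: power_le_one)
  assume x: "x > 1 / 2"
  have l: "(\<lambda>k. inverse ((2 * x) ^ k)) \<longlonglongrightarrow> 0"
    using x by (intro LIMSEQ_inverse_realpow_zero) simp
  have "(1 - x ^ k) ^ (2 ^ k) \<le> inverse ((2 * x) ^ k)" for k
  proof -
    have "(1 - x ^ k) ^ (2 ^ k) \<le> exp (- (x ^ k)) ^ (2 ^ k)"
      using x1[of k] exp_ge_add_one_self[of "- (x ^ k)"] by (intro power_mono) auto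
    also have "\<dots> = exp (- ((2 * x) ^ k))"
      by (simp add: power_mult_distrib flip: exp_of_nat_mult)
    also have "\<dots> \<le> inverse ((2 * x) ^ k)"
      unfolding exp_minus using x exp_ge_add_one_self[of "(2 * x) ^ k"]
      by (intro le_imp_inverse_le) (auto intro: order_trans[OF _ exp_ge_add_one_self])
    finally show ?thesis .
  qed
  then show "(\<lambda>k. (1 - x ^ k) ^ (2 ^ k)) \<longlonglongrightarrow> 0"
    using x1 by (intro tendsto_sandwich[OF _ _ tendsto_const l]) auto
qed

context
  fixes M :: "'x measure" and V :: "('x \<Rightarrow> complex) set"
  assumes V: "closed_subspace_L2 M V"
begin

lemma multipliers_const: "(\<lambda>x. c) \<in> multipliers M V"
  using closed_subspace_L2D(4)[OF V] by (auto simp: multipliers_def)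

lemma multipliers_add:
  assumes "\<phi> \<in> multipliers M V" "\<psi> \<in> multipliers M V"
  shows "(\<lambda>x. \<phi> x + \<psi> x) \<in> multipliers M V"
proof -
  obtain C D where "\<forall>x\<in>space M. cmod (\<phi> x) \<le> C" "\<forall>x\<in>space M. cmod (\<psi> x) \<le> D"
    using assms by (auto simp: multipliers_def)
  then have "\<forall>x\<in>space M. cmod (\<phi> x + \<psi> x) \<le> C + D"
    by (meson norm_add_rule_thm)
  then show ?thesis
    using assms closed_subspace_L2D(3)[OF V] by (auto simp: multipliers_def distrib_right)
qed

lemma multipliers_mult:
  assumes "\<phi> \<in> multipliers M V" "\<psi> \<in> multipliers M V"
  shows "(\<lambda>x. \<phi> x * \<psi> x) \<in> multipliers M V"
proof -
  obtain C D where *: "\<forall>x\<in>space M. cmod (\<phi> x) \<le> C" "\<forall>x\<in>space M. cmod (\<psi> x) \<le> D"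
    using assms by (auto simp: multipliers_def)
  have "\<forall>x\<in>space M. cmod (\<phi> x * \<psi> x) \<le> C * D"
  proof
    fix x assume "x \<in> space M"
    then have "cmod (\<phi> x) \<le> C" "cmod (\<psi> x) \<le> D" using * by auto
    then show "cmod (\<phi> x * \<psi> x) \<le> C * D"
      using mult_mono[of "cmod (\<phi> x)" C "cmod (\<psi> x)" D] norm_ge_zero[of "\<phi> x"]
      by (auto simp: norm_mult intro: order_trans)
  qed
  then show ?thesis
    using assms by (auto simp: multipliers_def mult.assoc)
qed

lemma multipliers_diff:
  assumes "\<phi> \<in> multipliers M V" "\<psi> \<in> multipliers M V"
  shows "(\<lambda>x. \<phi> x - \<psi> x) \<in> multipliers M V"
  using multipliers_add[OF assms(1) multipliers_mult[OF multipliers_const[of "-1"] assms(2)]] by simp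

lemma multipliers_power:
  assumes "\<phi> \<in> multipliers M V"
  shows "(\<lambda>x. \<phi> x ^ k) \<in> multipliers M V"
  by (induction k) (auto intro: multipliers_const multipliers_mult assms)

lemma multipliers_cong:
  assumes "\<phi> \<in> multipliers M V" "\<And>x. x \<in> space M \<Longrightarrow> \<phi> x = \<psi> x"
  shows "\<psi> \<in> multipliers M V"
proof -
  have [measurable]: "\<psi> \<in> borel_measurable M"
    using assms measurable_cong[of M \<phi> \<psi>] by (auto simp: multipliers_def)
  obtain C where C: "\<forall>x\<in>space M. cmod (\<psi> x) \<le> C"
    using assms by (auto simp: multipliers_def)
  have "(\<lambda>x. \<psi> x * f x) \<in> V" if "f \<in> V" for f
  proof (rule closed_subspace_AE[OF V])
    show "(\<lambda>x. \<phi> x * f x) \<in> V" using assms(1) that by (auto simp: multipliers_def)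
    show "(\<lambda>x. \<psi> x * f x) \<in> L2 M"
      using that closed_subspace_L2D(1)[OF V] C by (intro L2_mult_bounded[where C = C]) auto
  qed (use assms(2) in auto)
  then show ?thesis using C by (auto simp: multipliers_def)
qed

text \<open>For each f in V this is dominated convergence with dominating function C^2 |f|^2; the
  uniform bound C also passes to the limit.\<close>

lemma multipliers_limit:
  assumes \<phi>: "\<And>i::nat. \<phi> i \<in> multipliers M V"
    and bound: "\<And>i x. x \<in> space M \<Longrightarrow> cmod (\<phi> i x) \<le> C"
    and lim: "\<And>x. x \<in> space M \<Longrightarrow> (\<lambda>i. \<phi> i x) \<longlonglongrightarrow> \<psi> x"
  shows "\<psi> \<in> multipliers M V"
proof -
  have m: "\<phi> i \<in> borel_measurable M" for i using \<phi> by (auto simp: multipliers_def)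
  have [measurable]: "\<psi> \<in> borel_measurable M"
    by (rule borel_measurable_LIMSEQ_metric[OF m lim])
  have C: "cmod (\<psi> x) \<le> C" if "x \<in> space M" for x
    by (rule LIMSEQ_le_const2[OF tendsto_norm[OF lim[OF that]]]) (use bound that in auto)
  have "(\<lambda>x. \<psi> x * f x) \<in> V" if f: "f \<in> V" for f
  proof (rule closed_subspace_limit[OF V, where F = "\<lambda>i x. \<phi> i x * f x" and w = "\<lambda>x. C\<^sup>2 * (cmod (f x))\<^sup>2"])
    have fL: "f \<in> L2 M" using f closed_subspace_L2D(1)[OF V] by auto
    show "(\<lambda>x. \<phi> i x * f x) \<in> V" for i using \<phi>[of i] f by (auto simp: multipliers_def)
    show "(\<lambda>x. \<psi> x * f x) \<in> borel_measurable M" using L2D[OF fL] by auto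
    show "integrable M (\<lambda>x. C\<^sup>2 * (cmod (f x))\<^sup>2)" using L2D[OF fL] by auto
    show "AE x in M. (\<lambda>i. \<phi> i x * f x) \<longlonglongrightarrow> \<psi> x * f x"
      using lim by (intro AE_I2 tendsto_mult) auto
    show "AE x in M. (cmod (\<phi> i x * f x))\<^sup>2 \<le> C\<^sup>2 * (cmod (f x))\<^sup>2" for i
      by (auto intro!: AE_I2 mult_mono power_mono bound simp: norm_mult power_mult_distrib)
  qed
  then show ?thesis using C by (auto simp: multipliers_def)
qed

text \<open>1 - (1 - w^2)^k stays in [0, 1] and tends to 0 where w = 0 and to 1 elsewhere. Treating
  the zero set separately spares the sharp polynomials the point 1/2, where they tend to
  1/e.\<close>

lemma mult_sets_nonzero:
  assumes w: "(\<lambda>x. of_real (w x)) \<in> multipliers M V" and b: "\<And>x. x \<in> space M \<Longrightarrow> \<bar>w x\<bar> \<le> (1::real)"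
  shows "(\<lambda>x. of_real (indicator {x. w x \<noteq> 0} x)) \<in> multipliers M V"
proof (rule multipliers_limit[where \<phi> = "\<lambda>k x. 1 - (1 - of_real (w x) ^ 2) ^ k" and C = 1])
  show "(\<lambda>x. 1 - (1 - complex_of_real (w x) ^ 2) ^ k) \<in> multipliers M V" for k
    by (intro multipliers_diff multipliers_const multipliers_power w)
  fix x assume x: "x \<in> space M"
  have w1: "(w x)\<^sup>2 \<le> 1" using b[OF x] by (simp add: abs_square_le_1)
  have eq: "1 - (1 - complex_of_real (w x) ^ 2) ^ k = of_real (1 - (1 - (w x)\<^sup>2) ^ k)" for k by simp
  have "(1 - (w x)\<^sup>2) ^ k \<le> 1" "0 \<le> (1 - (w x)\<^sup>2) ^ k" for k
    using w1 by (auto intro: power_le_one)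
  then have "\<bar>1 - (1 - (w x)\<^sup>2) ^ k\<bar> \<le> 1" for k by (smt (verit))
  then show "cmod (1 - (1 - complex_of_real (w x) ^ 2) ^ k) \<le> 1" for k
    unfolding eq norm_of_real .
  show "(\<lambda>k. 1 - (1 - complex_of_real (w x) ^ 2) ^ k) \<longlonglongrightarrow> of_real (indicator {x. w x \<noteq> 0} x)"
  proof (cases "w x = 0")
    case False
    then have "(w x)\<^sup>2 > 0" by simp
    then have "(\<lambda>k. (1 - (w x)\<^sup>2) ^ k) \<longlonglongrightarrow> 0" using w1 by (intro LIMSEQ_power_zero) simp
    from tendsto_diff[OF tendsto_const[of 1] this]
    have "(\<lambda>k. 1 - (1 - (w x)\<^sup>2) ^ k) \<longlonglongrightarrow> 1" by simp
    from tendsto_of_real[OF this, where 'a = complex] show ?thesis unfolding eq using False by simp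
  qed simp
qed

text \<open>The substitution (1 - w) / 2 carries w > 0 to values below 1/2 and w < 0 to values
  above; the factor supported on w \<noteq> 0 settles the remaining point.\<close>

lemma mult_sets_positive:
  assumes w: "(\<lambda>x. of_real (w x)) \<in> multipliers M V" and b: "\<And>x. x \<in> space M \<Longrightarrow> \<bar>w x\<bar> \<le> (1::real)"
  shows "(\<lambda>x. of_real (indicator {x. w x > 0} x)) \<in> multipliers M V"
proof (rule multipliers_limit[where C = 1 and
    \<phi> = "\<lambda>k x. (1 - ((1 - of_real (w x)) * (1 / 2)) ^ k) ^ (2 ^ k) * of_real (indicator {x. w x \<noteq> 0} x)"])
  show "(\<lambda>x. (1 - ((1 - complex_of_real (w x)) * (1 / 2)) ^ k) ^ (2 ^ k) * of_real (indicator {x. w x \<noteq> 0} x))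
     \<in> multipliers M V" for k
    by (intro multipliers_diff multipliers_const multipliers_power multipliers_mult mult_sets_nonzero w b)
  fix x assume x: "x \<in> space M"
  define z where "z = (1 - w x) / 2"
  have z: "0 \<le> z" "z \<le> 1" using b[OF x] by (auto simp: z_def)
  have eq: "(1 - ((1 - complex_of_real (w x)) * (1 / 2)) ^ k) ^ (2 ^ k) * of_real (indicator {x. w x \<noteq> 0} x)
    = of_real ((1 - z ^ k) ^ (2 ^ k) * indicator {x. w x \<noteq> 0} x)" for k
    by (simp add: z_def)
  have "z ^ k \<le> 1" "0 \<le> z ^ k" for k using z by (auto intro: power_le_one)
  then have "\<bar>(1 - z ^ k) ^ (2 ^ k)\<bar> \<le> 1" for k
    by (simp add: power_le_one power_abs)
  then show "cmod ((1 - ((1 - complex_of_real (w x)) * (1 / 2)) ^ k) ^ (2 ^ k) * of_real (indicator {x. w x \<noteq> 0} x)) \<le> 1" for k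
    unfolding eq norm_of_real by (simp add: indicator_def)
  consider "w x = 0" | "w x > 0" | "w x < 0" by linarith
  then have "(\<lambda>k. (1 - z ^ k) ^ (2 ^ k) * indicator {x. w x \<noteq> 0} x :: real) \<longlonglongrightarrow> indicator {x. w x > 0} x"
  proof cases
    case 2
    then have "z < 1 / 2" by (simp add: z_def)
    with sharp_polynomial_tendsto(1)[OF z] 2 show ?thesis by simp
  next
    case 3
    then have "z > 1 / 2" by (simp add: z_def)
    with sharp_polynomial_tendsto(2)[OF z] 3 show ?thesis by simp
  qed simp
  then show "(\<lambda>k. (1 - ((1 - complex_of_real (w x)) * (1 / 2)) ^ k) ^ (2 ^ k) * of_real (indicator {x. w x \<noteq> 0} x))
     \<longlonglongrightarrow> of_real (indicator {x. w x > 0} x)"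
    unfolding eq by (rule tendsto_of_real)
qed

text \<open>As u may be unbounded, its level sets are reached through sin((u - a) / N), a
  combination of the characters cis(s u): once N exceeds |u - a| / \<pi>, it has the sign of u -
  a.\<close>

lemma mult_sets_greater:
  assumes u: "u \<in> borel_measurable M"
    and cis: "\<And>s. (\<lambda>x. cis (s * u x)) \<in> multipliers M V"
  shows "{x \<in> space M. a < u x} \<in> mult_sets M V"
proof -
  define w where "w N x = sin ((u x - a) / real (Suc N))" for N x
  have "(\<lambda>x. of_real (indicator {x. w N x > 0} x)) \<in> multipliers M V" for N
  proof (rule mult_sets_positive)
    let ?s = "1 / real (Suc N)"
    \<comment> \<open>sin v = (e^(iv) - e^(-iv)) (-i/2) with v = (u - a) /
      \<open>Suc N\<close>.\<close>
    have "(\<lambda>x. (cis (?s * u x) * cis (- (?s * a)) - cis (- ?s * u x) * cis (?s * a)) * (- \<i> / 2))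
        \<in> multipliers M V"
      by (intro multipliers_diff multipliers_const multipliers_mult cis)
    moreover have "(cis (?s * u x) * cis (- (?s * a)) - cis (- ?s * u x) * cis (?s * a)) * (- \<i> / 2)
       = of_real (w N x)" for x
    proof -
      define v where "v = (u x - a) / real (Suc N)"
      have e: "?s * u x + - (?s * a) = v" "- ?s * u x + ?s * a = - v"
        by (simp_all add: v_def diff_divide_distrib)
      show ?thesis unfolding cis_mult e w_def v_def[symmetric] by (simp add: complex_eq_iff)
    qed
    ultimately show "(\<lambda>x. of_real (w N x)) \<in> multipliers M V" by simp
  qed (simp add: w_def)
  then have "(\<lambda>x. of_real (indicator {x. a < u x} x)) \<in> multipliers M V"
  proof (rule multipliers_limit[where C = 1])
    fix x
    have "(\<lambda>N. (u x - a) / real (Suc N)) \<longlonglongrightarrow> 0"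
      by (intro LIMSEQ_Suc[OF lim_const_over_n])
    then have "\<forall>\<^sub>F N in sequentially. \<bar>(u x - a) / real (Suc N)\<bar> < pi"
      by (rule order_tendstoD(2)[OF tendsto_rabs_zero]) simp
    then have "\<forall>\<^sub>F N in sequentially. complex_of_real (indicator {x. w N x > 0} x) = of_real (indicator {x. a < u x} x)"
    proof eventually_elim
      case (elim N)
      have "sin ((u x - a) / real (Suc N)) > 0 \<longleftrightarrow> (u x - a) / real (Suc N) > 0"
        using elim sin_gt_zero[of "(u x - a) / real (Suc N)"] sin_ge_zero[of "- ((u x - a) / real (Suc N))"]
        unfolding sin_minus by (smt (verit))
      also have "\<dots> \<longleftrightarrow> a < u x" by (simp add: zero_less_divide_iff)
      finally show ?case by (simp add: w_def indicator_def)
    qed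
    then show "(\<lambda>N. complex_of_real (indicator {x. w N x > 0} x)) \<longlonglongrightarrow> of_real (indicator {x. a < u x} x)"
      by (rule tendsto_eventually)
  qed (auto simp: indicator_def)
  from multipliers_cong[OF this] show ?thesis
    using u by (simp add: mult_sets_def indicator_def)
qed

lemma sigma_algebra_mult_sets: "sigma_algebra (space M) (mult_sets M V)"
  unfolding sigma_algebra_iff2
proof (intro conjI ballI allI impI)
  show "mult_sets M V \<subseteq> Pow (space M)"
    using sets.sets_into_space by (auto simp: mult_sets_def)
  show "{} \<in> mult_sets M V"
    using multipliers_const[of 0] by (simp add: mult_sets_def)
  show "space M - A \<in> mult_sets M V" if "A \<in> mult_sets M V" for A
  proof -
    have "(\<lambda>x. 1 - of_real (indicator A x)) \<in> multipliers M V"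
      using that by (intro multipliers_diff multipliers_const) (auto simp: mult_sets_def)
    then have "(\<lambda>x. of_real (indicator (space M - A) x)) \<in> multipliers M V"
      by (rule multipliers_cong) (auto simp: indicator_def)
    then show ?thesis using that by (auto simp: mult_sets_def)
  qed
  fix A :: "nat \<Rightarrow> 'x set" assume A: "range A \<subseteq> mult_sets M V"
  let ?B = "\<lambda>n. \<Union>i<n. A i"
  have B: "(\<lambda>x. of_real (indicator (?B n) x)) \<in> multipliers M V" for n
  proof (induction n)
    case 0
    then show ?case using multipliers_const[of 0] by simp
  next
    case (Suc n)
    \<comment> \<open>The indicator of a union is 1 - (1 - 1_A)(1 - 1_B), which stays within the
      algebra of multipliers.\<close>
    have "(\<lambda>x. 1 - (1 - of_real (indicator (?B n) x)) * (1 - of_real (indicator (A n) x))) \<in> multipliers M V"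
      using Suc A by (intro multipliers_diff multipliers_mult multipliers_const) (auto simp: mult_sets_def)
    then show ?case by (rule multipliers_cong) (auto simp: indicator_def less_Suc_eq)
  qed
  have "(\<lambda>x. of_real (indicator (\<Union>i. A i) x)) \<in> multipliers M V"
  proof (rule multipliers_limit[OF B, where C = 1])
    fix x
    have "(\<lambda>n. indicator (?B n) x :: real) \<longlonglongrightarrow> indicator (\<Union>i. A i) x"
      by (rule LIMSEQ_indicator_UN)
    then show "(\<lambda>n. complex_of_real (indicator (?B n) x)) \<longlonglongrightarrow> of_real (indicator (\<Union>i. A i) x)"
      by (rule tendsto_of_real)
  qed (auto simp: indicator_def)
  then show "(\<Union>i. A i) \<in> mult_sets M V"
    using A by (auto simp: mult_sets_def)
qed

text \<open>A carrier for this \<sigma>-algebra, so that membership of all level sets of a function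
  can be stated, and composed, as Borel measurability.\<close>

definition mult_measure :: "'x measure" where
  "mult_measure = sigma (space M) (mult_sets M V)"

lemma space_mult_measure [simp]: "space mult_measure = space M"
  using sigma_algebra_mult_sets by (simp add: mult_measure_def sigma_algebra_iff2)

lemma sets_mult_measure: "sets mult_measure = mult_sets M V"
  unfolding mult_measure_def
  by (rule sigma_algebra.sets_measure_of_eq[OF sigma_algebra_mult_sets])

lemma borel_measurable_mult_measure:
  fixes u :: "'x \<Rightarrow> real"
  assumes "u \<in> borel_measurable M" "\<And>s. (\<lambda>x. cis (s * u x)) \<in> multipliers M V"
  shows "u \<in> borel_measurable mult_measure"
  unfolding borel_measurable_iff_greater
  using mult_sets_greater[OF assms] by (simp add: sets_mult_measure)

text \<open>An unbounded \<phi> is no multiplier itself, but its simple approximations F are. They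
  satisfy |F| \<le> 2 |\<phi>|, so the squares |F f|^2 are dominated by 4 |\<phi> f|^2.\<close>

lemma closed_subspace_mult_measurable:
  assumes full: "mult_sets M V = sets M" and f: "f \<in> V"
    and \<phi>: "\<phi> \<in> borel_measurable M" and \<phi>f: "(\<lambda>x. \<phi> x * f x) \<in> L2 M"
  shows "(\<lambda>x. \<phi> x * f x) \<in> V"
proof -
  have fL: "f \<in> L2 M" using f closed_subspace_L2D(1)[OF V] by auto
  obtain F where F: "\<And>i. simple_function M (F i)" "\<And>x. x \<in> space M \<Longrightarrow> (\<lambda>i. F i x) \<longlonglongrightarrow> \<phi> x"
    "\<And>i x. x \<in> space M \<Longrightarrow> dist (F i x) 0 \<le> 2 * dist (\<phi> x) 0"
    using borel_measurable_implies_sequence_metric[OF \<phi>, of 0] by blast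
  have "(\<lambda>x. F i x * f x) \<in> V" for i
  proof -
    let ?R = "F i ` space M" and ?A = "\<lambda>c. F i -` {c} \<inter> space M"
    have fin: "finite ?R" and meas: "\<And>c. c \<in> ?R \<Longrightarrow> ?A c \<in> sets M"
      using F(1)[of i] by (auto simp: simple_function_def)
    have "(\<lambda>x. \<Sum>c\<in>C. c * of_real (indicator (?A c) x)) \<in> multipliers M V" if "finite C" "C \<subseteq> ?R" for C
      using that
    proof (induction C)
      case empty
      then show ?case using multipliers_const[of 0] by simp
    next
      case (insert c C)
      have "?A c \<in> mult_sets M V" using meas insert.prems full by simp
      then show ?case using insert
        by (auto intro!: multipliers_add multipliers_mult multipliers_const simp: mult_sets_def)
    qed
    from this[OF fin subset_refl] have "F i \<in> multipliers M V"
    proof (rule multipliers_cong)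
      fix x assume x: "x \<in> space M"
      have "(\<Sum>c\<in>?R. c * of_real (indicator (?A c) x)) = (\<Sum>c\<in>?R. if c = F i x then c else 0)"
        using x by (intro sum.cong) (auto simp: indicator_def)
      also have "\<dots> = F i x" using fin x by (simp add: sum.delta)
      finally show "(\<Sum>c\<in>?R. c * complex_of_real (indicator (?A c) x)) = F i x" .
    qed
    with f show ?thesis by (auto simp: multipliers_def)
  qed
  then show ?thesis
  proof (rule closed_subspace_limit[OF V, where w = "\<lambda>x. 4 * (cmod (\<phi> x * f x))\<^sup>2"])
    show "AE x in M. (\<lambda>i. F i x * f x) \<longlonglongrightarrow> \<phi> x * f x"
      using F(2) by (intro AE_I2 tendsto_mult) auto
    show "AE x in M. (cmod (F i x * f x))\<^sup>2 \<le> 4 * (cmod (\<phi> x * f x))\<^sup>2" for i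
    proof (rule AE_I2)
      fix x assume "x \<in> space M"
      then have "cmod (F i x) \<le> 2 * cmod (\<phi> x)" using F(3) by simp
      then have "(cmod (F i x))\<^sup>2 \<le> (2 * cmod (\<phi> x))\<^sup>2" by (intro power_mono) auto
      then have "(cmod (F i x))\<^sup>2 * (cmod (f x))\<^sup>2 \<le> (2 * cmod (\<phi> x))\<^sup>2 * (cmod (f x))\<^sup>2"
        by (rule mult_right_mono) simp
      then show "(cmod (F i x * f x))\<^sup>2 \<le> 4 * (cmod (\<phi> x * f x))\<^sup>2"
        by (simp add: norm_mult power_mult_distrib)
    qed
  qed (use \<phi>f L2D[OF \<phi>f] in auto)
qed

end

section \<open>Unitriangular matrices and the decomposition of the group\<close>

definition unitri :: "int \<Rightarrow> nat \<Rightarrow> (int \<times> int) set \<Rightarrow> imat set" where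
  "unitri m n P = {a. \<forall>i j. (i, j) \<notin> P \<longrightarrow> a i j = Imat m n i j}"

text \<open>On the group this is the homomorphism that forgets the upper right block. Its kernel is
  \<open>B_rect\<close> and its image consists of the matrices \<open>sect m n x\<close>, so it
  realises the quotient by \<open>B_rect\<close>.\<close>

definition diag_part :: "int \<Rightarrow> imat \<Rightarrow> imat" where
  "diag_part m a = (\<lambda>i j. if i \<le> m \<and> m < j then 0 else a i j)"

text \<open>A second homomorphism, onto the factor of the lower right block: by triangularity the
  rows of index > m have no entries in columns \<le> m.\<close>

definition lower_part :: "int \<Rightarrow> nat \<Rightarrow> imat \<Rightarrow> imat" where
  "lower_part m n a = (\<lambda>i j. if i \<le> m then Imat m n i j else a i j)"

definition coords_of :: "int \<Rightarrow> nat \<Rightarrow> imat \<Rightarrow> coords" where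
  "coords_of m n a = (\<lambda>p\<in>Delta_X m n. a (fst p) (snd p))"

text \<open>Polynomial constructions on matrices are carried out once, over an arbitrary ring of
  functions containing the constants, and then instantiated with measurable functions, continuous
  functions and functions converging along a given sequence.\<close>

definition fun_algebra :: "('z \<Rightarrow> real) set \<Rightarrow> bool" where
  "fun_algebra C \<longleftrightarrow> (\<forall>c. (\<lambda>_. c) \<in> C) \<and>
     (\<forall>f\<in>C. \<forall>g\<in>C. (\<lambda>z. f z + g z) \<in> C \<and> (\<lambda>z. f z * g z) \<in> C)"

lemma fun_algebraD:
  assumes "fun_algebra C"
  shows "(\<lambda>_. c) \<in> C" "f \<in> C \<Longrightarrow> g \<in> C \<Longrightarrow> (\<lambda>z. f z + g z) \<in> C"
    "f \<in> C \<Longrightarrow> g \<in> C \<Longrightarrow> (\<lambda>z. f z * g z) \<in> C"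
  using assms by (auto simp: fun_algebra_def)

lemma fun_algebra_uminus: "fun_algebra C \<Longrightarrow> f \<in> C \<Longrightarrow> (\<lambda>z. - f z) \<in> C"
  using fun_algebraD(3)[of C "\<lambda>_. -1" f] fun_algebraD(1)[of C "-1"] by simp

lemma fun_algebra_diff: "fun_algebra C \<Longrightarrow> f \<in> C \<Longrightarrow> g \<in> C \<Longrightarrow> (\<lambda>z. f z - g z) \<in> C"
  using fun_algebraD(2)[of C f "\<lambda>z. - g z"] fun_algebra_uminus[of C g] by simp

lemma fun_algebra_sum:
  assumes "fun_algebra C" "\<And>i. i \<in> I \<Longrightarrow> f i \<in> C"
  shows "(\<lambda>z. \<Sum>i\<in>I. f i z) \<in> C"
  using assms(2)
  by (induction I rule: infinite_finite_induct) (auto intro: fun_algebraD[OF assms(1)])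

lemma fun_algebra_borel_measurable: "fun_algebra (borel_measurable M)"
  by (auto simp: fun_algebra_def)

lemma fun_algebra_continuous_on:
  "fun_algebra {f. continuous_on A (f :: 'z::topological_space \<Rightarrow> real)}"
  by (auto simp: fun_algebra_def intro: continuous_intros)

text \<open>Entries of the right inverse of a unitriangular matrix: the equation at (i, j) is solved
  for the (i, j) entry by entries of the same column closer to the diagonal.\<close>

function back_subst :: "imat \<Rightarrow> int \<Rightarrow> int \<Rightarrow> real" where
  "back_subst a i j =
     (if i \<ge> j then (if i = j then 1 else 0) else - (\<Sum>l\<in>{i<..j}. a i l * back_subst a l j))"
  by auto
termination by (relation "Wellfounded.measure (\<lambda>(a, i, j). nat (j - i))") auto

declare back_subst.simps [simp del]

section \<open>The group of unitriangular matrices\<close>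

context
  fixes m :: int and n :: nat
begin

lemma finite_idx [simp]: "finite (idx m n)"
  by (simp add: idx_def)

lemma Delta_subset_Delta_all:
  "Delta_rect m n \<subseteq> Delta_all m n" "Delta_sub m n \<subseteq> Delta_all m n"
  "Delta_sup m n \<subseteq> Delta_all m n" "Delta_X m n \<subseteq> Delta_all m n"
  by (auto simp: Delta_rect_def Delta_sub_def Delta_sup_def Delta_X_def Delta_all_def)

lemma finite_Delta_all: "finite (Delta_all m n)"
  by (rule finite_subset[of _ "idx m n \<times> idx m n"]) (auto simp: Delta_all_def idx_def)

lemma finite_Delta_X [simp]: "finite (Delta_X m n)"
  using finite_subset[OF Delta_subset_Delta_all(4) finite_Delta_all] .

lemma mem_Delta_X:
  "(i, j) \<in> Delta_X m n \<longleftrightarrow> m - int n \<le> i \<and> i < j \<and> j \<le> m + int n + 1 \<and> \<not> (i \<le> m \<and> m < j)"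
  by (auto simp: Delta_X_def Delta_sub_def Delta_sup_def)

lemma mem_Delta_sub: "(i, j) \<in> Delta_sub m n \<longleftrightarrow> m + 1 \<le> i \<and> i < j \<and> j \<le> m + int n + 1"
  by (simp add: Delta_sub_def)

lemma mem_Delta_sup: "(i, j) \<in> Delta_sup m n \<longleftrightarrow> m - int n \<le> i \<and> i < j \<and> j \<le> m"
  by (simp add: Delta_sup_def)

lemma unip_apply:
  assumes "P \<subseteq> Delta_all m n"
  shows "unip m n P x i j = (if (i, j) \<in> P then x (i, j) else Imat m n i j)"
proof -
  have fin: "finite P" using assms finite_Delta_all by (rule finite_subset)
  have "(\<Sum>(k, r)\<in>P. x (k, r) * E k r i j) = (\<Sum>p\<in>P. if p = (i, j) then x p else 0)"
    by (intro sum.cong) (auto simp: E_def split: prod.splits)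
  also have "\<dots> = (if (i, j) \<in> P then x (i, j) else 0)" using fin by (simp add: sum.delta)
  finally show ?thesis
    using assms by (auto simp: unip_def Imat_def Delta_all_def)
qed

lemma range_unip:
  assumes "P \<subseteq> Delta_all m n"
  shows "range (unip m n P) = unitri m n P"
proof
  show "range (unip m n P) \<subseteq> unitri m n P"
    using assms by (auto simp: unitri_def unip_apply)
  show "unitri m n P \<subseteq> range (unip m n P)"
  proof
    fix a assume a: "a \<in> unitri m n P"
    have "a = unip m n P (\<lambda>(i, j). a i j)"
      using a by (auto simp: unip_apply[OF assms] unitri_def fun_eq_iff)
    then show "a \<in> range (unip m n P)" by blast
  qed
qed

lemma carrier_G: "carrier (G m n) = unitri m n (Delta_all m n)"
  and mult_G: "a \<otimes>\<^bsub>G m n\<^esub> b = mmul m n a b"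
  and one_G: "\<one>\<^bsub>G m n\<^esub> = Imat m n"
  by (simp_all add: G_def range_unip)

lemma unip_in_carrier: "P \<subseteq> Delta_all m n \<Longrightarrow> unip m n P x \<in> carrier (G m n)"
  by (auto simp: carrier_G unitri_def unip_apply)

lemma B_rect_eq: "B_rect m n = unitri m n (Delta_rect m n)"
  unfolding B_rect_def by (rule range_unip[OF Delta_subset_Delta_all(1)])

lemma carrier_apply:
  assumes "a \<in> carrier (G m n)"
  shows "i \<in> idx m n \<Longrightarrow> a i i = 1" "j < i \<Longrightarrow> a i j = 0" "i \<notin> idx m n \<Longrightarrow> a i j = 0"
    "j \<notin> idx m n \<Longrightarrow> a i j = 0"
  using assms by (auto simp: carrier_G unitri_def Delta_all_def Imat_def idx_def)

lemma carrierI: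
  assumes "\<And>i. i \<in> idx m n \<Longrightarrow> a i i = 1" "\<And>i j. j < i \<Longrightarrow> a i j = 0"
    "\<And>i j. i \<notin> idx m n \<Longrightarrow> a i j = 0" "\<And>i j. j \<notin> idx m n \<Longrightarrow> a i j = 0"
  shows "a \<in> carrier (G m n)"
  unfolding carrier_G unitri_def
proof (intro CollectI allI impI)
  fix i j assume *: "(i, j) \<notin> Delta_all m n"
  consider "i \<notin> idx m n" | "j \<notin> idx m n" | "i = j" "i \<in> idx m n" | "j < i"
    using * by atomize_elim (auto simp: Delta_all_def idx_def)
  then show "a i j = Imat m n i j"
    by cases (use assms in \<open>auto simp: Imat_def\<close>)
qed

lemma mmul_assoc: "mmul m n (mmul m n a b) c = mmul m n a (mmul m n b c)"
proof (intro ext)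
  fix i j
  have "mmul m n (mmul m n a b) c i j = (\<Sum>l\<in>idx m n. \<Sum>k\<in>idx m n. a i k * b k l * c l j)"
    by (simp add: mmul_def sum_distrib_right)
  also have "\<dots> = (\<Sum>k\<in>idx m n. \<Sum>l\<in>idx m n. a i k * b k l * c l j)" by (rule sum.swap)
  also have "\<dots> = mmul m n a (mmul m n b c) i j"
    by (simp add: mmul_def sum_distrib_left mult.assoc)
  finally show "mmul m n (mmul m n a b) c i j = mmul m n a (mmul m n b c) i j" .
qed

lemma sum_Imat_left: "(\<Sum>l\<in>idx m n. Imat m n i l * f l) = (if i \<in> idx m n then f i else 0)"
proof -
  have "(\<Sum>l\<in>idx m n. Imat m n i l * f l) = (\<Sum>l\<in>idx m n. if l = i then f l else 0)"
    by (intro sum.cong) (auto simp: Imat_def)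
  then show ?thesis by (simp add: sum.delta)
qed

lemma sum_Imat_right: "(\<Sum>l\<in>idx m n. f l * Imat m n l j) = (if j \<in> idx m n then f j else 0)"
proof -
  have "(\<Sum>l\<in>idx m n. f l * Imat m n l j) = (\<Sum>l\<in>idx m n. if l = j then f l else 0)"
    by (intro sum.cong) (auto simp: Imat_def)
  then show ?thesis by (simp add: sum.delta)
qed

lemma Imat_in_carrier: "Imat m n \<in> carrier (G m n)"
  by (auto simp: carrier_G unitri_def)

lemma mmul_Imat:
  assumes "a \<in> carrier (G m n)"
  shows "mmul m n (Imat m n) a = a" "mmul m n a (Imat m n) = a"
  using carrier_apply[OF assms]
  by (auto simp: mmul_def fun_eq_iff sum_Imat_left sum_Imat_right)

lemma mmul_carrier_apply:
  assumes a: "a \<in> carrier (G m n)" and b: "b \<in> carrier (G m n)"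
  shows "mmul m n a b i j = (\<Sum>l\<in>{i..j}. a i l * b l j)"
proof (cases "i \<in> idx m n \<and> j \<in> idx m n")
  case True
  then have "{i..j} \<subseteq> idx m n" by (auto simp: idx_def)
  moreover have "a i l * b l j = 0" if "l \<in> idx m n - {i..j}" for l
    using that carrier_apply(2)[OF a, of l i] carrier_apply(2)[OF b, of j l] by auto
  ultimately show ?thesis unfolding mmul_def
    by (intro sum.mono_neutral_right) auto
next
  case False
  then have "a i l * b l j = 0" for l
    using carrier_apply(3)[OF a, of i l] carrier_apply(4)[OF b, of j l] by auto
  then show ?thesis unfolding mmul_def by (simp only: sum.neutral_const)
qed

lemma mmul_in_carrier:
  assumes a: "a \<in> carrier (G m n)" and b: "b \<in> carrier (G m n)"
  shows "mmul m n a b \<in> carrier (G m n)"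
proof (rule carrierI)
  show "mmul m n a b i i = 1" if "i \<in> idx m n" for i
    using that by (simp add: mmul_carrier_apply[OF a b] carrier_apply[OF a] carrier_apply[OF b])
  show "mmul m n a b i j = 0" if "j < i" for i j
    using that by (simp add: mmul_carrier_apply[OF a b])
  show "mmul m n a b i j = 0" if "i \<notin> idx m n" for i j
    using that by (simp add: mmul_def carrier_apply[OF a])
  show "mmul m n a b i j = 0" if "j \<notin> idx m n" for i j
    using that by (simp add: mmul_def carrier_apply[OF b])
qed

lemma right_inverse_exists:
  assumes a: "a \<in> carrier (G m n)"
  shows "\<exists>b\<in>carrier (G m n). mmul m n a b = Imat m n"
proof
  define b where "b i j = (if i \<in> idx m n \<and> j \<in> idx m n then back_subst a i j else 0)" for i j
  show b: "b \<in> carrier (G m n)"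
    by (rule carrierI) (auto simp: b_def back_subst.simps)
  show "mmul m n a b = Imat m n"
  proof (intro ext)
    fix i j
    show "mmul m n a b i j = Imat m n i j"
    proof (cases "(i, j) \<in> Delta_all m n")
      case False
      then show ?thesis using mmul_in_carrier[OF a b] by (auto simp: carrier_G unitri_def)
    next
      case True
      then have ij: "i < j" "i \<in> idx m n" "j \<in> idx m n" by (auto simp: Delta_all_def idx_def)
      have "mmul m n a b i j = (\<Sum>l\<in>{i..j}. a i l * b l j)" by (rule mmul_carrier_apply[OF a b])
      also have "\<dots> = (\<Sum>l\<in>{i..j}. a i l * back_subst a l j)"
        using ij by (intro sum.cong) (auto simp: b_def idx_def)
      also have "{i..j} = insert i {i<..j}" using ij by auto
      also have "(\<Sum>l\<in>insert i {i<..j}. a i l * back_subst a l j)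
          = back_subst a i j + (\<Sum>l\<in>{i<..j}. a i l * back_subst a l j)"
        using carrier_apply(1)[OF a ij(2)] by simp
      also have "\<dots> = 0" using ij by (subst back_subst.simps) simp
      finally show ?thesis using ij by (simp add: Imat_def)
    qed
  qed
qed

lemma group_G: "group (G m n)"
proof (rule groupI)
  show "\<exists>y\<in>carrier (G m n). y \<otimes>\<^bsub>G m n\<^esub> x = \<one>\<^bsub>G m n\<^esub>" if x: "x \<in> carrier (G m n)" for x
  proof -
    obtain b where b: "b \<in> carrier (G m n)" "mmul m n x b = Imat m n"
      using right_inverse_exists[OF x] by blast
    obtain c where c: "c \<in> carrier (G m n)" "mmul m n b c = Imat m n"
      using right_inverse_exists[OF b(1)] by blast
    \<comment> \<open>A right inverse c of the right inverse b of x equals x, which makes b a left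
      inverse.\<close>
    have "x = mmul m n x (mmul m n b c)" using c mmul_Imat[OF x] by simp
    also have "\<dots> = c" using b mmul_Imat[OF c(1)] by (simp flip: mmul_assoc)
    finally show ?thesis using b(1) c by (auto simp: mult_G one_G)
  qed
qed (simp_all add: mult_G one_G mmul_in_carrier mmul_assoc mmul_Imat Imat_in_carrier)

interpretation G: group "G m n" by (rule group_G)

lemma fun_algebra_mmul:
  assumes C: "fun_algebra C" and "\<And>i j. (\<lambda>z. a z i j) \<in> C" "\<And>i j. (\<lambda>z. b z i j) \<in> C"
  shows "(\<lambda>z. mmul m n (a z) (b z) i j) \<in> C"
  unfolding mmul_def by (intro fun_algebra_sum[OF C] fun_algebraD(3)[OF C] assms)

text \<open>Induction on the distance j - i from the diagonal: an entry of the inverse is minus a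
  sum of products of entries of \<open>a\<close> with entries of the inverse at smaller distance. No
  division occurs since the diagonal is 1.\<close>

lemma fun_algebra_inv:
  assumes C: "fun_algebra C" and a: "\<And>z. a z \<in> carrier (G m n)" and aC: "\<And>i j. (\<lambda>z. a z i j) \<in> C"
  shows "(\<lambda>z. (inv\<^bsub>G m n\<^esub> a z) i j) \<in> C"
proof -
  define b where "b z = inv\<^bsub>G m n\<^esub> a z" for z
  have b: "b z \<in> carrier (G m n)" for z using a by (simp add: b_def)
  have ab: "mmul m n (a z) (b z) = Imat m n" for z
    using G.r_inv[OF a[of z]] by (simp add: b_def mult_G one_G)
  have "(\<lambda>z. b z i j) \<in> C" for i j
  proof (induction "nat (j - i)" arbitrary: i rule: less_induct)
    case less
    show ?case
    proof (cases "(i, j) \<in> Delta_all m n")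
      case False
      then have "(\<lambda>z. b z i j) = (\<lambda>_. Imat m n i j)"
        using b by (auto simp: carrier_G unitri_def fun_eq_iff)
      then show ?thesis using fun_algebraD(1)[OF C] by simp
    next
      case True
      then have ij: "i < j" "i \<in> idx m n" by (auto simp: Delta_all_def idx_def)
      have "b z i j = - (\<Sum>l\<in>{i<..j}. a z i l * b z l j)" for z
      proof -
        have "0 = (\<Sum>l\<in>{i..j}. a z i l * b z l j)"
          using ij mmul_carrier_apply[OF a b, of z z i j] by (simp add: ab Imat_def)
        also have "{i..j} = insert i {i<..j}" using ij by auto
        also have "(\<Sum>l\<in>insert i {i<..j}. a z i l * b z l j) = b z i j + (\<Sum>l\<in>{i<..j}. a z i l * b z l j)"
          using carrier_apply(1)[OF a ij(2)] by simp
        finally show ?thesis by simp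
      qed
      moreover have "(\<lambda>z. - (\<Sum>l\<in>{i<..j}. a z i l * b z l j)) \<in> C"
        using ij by (intro fun_algebra_uminus[OF C] fun_algebra_sum[OF C] fun_algebraD(3)[OF C] aC less) auto
      ultimately show ?thesis by simp
    qed
  qed
  then show ?thesis by (simp add: b_def)
qed

section \<open>Splitting off the upper right block\<close>

lemma diag_part_mmul:
  assumes a: "a \<in> carrier (G m n)" and b: "b \<in> carrier (G m n)"
  shows "diag_part m (mmul m n a b) = mmul m n (diag_part m a) (diag_part m b)"
proof (intro ext)
  fix i j
  show "diag_part m (mmul m n a b) i j = mmul m n (diag_part m a) (diag_part m b) i j"
  proof (cases "i \<le> m \<and> m < j")
    case True
    then have z: "diag_part m a i l * diag_part m b l j = 0" for l
      by (auto simp: diag_part_def)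
    show ?thesis using True by (simp add: mmul_def z) (simp add: diag_part_def)
  next
    case False
    \<comment> \<open>Outside the upper right block, an index l between i and j lies in the same
      block as both; for all other l both products vanish.\<close>
    then have e: "a i l * b l j = diag_part m a i l * diag_part m b l j" for l
      using carrier_apply(2)[OF a, of l i] carrier_apply(2)[OF b, of j l]
      by (auto simp: diag_part_def)
    have "diag_part m (mmul m n a b) i j = (\<Sum>l\<in>idx m n. a i l * b l j)"
      using False by (auto simp: mmul_def diag_part_def)
    then show ?thesis unfolding e by (simp add: mmul_def)
  qed
qed

lemma diag_part_in_carrier: "a \<in> carrier (G m n) \<Longrightarrow> diag_part m a \<in> carrier (G m n)"
  using carrier_apply by (intro carrierI) (auto simp: diag_part_def)

lemma diag_part_idem [simp]: "diag_part m (diag_part m a) = diag_part m a"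
  by (auto simp: diag_part_def fun_eq_iff)

lemma diag_part_Imat [simp]: "diag_part m (Imat m n) = Imat m n"
  by (auto simp: diag_part_def Imat_def fun_eq_iff)

lemma B_rect_iff: "a \<in> B_rect m n \<longleftrightarrow> a \<in> carrier (G m n) \<and> diag_part m a = Imat m n"
proof
  assume "a \<in> B_rect m n"
  then have a: "\<And>i j. (i, j) \<notin> Delta_rect m n \<Longrightarrow> a i j = Imat m n i j"
    by (auto simp: B_rect_eq unitri_def)
  then have "a \<in> carrier (G m n)"
    using Delta_subset_Delta_all(1) by (auto simp: carrier_G unitri_def)
  moreover have "diag_part m a i j = Imat m n i j" for i j
    using a[of i j] by (auto simp: diag_part_def Delta_rect_def Imat_def)
  ultimately show "a \<in> carrier (G m n) \<and> diag_part m a = Imat m n" by (auto simp: fun_eq_iff)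
next
  assume *: "a \<in> carrier (G m n) \<and> diag_part m a = Imat m n"
  have "a i j = Imat m n i j" if "(i, j) \<notin> Delta_rect m n" for i j
  proof (cases "i \<le> m \<and> m < j")
    case True
    with that have "(i, j) \<notin> Delta_all m n" by (auto simp: Delta_rect_def Delta_all_def)
    with * show ?thesis by (auto simp: carrier_G unitri_def)
  next
    case False
    with * show ?thesis by (metis diag_part_def)
  qed
  then show "a \<in> B_rect m n" by (auto simp: B_rect_eq unitri_def)
qed

lemma diag_part_inv:
  assumes a: "a \<in> carrier (G m n)"
  shows "diag_part m (inv\<^bsub>G m n\<^esub> a) = inv\<^bsub>G m n\<^esub> (diag_part m a)"
proof -
  have "diag_part m (inv\<^bsub>G m n\<^esub> a) \<otimes>\<^bsub>G m n\<^esub> diag_part m a = \<one>\<^bsub>G m n\<^esub>"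
    using G.l_inv[OF a] diag_part_mmul[OF G.inv_closed[OF a] a] by (simp add: mult_G one_G)
  then show ?thesis
    by (intro G.inv_equality[symmetric] diag_part_in_carrier G.inv_closed a)
qed

text \<open>The two factors live in complementary diagonal blocks, so their product superposes their
  entries: the first has identity rows up to \<open>m\<close>, the second has identity rows beyond
  \<open>m\<close>.\<close>

lemma sect_eq: "sect m n x = unip m n (Delta_X m n) x"
proof (intro ext)
  fix i j
  note app = unip_apply[OF Delta_subset_Delta_all(2)] unip_apply[OF Delta_subset_Delta_all(3)]
    unip_apply[OF Delta_subset_Delta_all(4)]
  show "sect m n x i j = unip m n (Delta_X m n) x i j"
  proof (cases "i \<le> m")
    case True
    then have "sect m n x i j = (\<Sum>l\<in>idx m n. Imat m n i l * x_sup m n x l j)"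
      by (simp add: sect_def mult_G mmul_def x_sub_def app mem_Delta_sub)
    also have "\<dots> = unip m n (Delta_X m n) x i j"
      using True unfolding sum_Imat_left
      by (auto simp: x_sup_def app mem_Delta_X mem_Delta_sup Imat_def idx_def)
    finally show ?thesis .
  next
    case False
    have e: "x_sub m n x i l * x_sup m n x l j = x_sub m n x i l * Imat m n l j" for l
      using False by (auto simp: x_sub_def x_sup_def app mem_Delta_sub mem_Delta_sup Imat_def)
    have "sect m n x i j = (\<Sum>l\<in>idx m n. x_sub m n x i l * Imat m n l j)"
      by (simp only: sect_def mult_G mmul_def e)
    also have "\<dots> = unip m n (Delta_X m n) x i j"
      using False unfolding sum_Imat_right
      by (auto simp: x_sub_def app mem_Delta_X mem_Delta_sub Imat_def idx_def)
    finally show ?thesis .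
  qed
qed

lemma sect_apply: "sect m n x i j = (if (i, j) \<in> Delta_X m n then x (i, j) else Imat m n i j)"
  by (simp add: sect_eq unip_apply[OF Delta_subset_Delta_all(4)])

lemma sect_in_carrier [simp]: "sect m n x \<in> carrier (G m n)"
  by (simp add: sect_eq unip_in_carrier[OF Delta_subset_Delta_all(4)])

lemma diag_part_sect [simp]: "diag_part m (sect m n x) = sect m n x"
  by (auto simp: fun_eq_iff diag_part_def sect_apply mem_Delta_X Imat_def)

lemma sect_coords_of:
  assumes "a \<in> carrier (G m n)"
  shows "sect m n (coords_of m n a) = diag_part m a"
proof (intro ext)
  fix i j
  show "sect m n (coords_of m n a) i j = diag_part m a i j"
  proof (cases "(i, j) \<in> Delta_X m n")
    case True
    then show ?thesis by (auto simp: sect_apply coords_of_def diag_part_def mem_Delta_X)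
  next
    case False
    then have "i \<le> m \<and> m < j \<or> (i, j) \<notin> Delta_all m n" by (auto simp: mem_Delta_X Delta_all_def)
    with False show ?thesis using assms
      by (auto simp: sect_apply diag_part_def carrier_G unitri_def Imat_def)
  qed
qed

lemma coords_of_in_X [simp]: "coords_of m n a \<in> X m n"
  by (simp add: coords_of_def X_def)

lemma coords_of_sect: "x \<in> X m n \<Longrightarrow> coords_of m n (sect m n x) = x"
  unfolding X_def by (rule PiE_ext[of _ "Delta_X m n" "\<lambda>_. UNIV"]) (auto simp: coords_of_def sect_apply)

text \<open>Existence: s(z) is the block-diagonal part of s(x) t, so the quotient lies in the kernel
  of \<open>diag_part\<close>. Uniqueness: \<open>diag_part\<close> erases any competing h' and
  returns s(z').\<close>

lemma decomp_eq:
  fixes x :: coords and t :: imat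
  assumes t: "t \<in> carrier (G m n)"
  defines "z \<equiv> coords_of m n (sect m n x \<otimes>\<^bsub>G m n\<^esub> t)"
  shows "decomp m n x t = (sect m n x \<otimes>\<^bsub>G m n\<^esub> t \<otimes>\<^bsub>G m n\<^esub> inv\<^bsub>G m n\<^esub> (sect m n z), z)"
    and "sect m n x \<otimes>\<^bsub>G m n\<^esub> t \<otimes>\<^bsub>G m n\<^esub> inv\<^bsub>G m n\<^esub> (sect m n z) \<in> B_rect m n"
proof -
  let ?a = "sect m n x \<otimes>\<^bsub>G m n\<^esub> t" and ?s = "sect m n z"
  let ?h = "?a \<otimes>\<^bsub>G m n\<^esub> inv\<^bsub>G m n\<^esub> ?s"
  have a: "?a \<in> carrier (G m n)" using t by simp
  have s: "?s = diag_part m ?a" unfolding z_def by (rule sect_coords_of[OF a])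
  have ds: "diag_part m ?s = ?s" by (simp add: s)
  show h: "?h \<in> B_rect m n"
    unfolding B_rect_iff
  proof
    have "diag_part m ?h = diag_part m ?a \<otimes>\<^bsub>G m n\<^esub> diag_part m (inv\<^bsub>G m n\<^esub> ?s)"
      unfolding mult_G by (rule diag_part_mmul) (use t mmul_in_carrier in auto)
    also have "\<dots> = ?s \<otimes>\<^bsub>G m n\<^esub> inv\<^bsub>G m n\<^esub> ?s"
      by (simp add: diag_part_inv ds flip: s)
    finally show "diag_part m ?h = Imat m n" by (simp add: one_G)
  qed (use t in simp)
  show "decomp m n x t = (?h, z)"
    unfolding decomp_def
  proof (rule the_equality, safe)
    show "?h \<in> B_rect m n" by (rule h)
    show "z \<in> X m n" by (simp add: z_def)
    show "?a = ?h \<otimes>\<^bsub>G m n\<^esub> ?s" using t by (simp add: G.m_assoc)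
    fix h' z' assume h': "h' \<in> B_rect m n" and z': "z' \<in> X m n" and eq: "?a = h' \<otimes>\<^bsub>G m n\<^esub> sect m n z'"
    have h'c: "h' \<in> carrier (G m n)" using h' by (simp add: B_rect_iff)
    have "diag_part m ?a = mmul m n (diag_part m h') (diag_part m (sect m n z'))"
      using diag_part_mmul[OF h'c sect_in_carrier] eq by (simp add: mult_G)
    also have "\<dots> = sect m n z'" using h' mmul_Imat(1)[OF sect_in_carrier] by (simp add: B_rect_iff)
    finally have "?s = sect m n z'" by (simp add: s)
    then have zz: "z = z'" using coords_of_sect[OF z'] coords_of_sect[of z] by (simp add: z_def)
    then show "z' = z" by simp
    show "h' = ?h" unfolding eq zz using h'c by (simp add: G.m_assoc)
  qed
qed

section \<open>The action on X and its cocycle\<close>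

lemma act_eq: "t \<in> carrier (G m n) \<Longrightarrow> act m n x t = coords_of m n (mmul m n (sect m n x) t)"
  by (simp add: act_def decomp_eq(1) mult_G)

lemma hcoc_eq:
  assumes "t \<in> carrier (G m n)"
  shows "hcoc m n x t = sect m n x \<otimes>\<^bsub>G m n\<^esub> t \<otimes>\<^bsub>G m n\<^esub> inv\<^bsub>G m n\<^esub> (sect m n (act m n x t))"
  using assms by (simp add: hcoc_def act_def decomp_eq(1))

lemma hcoc_in_B_rect: "t \<in> carrier (G m n) \<Longrightarrow> hcoc m n x t \<in> B_rect m n"
  using decomp_eq by (simp add: hcoc_def)

lemma act_in_X [simp]: "t \<in> carrier (G m n) \<Longrightarrow> act m n x t \<in> X m n"
  by (simp add: act_eq)

lemma sect_act:
  assumes "t \<in> carrier (G m n)"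
  shows "sect m n (act m n x t) = mmul m n (sect m n x) (diag_part m t)"
  using assms by (simp add: act_eq sect_coords_of mmul_in_carrier diag_part_mmul)

lemma act_mult:
  assumes s: "s \<in> carrier (G m n)" and t: "t \<in> carrier (G m n)"
  shows "act m n x (s \<otimes>\<^bsub>G m n\<^esub> t) = act m n (act m n x s) t"
proof -
  have "sect m n (act m n x (s \<otimes>\<^bsub>G m n\<^esub> t)) = sect m n (act m n (act m n x s) t)"
    using s t by (simp add: sect_act mult_G diag_part_mmul mmul_assoc mmul_in_carrier)
  then show ?thesis using s t
    by (metis act_in_X coords_of_sect G.m_closed)
qed

lemma act_one: "x \<in> X m n \<Longrightarrow> act m n x (Imat m n) = x"
  by (simp add: act_eq Imat_in_carrier mmul_Imat coords_of_sect)

text \<open>The inner factors, \<open>?u\<close> and its inverse, cancel. Together with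
  \<open>S_char_mult\<close> this cocycle identity makes \<open>T\<close> multiplicative.\<close>

lemma hcoc_mult:
  assumes s: "s \<in> carrier (G m n)" and t: "t \<in> carrier (G m n)"
  shows "hcoc m n x (s \<otimes>\<^bsub>G m n\<^esub> t) = hcoc m n x s \<otimes>\<^bsub>G m n\<^esub> hcoc m n (act m n x s) t"
proof -
  let ?u = "sect m n (act m n x s)"
  have "sect m n x \<otimes>\<^bsub>G m n\<^esub> s \<otimes>\<^bsub>G m n\<^esub> inv\<^bsub>G m n\<^esub> ?u \<otimes>\<^bsub>G m n\<^esub> (?u \<otimes>\<^bsub>G m n\<^esub> t \<otimes>\<^bsub>G m n\<^esub> w)
      = sect m n x \<otimes>\<^bsub>G m n\<^esub> s \<otimes>\<^bsub>G m n\<^esub> (inv\<^bsub>G m n\<^esub> ?u \<otimes>\<^bsub>G m n\<^esub> ?u) \<otimes>\<^bsub>G m n\<^esub> t \<otimes>\<^bsub>G m n\<^esub> w"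
    if "w \<in> carrier (G m n)" for w
    using s t that by (simp only: G.m_assoc G.m_closed sect_in_carrier G.inv_closed)
  then show ?thesis
    using s t by (simp add: hcoc_eq act_mult G.m_assoc)
qed

lemma hcoc_one: "x \<in> X m n \<Longrightarrow> hcoc m n x (Imat m n) = Imat m n"
  using G.r_inv[OF sect_in_carrier]
  by (simp add: hcoc_eq Imat_in_carrier act_one mult_G mmul_Imat one_G)

text \<open>Written as the old coordinate plus a function of coordinates nearer to the diagonal, the
  form that \<open>distr_triangular\<close> expects.\<close>

lemma act_apply:
  assumes t: "t \<in> carrier (G m n)" and p: "(i, j) \<in> Delta_X m n"
  shows "act m n x t (i, j) = x (i, j) + (t i j + (\<Sum>l\<in>{i<..<j}. x (i, l) * t l j))"
proof -
  from p have ij: "i < j" "i \<in> idx m n" "j \<in> idx m n" by (auto simp: mem_Delta_X idx_def)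
  have "act m n x t (i, j) = (\<Sum>l\<in>{i..j}. sect m n x i l * t l j)"
    using p t by (simp add: act_eq coords_of_def mmul_carrier_apply)
  also have "{i..j} = insert i (insert j {i<..<j})" using ij by auto
  also have "(\<Sum>l\<in>insert i (insert j {i<..<j}). sect m n x i l * t l j)
      = sect m n x i i * t i j + (sect m n x i j * t j j + (\<Sum>l\<in>{i<..<j}. sect m n x i l * t l j))"
    using ij by simp
  also have "(\<Sum>l\<in>{i<..<j}. sect m n x i l * t l j) = (\<Sum>l\<in>{i<..<j}. x (i, l) * t l j)"
    using p by (intro sum.cong) (auto simp: sect_apply mem_Delta_X)
  finally show ?thesis
    using p ij carrier_apply(1)[OF t ij(3)] carrier_apply(1)[OF sect_in_carrier ij(2)]
    by (simp add: sect_apply)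
qed

section \<open>The character S and the functions \<open>S_kr\<close>\<close>

lemma pairing_eq: "pairing m n y a = (\<Sum>i\<in>idx m n. \<Sum>l\<in>idx m n. a i l * y l i)"
  by (simp add: pairing_def mtrace_def mmul_def)

text \<open>Two matrices supported on the upper right block have product 0, since that block has
  rows \<le> m and columns > m. So h - I is additive on \<open>B_rect\<close>, which makes
  \<open>S_char\<close> a character.\<close>

lemma B_rect_mult_apply:
  assumes a: "a \<in> B_rect m n" and b: "b \<in> B_rect m n"
  shows "mmul m n a b i j - Imat m n i j = (a i j - Imat m n i j) + (b i j - Imat m n i j)"
proof (cases "(i, j) \<in> Delta_rect m n")
  case False
  have "mmul m n a b \<in> B_rect m n"
    using a b by (simp add: B_rect_iff mmul_in_carrier diag_part_mmul mmul_Imat Imat_in_carrier)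
  with False a b show ?thesis by (auto simp: B_rect_eq unitri_def)
next
  case True
  then have ij: "i \<le> m" "m < j" "i \<in> idx m n" "j \<in> idx m n" by (auto simp: Delta_rect_def idx_def)
  have "a i l * b l j = Imat m n i l * b l j + a i l * Imat m n l j" for l
    using a b ij True by (cases "l \<le> m") (auto simp: B_rect_eq unitri_def Delta_rect_def Imat_def)
  then have "mmul m n a b i j = b i j + a i j"
    using ij by (simp add: mmul_def sum.distrib sum_Imat_left sum_Imat_right)
  then show ?thesis using ij by (simp add: Imat_def)
qed

lemma S_char_eq_cis: "S_char m n y h = cis (2 * pi * pairing m n y (\<lambda>i j. h i j - Imat m n i j))"
  by (simp add: S_char_def cis_conv_exp mult_ac)

lemma S_char_mult:
  assumes "a \<in> B_rect m n" "b \<in> B_rect m n"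
  shows "S_char m n y (mmul m n a b) = S_char m n y a * S_char m n y b"
proof -
  have "pairing m n y (\<lambda>i j. mmul m n a b i j - Imat m n i j)
      = pairing m n y (\<lambda>i j. a i j - Imat m n i j) + pairing m n y (\<lambda>i j. b i j - Imat m n i j)"
    unfolding pairing_eq B_rect_mult_apply[OF assms] distrib_right sum.distrib ..
  then show ?thesis by (simp add: S_char_eq_cis cis_mult distrib_left)
qed

lemma S_char_one: "S_char m n y (Imat m n) = 1"
  by (simp add: S_char_def pairing_eq)

lemma one_param_in_carrier:
  assumes "(k, r) \<in> Delta_all m n"
  shows "one_param m n k r t \<in> carrier (G m n)"
  using assms by (auto simp: carrier_G unitri_def one_param_def E_def)

text \<open>Conjugation by the whole section replaces the product with separate blocks on the left
  and right; for y = \<open>y_functional\<close> both agree on the lower left block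
  (\<open>Phi_eq_block\<close>).\<close>

definition Phi :: "imat \<Rightarrow> coords \<Rightarrow> imat" where
  "Phi y x = mmul m n (mmul m n (inv\<^bsub>G m n\<^esub> (sect m n x)) y) (sect m n x)"

lemma act_one_param_rect:
  assumes kr: "(k, r) \<in> Delta_rect m n" and x: "x \<in> X m n"
  shows "act m n x (one_param m n k r t) = x"
proof -
  have kr': "(k, r) \<in> Delta_all m n" using kr Delta_subset_Delta_all by auto
  have "diag_part m (one_param m n k r t) = Imat m n"
    using kr by (auto simp: diag_part_def one_param_def E_def Delta_rect_def Imat_def fun_eq_iff)
  then have "sect m n (act m n x (one_param m n k r t)) = sect m n x"
    by (simp add: sect_act one_param_in_carrier[OF kr'] mmul_Imat)
  then show ?thesis
    by (metis act_in_X coords_of_sect x one_param_in_carrier[OF kr'])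
qed

text \<open>As I + t E_kr fixes x, h = s (I + t E_kr) s^-1 with s = s(x). Hence h - I = t s E_kr
  s^-1, and tr(s E_kr s^-1 y) is the (r, k) entry of s^-1 y s.\<close>

lemma pairing_hcoc_one_param:
  assumes kr: "(k, r) \<in> Delta_rect m n" and x: "x \<in> X m n"
  shows "pairing m n y (\<lambda>i j. hcoc m n x (one_param m n k r t) i j - Imat m n i j) = t * Phi y x r k"
proof -
  let ?s = "sect m n x" and ?g = "one_param m n k r t"
  let ?u = "inv\<^bsub>G m n\<^esub> ?s"
  have kr': "(k, r) \<in> Delta_all m n" using kr Delta_subset_Delta_all by auto
  then have idx: "k \<in> idx m n" "r \<in> idx m n" by (auto simp: Delta_all_def idx_def)
  have su: "mmul m n ?s ?u = Imat m n" using G.r_inv[OF sect_in_carrier] by (simp add: mult_G one_G)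
  have sg: "mmul m n ?s ?g i l = ?s i l + t * ?s i k * (if l = r then 1 else 0)" for i l
  proof -
    have "mmul m n ?s ?g i l = mmul m n ?s (Imat m n) i l + (\<Sum>q\<in>idx m n. ?s i q * (t * E k r q l))"
      by (simp add: mmul_def one_param_def distrib_left sum.distrib)
    also have "(\<Sum>q\<in>idx m n. ?s i q * (t * E k r q l)) = (\<Sum>q\<in>idx m n. if q = k then t * ?s i k * (if l = r then 1 else 0) else 0)"
      by (intro sum.cong) (auto simp: E_def)
    finally show ?thesis using idx by (simp add: sum.delta mmul_Imat)
  qed
  have "hcoc m n x ?g i j - Imat m n i j = t * ?s i k * ?u r j" for i j
  proof -
    have "hcoc m n x ?g i j = (\<Sum>l\<in>idx m n. mmul m n ?s ?g i l * ?u l j)"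
      using kr' by (simp add: hcoc_eq one_param_in_carrier act_one_param_rect[OF kr x] mult_G mmul_def)
    also have "\<dots> = mmul m n ?s ?u i j + (\<Sum>l\<in>idx m n. if l = r then t * ?s i k * ?u r j else 0)"
      unfolding sg mmul_def[of m n ?s ?u] sum.distrib[symmetric]
      by (intro sum.cong) (auto simp: distrib_right)
    finally show ?thesis using idx by (simp add: sum.delta su)
  qed
  then have "pairing m n y (\<lambda>i j. hcoc m n x ?g i j - Imat m n i j)
      = t * (\<Sum>i\<in>idx m n. \<Sum>l\<in>idx m n. ?u r l * y l i * ?s i k)"
    by (simp add: pairing_eq sum_distrib_left mult_ac)
  also have "\<dots> = t * Phi y x r k"
    by (simp add: Phi_def mmul_def sum_distrib_right)
  finally show ?thesis .
qed

lemma S_coord_eq_Phi: "(k, r) \<in> Delta_rect m n \<Longrightarrow> x \<in> X m n \<Longrightarrow> S_coord m n y k r x = Phi y x r k"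
  by (simp add: S_coord_def pairing_hcoc_one_param)

section \<open>Blocks of the product and Gaussian elimination\<close>

lemma lower_part_in_carrier: "a \<in> carrier (G m n) \<Longrightarrow> lower_part m n a \<in> carrier (G m n)"
  using carrier_apply by (intro carrierI) (auto simp: lower_part_def Imat_def)

lemma lower_part_mmul:
  assumes a: "a \<in> carrier (G m n)" and b: "b \<in> carrier (G m n)"
  shows "lower_part m n (mmul m n a b) = mmul m n (lower_part m n a) (lower_part m n b)"
proof (intro ext)
  fix i j
  show "lower_part m n (mmul m n a b) i j = mmul m n (lower_part m n a) (lower_part m n b) i j"
  proof (cases "i \<le> m")
    case True
    then have "mmul m n (lower_part m n a) (lower_part m n b) i j
        = (\<Sum>l\<in>idx m n. Imat m n i l * lower_part m n b l j)"
      by (simp add: mmul_def lower_part_def[of m n a])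
    with True show ?thesis
      unfolding sum_Imat_left by (simp add: lower_part_def Imat_def)
  next
    case False
    then have e: "a i l * b l j = lower_part m n a i l * lower_part m n b l j" for l
      using carrier_apply(2)[OF a, of l i] by (auto simp: lower_part_def)
    have "lower_part m n (mmul m n a b) i j = (\<Sum>l\<in>idx m n. a i l * b l j)"
      using False by (auto simp: mmul_def lower_part_def)
    then show ?thesis unfolding e by (simp add: mmul_def)
  qed
qed

lemma lower_part_inv:
  assumes a: "a \<in> carrier (G m n)"
  shows "lower_part m n (inv\<^bsub>G m n\<^esub> a) = inv\<^bsub>G m n\<^esub> (lower_part m n a)"
proof -
  have "lower_part m n (Imat m n) = Imat m n" by (auto simp: lower_part_def fun_eq_iff)
  then have "lower_part m n (inv\<^bsub>G m n\<^esub> a) \<otimes>\<^bsub>G m n\<^esub> lower_part m n a = \<one>\<^bsub>G m n\<^esub>"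
    using G.l_inv[OF a] lower_part_mmul[OF G.inv_closed[OF a] a] by (simp add: mult_G one_G)
  then show ?thesis
    by (intro G.inv_equality[symmetric] lower_part_in_carrier G.inv_closed a)
qed

lemma lower_part_sect: "lower_part m n (sect m n x) = x_sub m n x"
  by (auto simp: fun_eq_iff lower_part_def x_sub_def sect_apply mem_Delta_X
      unip_apply[OF Delta_subset_Delta_all(2)] mem_Delta_sub)

lemma mmul_y_functional:
  "mmul m n (mmul m n a (y_functional m n y)) b r k
    = (\<Sum>j = 0..n. a r (m + int j + 1) * y (m + int j + 1) (m - int j) * b (m - int j) k)"
proof -
  have "mmul m n a (y_functional m n y) r i
      = (\<Sum>j = 0..n. if i = m - int j then a r (m + int j + 1) * y (m + int j + 1) (m - int j) else 0)" for i
  proof -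
    have "mmul m n a (y_functional m n y) r i = (\<Sum>j = 0..n. \<Sum>l\<in>idx m n.
        a r l * (y (m + int j + 1) (m - int j) * E (m + int j + 1) (m - int j) l i))"
      unfolding mmul_def y_functional_def sum_distrib_left by (rule sum.swap)
    also have "\<dots> = (\<Sum>j = 0..n. if i = m - int j then a r (m + int j + 1) * y (m + int j + 1) (m - int j) else 0)"
    proof (rule sum.cong)
      fix j assume j: "j \<in> {0..n}"
      have "(\<Sum>l\<in>idx m n. a r l * (y (m + int j + 1) (m - int j) * E (m + int j + 1) (m - int j) l i))
        = (\<Sum>l\<in>idx m n. if l = m + int j + 1 then (if i = m - int j then a r (m + int j + 1) * y (m + int j + 1) (m - int j) else 0) else 0)"
        by (intro sum.cong) (auto simp: E_def)
      also have "\<dots> = (if i = m - int j then a r (m + int j + 1) * y (m + int j + 1) (m - int j) else 0)"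
        using j by (simp add: sum.delta idx_def)
      finally show "(\<Sum>l\<in>idx m n. a r l * (y (m + int j + 1) (m - int j) * E (m + int j + 1) (m - int j) l i))
        = (if i = m - int j then a r (m + int j + 1) * y (m + int j + 1) (m - int j) else 0)" .
    qed simp
    finally show ?thesis .
  qed
  note row = this
  have "mmul m n (mmul m n a (y_functional m n y)) b r k
      = (\<Sum>i\<in>idx m n. mmul m n a (y_functional m n y) r i * b i k)"
    by (rule mmul_def[THEN fun_cong, THEN fun_cong])
  also have "\<dots> = (\<Sum>i\<in>idx m n. \<Sum>j = 0..n.
      if i = m - int j then a r (m + int j + 1) * y (m + int j + 1) (m - int j) * b (m - int j) k else 0)"
    unfolding row sum_distrib_right by (intro sum.cong) auto
  also have "\<dots> = (\<Sum>j = 0..n. \<Sum>i\<in>idx m n.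
      if i = m - int j then a r (m + int j + 1) * y (m + int j + 1) (m - int j) * b (m - int j) k else 0)"
    by (rule sum.swap)
  also have "\<dots> = (\<Sum>j = 0..n. a r (m + int j + 1) * y (m + int j + 1) (m - int j) * b (m - int j) k)"
    by (intro sum.cong) (auto simp: sum.delta idx_def)
  finally show ?thesis .
qed

text \<open>Since r > m, row r of s^-1 is that of the inverse of \<open>x_sub\<close>, because
  \<open>lower_part\<close> is a homomorphism; since k \<le> m, column k of s is that of
  \<open>x_sup\<close>.\<close>

lemma Phi_eq_block:
  assumes "(k, r) \<in> Delta_rect m n" and "y = y_functional m n y'"
  shows "Phi y x r k = mmul m n (mmul m n (inv\<^bsub>G m n\<^esub> (x_sub m n x)) y) (x_sup m n x) r k"
proof -
  have "(inv\<^bsub>G m n\<^esub> (x_sub m n x)) r l = (inv\<^bsub>G m n\<^esub> (sect m n x)) r l" for l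
  proof -
    have "inv\<^bsub>G m n\<^esub> (x_sub m n x) = lower_part m n (inv\<^bsub>G m n\<^esub> (sect m n x))"
      by (simp add: lower_part_inv lower_part_sect)
    then show ?thesis using assms(1) by (simp add: lower_part_def Delta_rect_def)
  qed
  moreover have "x_sup m n x i k = sect m n x i k" for i
    using assms(1) by (auto simp: x_sup_def sect_apply unip_apply[OF Delta_subset_Delta_all(3)]
        mem_Delta_X mem_Delta_sup Delta_rect_def)
  ultimately show ?thesis unfolding Phi_def assms(2) mmul_y_functional by simp
qed

lemma fun_algebra_Phi:
  assumes C: "fun_algebra C" and x: "\<And>p. p \<in> Delta_X m n \<Longrightarrow> (\<lambda>x. x p) \<in> C"
  shows "(\<lambda>x. Phi y x r k) \<in> C"
proof -
  have "(\<lambda>x. sect m n x i j) \<in> C" for i j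
    by (cases "(i, j) \<in> Delta_X m n") (simp_all add: sect_apply x fun_algebraD(1)[OF C])
  then show ?thesis unfolding Phi_def
    by (intro fun_algebra_mmul[OF C] fun_algebra_inv[OF C]) (auto intro: fun_algebraD(1)[OF C])
qed

text \<open>
  \<open>Phi = L Y R\<close> with \<open>L\<close> and \<open>R\<close> unitriangular and \<open>Y\<close> antidiagonal with nonzero entries, so both
  factors are recovered by Gaussian elimination, starting from the corner entry of \<open>Y\<close>.
\<close>

lemma coordinates_from_Phi:
  assumes C: "fun_algebra C" and y: "\<And>j. j \<le> n \<Longrightarrow> y (m + int j + 1) (m - int j) \<noteq> 0"
    and Phi: "\<And>k r. (k, r) \<in> Delta_rect m n \<Longrightarrow> (\<lambda>x. Phi (y_functional m n y) x r k) \<in> C"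
    and p: "p \<in> Delta_X m n"
  shows "(\<lambda>x. x p) \<in> C"
proof -
  define L where "L x = inv\<^bsub>G m n\<^esub> (sect m n x)" for x
  have L: "L x \<in> carrier (G m n)" for x by (simp add: L_def)
  note S = sect_in_carrier
  let ?y = "\<lambda>j::nat. y (m + int j + 1) (m - int j)"
  let ?t = "\<lambda>x r k (j::nat). L x r (m + int j + 1) * ?y j * sect m n x (m - int j) k"
  \<comment> \<open>Downward induction on c: the c-th entry of y, counted from the centre, couples
    column m + c + 1 of L with row m - c of s, and the outer positions j > c are already
    known.\<close>
  have main: "(\<forall>r. m < r \<and> r \<le> m + int n + 1 \<longrightarrow> (\<lambda>x. L x r (m + int c + 1)) \<in> C) \<and>
      (\<forall>k. m - int n \<le> k \<and> k \<le> m \<longrightarrow> (\<lambda>x. sect m n x (m - int c) k) \<in> C)" if "c \<le> n" for c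
    using that
  proof (induction "n - c" arbitrary: c rule: less_induct)
    case less
    have split: "{0..n} = insert c ({c<..n} \<union> {0..<c})" using less.prems by auto
    have idx: "m + int c + 1 \<in> idx m n" "m - int c \<in> idx m n" using less.prems by (auto simp: idx_def)
    have expand: "Phi (y_functional m n y) x r k
       = ?t x r k c + (\<Sum>j\<in>{c<..n}. ?t x r k j) + (\<Sum>j\<in>{0..<c}. ?t x r k j)" for x r k
      unfolding Phi_def mmul_y_functional split L_def[symmetric]
      by (subst sum.insert, simp, simp, subst sum.union_disjoint) auto
    have rest: "(\<lambda>x. \<Sum>j\<in>{c<..n}. ?t x r k j) \<in> C"
      if "m < r" "r \<le> m + int n + 1" "m - int n \<le> k" "k \<le> m" for r k
      using that less.hyps by (intro fun_algebra_sum[OF C] fun_algebraD[OF C]) auto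
    have "(\<lambda>x. L x r (m + int c + 1)) \<in> C" if r: "m < r" "r \<le> m + int n + 1" for r
    proof -
      \<comment> \<open>In this column the pivot of s is the diagonal entry 1, and positions j < c
        meet s below the diagonal, where it vanishes.\<close>
      let ?k = "m - int c"
      have z: "(\<Sum>j\<in>{0..<c}. ?t x r ?k j) = 0" for x
        using carrier_apply(2)[OF S, of "m - int c" _ x] by (intro sum.neutral) simp
      have "L x r (m + int c + 1) = (Phi (y_functional m n y) x r ?k - (\<Sum>j\<in>{c<..n}. ?t x r ?k j)) * (1 / ?y c)" for x
        unfolding expand z using y[OF less.prems] carrier_apply(1)[OF S idx(2)] by simp
      moreover have "(\<lambda>x. (Phi (y_functional m n y) x r ?k - (\<Sum>j\<in>{c<..n}. ?t x r ?k j)) * (1 / ?y c)) \<in> C"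
        using r less.prems
        by (intro fun_algebraD(1,3)[OF C] fun_algebra_diff[OF C] rest Phi) (auto simp: Delta_rect_def)
      ultimately show ?thesis by simp
    qed
    moreover have "(\<lambda>x. sect m n x (m - int c) k) \<in> C" if k: "m - int n \<le> k" "k \<le> m" for k
    proof -
      \<comment> \<open>Symmetrically, in this row the pivot of L is 1 and positions j < c meet L
        below the diagonal.\<close>
      let ?r = "m + int c + 1"
      have z: "(\<Sum>j\<in>{0..<c}. ?t x ?r k j) = 0" for x
        using carrier_apply(2)[OF L, of _ "m + int c + 1" x] by (intro sum.neutral) simp
      have "sect m n x (m - int c) k = (Phi (y_functional m n y) x ?r k - (\<Sum>j\<in>{c<..n}. ?t x ?r k j)) * (1 / ?y c)" for x
        unfolding expand z using y[OF less.prems] carrier_apply(1)[OF L idx(1)] by simp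
      moreover have "(\<lambda>x. (Phi (y_functional m n y) x ?r k - (\<Sum>j\<in>{c<..n}. ?t x ?r k j)) * (1 / ?y c)) \<in> C"
        using k less.prems
        by (intro fun_algebraD(1,3)[OF C] fun_algebra_diff[OF C] rest Phi) (auto simp: Delta_rect_def)
      ultimately show ?thesis by simp
    qed
    ultimately show ?case by blast
  qed
  obtain i j where ij: "p = (i, j)" by (cases p)
  show ?thesis
  proof (cases "i \<le> m")
    case True
    with p ij have "(\<lambda>x. sect m n x (m - int (nat (m - i))) j) \<in> C"
      by (intro main[THEN conjunct2, rule_format]) (auto simp: mem_Delta_X)
    then show ?thesis using True p ij by (simp add: sect_apply)
  next
    case False
    \<comment> \<open>For the lower right block only the inverse of \<open>x_sub\<close> has been
      recovered; inverting once more stays within \<open>C\<close>.\<close>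
    have "(\<lambda>x. lower_part m n (L x) a b) \<in> C" for a b
    proof (cases "(a, b) \<in> Delta_sub m n")
      case True
      then have "(\<lambda>x. L x a (m + int (nat (b - m - 1)) + 1)) \<in> C"
        by (intro main[THEN conjunct1, rule_format]) (auto simp: Delta_sub_def)
      then show ?thesis using True by (simp add: lower_part_def Delta_sub_def)
    next
      case False
      then have "(\<lambda>x. lower_part m n (L x) a b) = (\<lambda>x. Imat m n a b)"
        using L by (auto simp: lower_part_def carrier_G unitri_def Delta_sub_def Delta_all_def fun_eq_iff)
      then show ?thesis using fun_algebraD(1)[OF C] by simp
    qed
    then have "(\<lambda>x. (inv\<^bsub>G m n\<^esub> lower_part m n (L x)) i j) \<in> C"
      by (intro fun_algebra_inv[OF C] lower_part_in_carrier L)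
    moreover have "(inv\<^bsub>G m n\<^esub> lower_part m n (L x)) i j = sect m n x i j" for x
    proof -
      have "inv\<^bsub>G m n\<^esub> lower_part m n (L x) = lower_part m n (sect m n x)"
        using lower_part_inv[OF L, of x] by (simp add: L_def)
      with False show ?thesis by (simp add: lower_part_def)
    qed
    ultimately have "(\<lambda>x. sect m n x i j) \<in> C" by simp
    then show ?thesis using p ij by (simp add: sect_apply)
  qed
qed

end

section \<open>The invariant measure and unitarity\<close>

text \<open>
  A triangular map with unit diagonal preserves Lebesgue measure: integrate first over a coordinate
  of top level, on which the other components do not depend.
\<close>

lemma distr_triangular:
  fixes lev :: "'i \<Rightarrow> int" and g :: "'i \<Rightarrow> ('i \<Rightarrow> real) \<Rightarrow> real"
  assumes "finite I"
    and "\<And>p. p \<in> I \<Longrightarrow> g p \<in> borel_measurable (Pi\<^sub>M I (\<lambda>_. lborel))"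
    and "\<And>p x y. p \<in> I \<Longrightarrow> (\<And>q. q \<in> I \<Longrightarrow> lev q < lev p \<Longrightarrow> x q = y q) \<Longrightarrow> g p x = g p y"
  shows "distr (Pi\<^sub>M I (\<lambda>_. lborel)) (Pi\<^sub>M I (\<lambda>_. lborel)) (\<lambda>x. \<lambda>p\<in>I. x p + g p x)
    = Pi\<^sub>M I (\<lambda>_. lborel)"
  using assms
proof (induction I arbitrary: g rule: finite_ranking_induct[where f = lev])
  case empty
  have "distr (Pi\<^sub>M {} (\<lambda>_. lborel)) (Pi\<^sub>M {} (\<lambda>_. lborel)) (\<lambda>x. \<lambda>p\<in>{}. x p + g p x)
      = distr (Pi\<^sub>M {} (\<lambda>_. lborel)) (Pi\<^sub>M {} (\<lambda>_. lborel)) (\<lambda>x. x)"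
    by (rule distr_cong) (auto simp: space_PiM)
  also have "\<dots> = Pi\<^sub>M {} (\<lambda>_. lborel)" by (rule distr_id)
  finally show ?case .
next
  case (insert p I)
  show ?case
  proof (cases "p \<in> I")
    case True
    then have ins: "insert p I = I" by auto
    show ?thesis unfolding ins
    proof (rule insert.IH)
      show "g q \<in> borel_measurable (Pi\<^sub>M I (\<lambda>_. lborel))" if "q \<in> I" for q
        using insert.prems(1)[of q] that unfolding ins .
      show "g q x = g q y" if "q \<in> I" "\<And>r. r \<in> I \<Longrightarrow> lev r < lev q \<Longrightarrow> x r = y r" for q x y
        by (rule insert.prems(2)[unfolded ins]) (use that in auto)
    qed
  next
    case False
    interpret product_sigma_finite "\<lambda>_::'i. lborel :: real measure"
      by standard
    let ?M = "Pi\<^sub>M I (\<lambda>_. lborel :: real measure)" and ?N = "Pi\<^sub>M (insert p I) (\<lambda>_. lborel :: real measure)"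
    \<comment> \<open>The level of p is maximal, so no \<open>g q\<close> depends on the coordinate
      p; freezing it at 0 turns \<open>g q\<close> into a function on the smaller product.\<close>
    define g' where "g' q x = g q (x(p := 0))" for q and x :: "'i \<Rightarrow> real"
    have upd: "(\<lambda>x. x(p := c)) \<in> measurable ?M ?N" for c
      using measurable_compose[OF _ measurable_add_dim[of p I "\<lambda>_. lborel :: real measure"], of "\<lambda>x. (x, c)" ?M] by simp
    have g'_meas: "g' q \<in> borel_measurable ?M" if "q \<in> insert p I" for q
      unfolding g'_def by (rule measurable_compose[OF upd insert.prems(1)[OF that]])
    define \<Phi> where "\<Phi> x = (\<lambda>q\<in>I. x q + g' q x)" for x
    define \<Psi> where "\<Psi> x = (\<lambda>q\<in>insert p I. x q + g q x)" for x
    have IH: "distr ?M ?M \<Phi> = ?M"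
      unfolding \<Phi>_def
    proof (rule insert.IH)
      show "g' q \<in> borel_measurable ?M" if "q \<in> I" for q using that g'_meas by simp
      show "g' q x = g' q y" if "q \<in> I" "\<And>r. r \<in> I \<Longrightarrow> lev r < lev q \<Longrightarrow> x r = y r" for q x y
        unfolding g'_def by (rule insert.prems(2)) (use that in auto)
    qed
    have \<Phi>_meas [measurable]: "\<Phi> \<in> measurable ?M ?M"
      unfolding \<Phi>_def using g'_meas by (intro measurable_restrict) auto
    have \<Psi>_meas [measurable]: "\<Psi> \<in> measurable ?N ?N"
      unfolding \<Psi>_def using insert.prems(1) by (intro measurable_restrict) auto
    have \<Psi>_upd: "\<Psi> (x(p := u)) = (\<Phi> x)(p := u + g' p x)" if "x \<in> space ?M" for x u
    proof
      fix q
      have "g r (x(p := u)) = g' r x" if "r \<in> insert p I" for r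
        unfolding g'_def by (rule insert.prems(2)[OF that]) (use that insert.hyps(2) in fastforce)
      then show "\<Psi> (x(p := u)) q = ((\<Phi> x)(p := u + g' p x)) q"
        using False that by (auto simp: \<Psi>_def \<Phi>_def)
    qed
    show ?thesis
      unfolding \<Psi>_def[symmetric]
    proof (rule measure_eqI)
      fix A assume "A \<in> sets (distr ?N ?N \<Psi>)"
      then have A [measurable]: "A \<in> sets ?N" by simp
      define h where "h x u = (indicator A (x(p := u)) :: ennreal)" for x u
      have h_meas: "case_prod h \<in> borel_measurable (?M \<Otimes>\<^sub>M lborel)"
        unfolding h_def using measurable_compose[OF measurable_add_dim[of p I "\<lambda>_. lborel"] borel_measurable_indicator[OF A]]
        by (simp add: case_prod_beta')
      have h_meas_x: "(\<lambda>x. \<integral>\<^sup>+u. h x u \<partial>lborel) \<in> borel_measurable ?M"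
        using lborel.borel_measurable_nn_integral[OF h_meas] by simp
      have h_sec: "h x \<in> borel_measurable borel" if "x \<in> space ?M" for x
        using measurable_compose_Pair1[OF that h_meas] by simp
      have \<Phi>_sp: "\<Phi> x \<in> space ?M" if "x \<in> space ?M" for x
        using measurable_space[OF \<Phi>_meas that] .
      have "emeasure (distr ?N ?N \<Psi>) A = (\<integral>\<^sup>+x. indicator A (\<Psi> x) \<partial>?N)"
        by (subst nn_integral_indicator[symmetric], simp, subst nn_integral_distr) auto
      also have "\<dots> = (\<integral>\<^sup>+x. \<integral>\<^sup>+u. indicator A (\<Psi> (x(p := u))) \<partial>lborel \<partial>?M)"
        by (rule product_nn_integral_insert[OF insert.hyps(1) False]) measurable
      also have "\<dots> = (\<integral>\<^sup>+x. \<integral>\<^sup>+u. h (\<Phi> x) u \<partial>lborel \<partial>?M)"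
      proof (rule nn_integral_cong)
        \<comment> \<open>In the coordinate p the map is translation by \<open>g' p x\<close>, which
          preserves Lebesgue measure.\<close>
        fix x assume x: "x \<in> space ?M"
        have "(\<integral>\<^sup>+u. h (\<Phi> x) u \<partial>lborel) = (\<integral>\<^sup>+u. h (\<Phi> x) (g' p x + u) \<partial>lborel)"
          using nn_integral_real_affine[OF h_sec[OF \<Phi>_sp[OF x]], of 1 "g' p x"] by simp
        also have "\<dots> = (\<integral>\<^sup>+u. indicator A (\<Psi> (x(p := u))) \<partial>lborel)"
          by (simp add: h_def \<Psi>_upd[OF x] add.commute)
        finally show "(\<integral>\<^sup>+u. indicator A (\<Psi> (x(p := u))) \<partial>lborel) = (\<integral>\<^sup>+u. h (\<Phi> x) u \<partial>lborel)" ..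
      qed
      also have "\<dots> = (\<integral>\<^sup>+x. \<integral>\<^sup>+u. h x u \<partial>lborel \<partial>distr ?M ?M \<Phi>)"
        using h_meas_x by (subst nn_integral_distr) auto
      also have "\<dots> = (\<integral>\<^sup>+x. indicator A x \<partial>?N)"
        unfolding IH h_def by (rule product_nn_integral_insert[OF insert.hyps(1) False, symmetric]) measurable
      finally show "emeasure (distr ?N ?N \<Psi>) A = emeasure ?N A" by simp
    qed simp
  qed
qed

section \<open>Measure-preserving maps and convergence in the mean\<close>

lemma measure_preserving_integrable_iff:
  fixes f :: "'a \<Rightarrow> 'b::{banach, second_countable_topology}"
  assumes "distr M M \<phi> = M" "\<phi> \<in> measurable M M" "f \<in> borel_measurable M"
  shows "integrable M (\<lambda>x. f (\<phi> x)) \<longleftrightarrow> integrable M f"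
  using integrable_distr_eq[OF assms(2,3)] assms(1) by simp

lemma measure_preserving_integral:
  fixes f :: "'a \<Rightarrow> 'b::{banach, second_countable_topology}"
  assumes "distr M M \<phi> = M" "\<phi> \<in> measurable M M" "f \<in> borel_measurable M"
  shows "(\<integral>x. f (\<phi> x) \<partial>M) = (\<integral>x. f x \<partial>M)"
  using integral_distr[OF assms(2,3)] assms(1) by simp

text \<open>Each half line is integrated by arctan, the negative one after reflection; the point 0
  is counted twice, so an upper bound results. It serves to make \<open>bump\<close> square
  integrable.\<close>

lemma integrable_inverse_1_plus_square: "integrable lborel (\<lambda>u::real. 1 / (1 + u\<^sup>2))"
proof -
  define q where "q u = 1 / (1 + u\<^sup>2)" for u :: real
  have [measurable]: "q \<in> borel_measurable borel" unfolding q_def by measurable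
  have nn: "q u \<ge> 0" for u by (simp add: q_def)
  have half: "(\<integral>\<^sup>+u. ennreal (q u) * indicator {0..} u \<partial>lborel) = ennreal (pi / 2)"
    using nn_integral_FTC_atLeast[of q 0 arctan "pi / 2"] nn tendsto_arctan_at_top
      DERIV_arctan by (simp add: q_def inverse_eq_divide)
  have "(\<integral>\<^sup>+u. ennreal (q u) \<partial>lborel)
      \<le> (\<integral>\<^sup>+u. ennreal (q u) * indicator {0..} u + ennreal (q (- u)) * indicator {0..} (- u) \<partial>lborel)"
    by (intro nn_integral_mono) (auto simp: indicator_def q_def)
  also have "\<dots> = (\<integral>\<^sup>+u. ennreal (q u) * indicator {0..} u \<partial>lborel)
      + (\<integral>\<^sup>+u. ennreal (q (- u)) * indicator {0..} (- u) \<partial>lborel)"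
    by (rule nn_integral_add) measurable
  also have "(\<integral>\<^sup>+u. ennreal (q (- u)) * indicator {0..} (- u) \<partial>lborel) = ennreal (pi / 2)"
    using nn_integral_real_affine[of "\<lambda>u. ennreal (q u) * indicator {0..} u" "-1" 0] half by simp
  finally have "(\<integral>\<^sup>+u. ennreal (q u) \<partial>lborel) < \<infinity>"
    unfolding half by (simp add: ennreal_plus[symmetric] del: ennreal_plus) (metis ennreal_less_top le_less_trans)
  then show ?thesis
    unfolding q_def[symmetric] using nn by (intro integrableI_nonneg) auto
qed

lemma borel_measurable_cnj:
  assumes "f \<in> borel_measurable M"
  shows "(\<lambda>x. cnj (f x)) \<in> borel_measurable M"
  by (rule measurable_compose[OF assms]) (intro borel_measurable_continuous_onI continuous_intros)

text \<open>A case of Riesz's theorem: pointwise convergence with matching norms gives convergence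
  in L2. Along an orbit of unitary operators the norms are constant, so no dominating function has
  to be found.\<close>

lemma l2_convergence_of_norms:
  assumes F: "\<And>i. F i \<in> L2 M" and f: "f \<in> L2 M"
    and norms: "\<And>i. (\<integral>x. (cmod (F i x))\<^sup>2 \<partial>M) = (\<integral>x. (cmod (f x))\<^sup>2 \<partial>M)"
    and lim: "AE x in M. (\<lambda>i::nat. F i x) \<longlonglongrightarrow> f x"
  shows "(\<lambda>i. l2_norm M (\<lambda>x. F i x - f x)) \<longlonglongrightarrow> 0"
proof -
  note [measurable] = L2D(1)[OF F] L2D(1)[OF f]
  \<comment> \<open>\<open>|F - f|\<^sup>2 \<le> 2|F|\<^sup>2 - 2|f|\<^sup>2 + g\<close>, where \<open>g \<le> 4|f|\<^sup>2\<close> is dominated and tends to \<open>0\<close>.\<close>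
  define g where "g i x = max 0 (2 * (cmod (f x))\<^sup>2 - 2 * (cmod (F i x))\<^sup>2 + (cmod (F i x - f x))\<^sup>2)" for i x
  have g_meas: "g i \<in> borel_measurable M" for i unfolding g_def by measurable
  have g_bound: "norm (g i x) \<le> 4 * (cmod (f x))\<^sup>2" for i x
    using cmod_diff_square_le[of "F i x" "f x"] by (simp add: g_def)
  have int4: "integrable M (\<lambda>x. 4 * (cmod (f x))\<^sup>2)" using L2D(2)[OF f] by simp
  have "(\<lambda>i. \<integral>x. g i x \<partial>M) \<longlonglongrightarrow> (\<integral>x. 0 \<partial>M)"
  proof (rule integral_dominated_convergence[OF _ g_meas int4])
    show "AE x in M. (\<lambda>i. g i x) \<longlonglongrightarrow> 0"
      using lim
    proof eventually_elim
      case (elim x)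
      have "(\<lambda>i. g i x) \<longlonglongrightarrow> max 0 (2 * (cmod (f x))\<^sup>2 - 2 * (cmod (f x))\<^sup>2 + (cmod (f x - f x))\<^sup>2)"
        unfolding g_def by (intro tendsto_intros elim)
      then show ?case by simp
    qed
  qed (use g_bound in auto)
  then have lim_g: "(\<lambda>i. \<integral>x. g i x \<partial>M) \<longlonglongrightarrow> 0" by simp
  have g_int: "integrable M (g i)" for i
    by (rule Bochner_Integration.integrable_bound[OF int4 g_meas]) (use g_bound in auto)
  have le: "(\<integral>x. (cmod (F i x - f x))\<^sup>2 \<partial>M) \<le> (\<integral>x. g i x \<partial>M)" for i
  proof -
    have "(\<integral>x. (cmod (F i x - f x))\<^sup>2 \<partial>M) \<le> (\<integral>x. 2 * (cmod (F i x))\<^sup>2 - 2 * (cmod (f x))\<^sup>2 + g i x \<partial>M)"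
      using L2D(2)[OF L2_diff[OF F f]] L2D(2)[OF F] L2D(2)[OF f] g_int
      by (intro integral_mono) (auto simp: g_def)
    also have "\<dots> = (\<integral>x. g i x \<partial>M)"
      using L2D(2)[OF F] L2D(2)[OF f] g_int norms[of i] by simp
    finally show ?thesis .
  qed
  show ?thesis
    unfolding l2_norm_tendsto_0_iff
    by (rule tendsto_sandwich[OF _ _ tendsto_const lim_g]) (use le in auto)
qed

section \<open>Invariance of the measure\<close>

context
  fixes m :: int and n :: nat
begin

interpretation G: group "G m n" by (rule group_G)

lemma space_mu: "space (mu m n) = X m n"
  by (simp add: mu_def X_def space_PiM)

lemma sigma_finite_mu: "sigma_finite_measure (mu m n)"
proof -
  interpret product_sigma_finite "\<lambda>_::int \<times> int. lborel :: real measure" by standard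
  show ?thesis unfolding mu_def by (rule sigma_finite) simp
qed

lemma coordinate_measurable: "p \<in> Delta_X m n \<Longrightarrow> (\<lambda>x. x p) \<in> borel_measurable (mu m n)"
  unfolding mu_def using measurable_component_singleton[of p "Delta_X m n" "\<lambda>_. lborel"] by simp

lemma measurable_muI:
  assumes "\<And>p. p \<in> Delta_X m n \<Longrightarrow> (\<lambda>z. f z p) \<in> borel_measurable N"
    and "\<And>z. z \<in> space N \<Longrightarrow> f z \<in> X m n"
  shows "f \<in> measurable N (mu m n)"
proof -
  have "(\<lambda>z. \<lambda>p\<in>Delta_X m n. f z p) \<in> measurable N (mu m n)"
    unfolding mu_def using assms(1) by (intro measurable_restrict) simp
  moreover have "(\<lambda>p\<in>Delta_X m n. f z p) = f z" if "z \<in> space N" for z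
    using assms(2)[OF that] PiE_restrict[of "f z" "Delta_X m n"] by (simp add: X_def)
  ultimately show ?thesis by (simp cong: measurable_cong)
qed

lemma act_eq_restrict:
  assumes "t \<in> carrier (G m n)"
  shows "act m n x t = (\<lambda>p\<in>Delta_X m n. x p +
    (t (fst p) (snd p) + (\<Sum>l\<in>{fst p<..<snd p}. x (fst p, l) * t l (snd p))))"
proof
  fix p
  show "act m n x t p = (\<lambda>p\<in>Delta_X m n. x p +
    (t (fst p) (snd p) + (\<Sum>l\<in>{fst p<..<snd p}. x (fst p, l) * t l (snd p)))) p"
    using act_apply[OF assms, of "fst p" "snd p" x] act_eq[OF assms, of x]
    by (cases "p \<in> Delta_X m n") (auto simp: coords_of_def)
qed

text \<open>The level is the distance j - i from the diagonal: the correction at (i, j) involves x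
  only at (i, l) with l < j.\<close>

lemma distr_act:
  assumes t: "t \<in> carrier (G m n)"
  shows "distr (mu m n) (mu m n) (\<lambda>x. act m n x t) = mu m n"
  unfolding act_eq_restrict[OF t] unfolding mu_def
proof (rule distr_triangular[where lev = "\<lambda>p. snd p - fst p"])
  fix p assume p: "p \<in> Delta_X m n"
  then have q: "(fst p, l) \<in> Delta_X m n" if "l \<in> {fst p<..<snd p}" for l
    using that by (cases p) (auto simp: mem_Delta_X)
  show "(\<lambda>x. t (fst p) (snd p) + (\<Sum>l\<in>{fst p<..<snd p}. x (fst p, l) * t l (snd p)))
      \<in> borel_measurable (Pi\<^sub>M (Delta_X m n) (\<lambda>_. lborel))"
    using coordinate_measurable[OF q] by (simp add: mu_def)
  fix x z :: coords
  assume "\<And>q. q \<in> Delta_X m n \<Longrightarrow> snd q - fst q < snd p - fst p \<Longrightarrow> x q = z q"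
  then show "t (fst p) (snd p) + (\<Sum>l\<in>{fst p<..<snd p}. x (fst p, l) * t l (snd p))
      = t (fst p) (snd p) + (\<Sum>l\<in>{fst p<..<snd p}. z (fst p, l) * t l (snd p))"
    using q by (intro arg_cong2[where f = "(+)"] sum.cong) auto
qed simp

lemma act_sect_apply:
  assumes "p \<in> Delta_X m n"
  shows "act m n x (sect m n z) p = z p + (x p + (\<Sum>l\<in>{fst p<..<snd p}. x (fst p, l) * z (l, snd p)))"
proof -
  have "(\<Sum>l\<in>{fst p<..<snd p}. x (fst p, l) * sect m n z l (snd p))
      = (\<Sum>l\<in>{fst p<..<snd p}. x (fst p, l) * z (l, snd p))"
    using assms by (cases p, intro sum.cong) (auto simp: sect_apply mem_Delta_X)
  then show ?thesis
    using assms by (simp add: act_eq_restrict sect_apply)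
qed

text \<open>Invariance in the group variable for fixed x, the counterpart of
  \<open>distr_act\<close> in the Fubini argument. Here z is the variable, and the correction at (i,
  j) involves it only at (l, j) with l > i.\<close>

lemma distr_act_sect: "distr (mu m n) (mu m n) (\<lambda>z. act m n x (sect m n z)) = mu m n"
proof -
  have "(\<lambda>z. act m n x (sect m n z)) = (\<lambda>z. \<lambda>p\<in>Delta_X m n. z p +
      (x p + (\<Sum>l\<in>{fst p<..<snd p}. x (fst p, l) * z (l, snd p))))"
  proof (intro ext)
    fix z p
    show "act m n x (sect m n z) p = (\<lambda>p\<in>Delta_X m n. z p +
      (x p + (\<Sum>l\<in>{fst p<..<snd p}. x (fst p, l) * z (l, snd p)))) p"
      using act_sect_apply[of p x z] by (cases "p \<in> Delta_X m n") (auto simp: act_eq_restrict)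
  qed
  moreover have "distr (mu m n) (mu m n) (\<lambda>z. \<lambda>p\<in>Delta_X m n. z p +
      (x p + (\<Sum>l\<in>{fst p<..<snd p}. x (fst p, l) * z (l, snd p)))) = mu m n"
    unfolding mu_def
  proof (rule distr_triangular[where lev = "\<lambda>p. snd p - fst p"])
    fix p assume p: "p \<in> Delta_X m n"
    then have q: "(l, snd p) \<in> Delta_X m n" if "l \<in> {fst p<..<snd p}" for l
      using that by (cases p) (auto simp: mem_Delta_X)
    show "(\<lambda>z. x p + (\<Sum>l\<in>{fst p<..<snd p}. x (fst p, l) * z (l, snd p)))
        \<in> borel_measurable (Pi\<^sub>M (Delta_X m n) (\<lambda>_. lborel))"
      using coordinate_measurable[OF q] by (simp add: mu_def)
    fix z w :: coords
    assume "\<And>q. q \<in> Delta_X m n \<Longrightarrow> snd q - fst q < snd p - fst p \<Longrightarrow> z q = w q"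
    then show "x p + (\<Sum>l\<in>{fst p<..<snd p}. x (fst p, l) * z (l, snd p))
        = x p + (\<Sum>l\<in>{fst p<..<snd p}. x (fst p, l) * w (l, snd p))"
      using q by (intro arg_cong2[where f = "(+)"] sum.cong) auto
  qed simp
  ultimately show ?thesis by simp
qed

lemma act_measurable:
  assumes "t \<in> carrier (G m n)"
  shows "(\<lambda>x. act m n x t) \<in> measurable (mu m n) (mu m n)"
proof (rule measurable_muI)
  fix p assume p: "p \<in> Delta_X m n"
  then have q: "(fst p, l) \<in> Delta_X m n" if "l \<in> {fst p<..<snd p}" for l
    using that by (cases p) (auto simp: mem_Delta_X)
  show "(\<lambda>x. act m n x t p) \<in> borel_measurable (mu m n)"
    using p coordinate_measurable[OF q] coordinate_measurable[OF p]
    by (simp add: act_eq_restrict[OF assms])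
qed (simp add: assms)

lemma act_sect_measurable:
  "(\<lambda>(x, z). act m n x (sect m n z)) \<in> measurable (mu m n \<Otimes>\<^sub>M mu m n) (mu m n)"
  unfolding case_prod_beta'
proof (rule measurable_muI)
  fix p assume p: "p \<in> Delta_X m n"
  then have q: "(fst p, l) \<in> Delta_X m n" "(l, snd p) \<in> Delta_X m n" if "l \<in> {fst p<..<snd p}" for l
    using that by (cases p; auto simp: mem_Delta_X)+
  have "(\<lambda>w. fst w r) \<in> borel_measurable (mu m n \<Otimes>\<^sub>M mu m n)"
    "(\<lambda>w. snd w r) \<in> borel_measurable (mu m n \<Otimes>\<^sub>M mu m n)" if "r \<in> Delta_X m n" for r
    using measurable_compose[OF measurable_fst coordinate_measurable[OF that]]
      measurable_compose[OF measurable_snd coordinate_measurable[OF that]] by auto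
  then show "(\<lambda>w. act m n (fst w) (sect m n (snd w)) p) \<in> borel_measurable (mu m n \<Otimes>\<^sub>M mu m n)"
    unfolding act_sect_apply[OF p] using p q by (intro borel_measurable_add borel_measurable_sum borel_measurable_times) auto
qed simp

text \<open>The translated measure is \<mu> itself, but \<open>RN_deriv\<close> is determined only
  up to null sets; for this reason the identities for \<open>T\<close> hold almost
  everywhere.\<close>

lemma dmu_AE:
  assumes t: "t \<in> carrier (G m n)"
  shows "AE x in mu m n. dmu m n t x = 1"
proof -
  interpret sigma_finite_measure "mu m n" by (rule sigma_finite_mu)
  have "AE x in mu m n. (\<lambda>_. 1) x = RN_deriv (mu m n) (mu m n) x"
    by (rule RN_deriv_unique) (simp_all add: density_1)
  moreover have "distr (mu m n) (mu m n) (\<lambda>z. act m n z (inv\<^bsub>G m n\<^esub> t)) = mu m n"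
    using t by (intro distr_act) simp
  ultimately show ?thesis by (auto simp: dmu_def)
qed

text \<open>Point and group element may both vary: measurability fixes t and moves x, strong
  continuity fixes x and moves t.\<close>

lemma fun_algebra_hcoc:
  assumes C: "fun_algebra C" and x: "\<And>p. p \<in> Delta_X m n \<Longrightarrow> (\<lambda>z. x z p) \<in> C"
    and t: "\<And>z. t z \<in> carrier (G m n)" and tC: "\<And>i j. (\<lambda>z. t z i j) \<in> C"
  shows "(\<lambda>z. pairing m n y (\<lambda>i j. hcoc m n (x z) (t z) i j - Imat m n i j)) \<in> C"
proof -
  have s: "(\<lambda>z. sect m n (x z) i j) \<in> C" for i j
    by (cases "(i, j) \<in> Delta_X m n") (simp_all add: sect_apply x fun_algebraD(1)[OF C])
  have d: "(\<lambda>z. diag_part m (t z) i j) \<in> C" for i j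
  proof (cases "i \<le> m \<and> m < j")
    case True
    then show ?thesis by (simp add: diag_part_def fun_algebraD(1)[OF C])
  next
    case False
    then have "(\<lambda>z. diag_part m (t z) i j) = (\<lambda>z. t z i j)" by (auto simp: diag_part_def)
    then show ?thesis using tC by simp
  qed
  have "(\<lambda>z. (inv\<^bsub>G m n\<^esub> (mmul m n (sect m n (x z)) (diag_part m (t z)))) i j) \<in> C" for i j
    by (intro fun_algebra_inv[OF C] fun_algebra_mmul[OF C] s d mmul_in_carrier diag_part_in_carrier
        sect_in_carrier t)
  then have "(\<lambda>z. hcoc m n (x z) (t z) i j) \<in> C" for i j
    unfolding hcoc_eq[OF t] mult_G sect_act[OF t]
    by (intro fun_algebra_mmul[OF C] s tC)
  then show ?thesis
    unfolding pairing_eq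
    by (intro fun_algebra_sum[OF C] fun_algebraD(1,3)[OF C] fun_algebra_diff[OF C])
qed

section \<open>Unitarity of the operators \<open>T\<close>\<close>

lemma S_char_hcoc_measurable:
  assumes "t \<in> carrier (G m n)"
  shows "(\<lambda>x. S_char m n y (hcoc m n x t)) \<in> borel_measurable (mu m n)"
proof -
  have "(\<lambda>x. pairing m n y (\<lambda>i j. hcoc m n x t i j - Imat m n i j)) \<in> borel_measurable (mu m n)"
    (is "?p \<in> _")
    by (rule fun_algebra_hcoc[OF fun_algebra_borel_measurable]) (auto simp: coordinate_measurable assms)
  then have "(\<lambda>x. 2 * pi * ?p x) \<in> borel_measurable (mu m n)"
    by (intro borel_measurable_times borel_measurable_const)
  moreover have "cis \<in> borel_measurable borel"
    by (intro borel_measurable_continuous_onI continuous_intros)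
  ultimately show ?thesis
    unfolding S_char_eq_cis by (rule measurable_compose)
qed

lemma norm_S_char [simp]: "cmod (S_char m n y h) = 1"
  by (simp add: S_char_eq_cis)

lemma compose_act_measurable:
  assumes "t \<in> carrier (G m n)" "f \<in> borel_measurable (mu m n)"
  shows "(\<lambda>x. f (act m n x t)) \<in> borel_measurable (mu m n)"
  using measurable_compose[OF act_measurable[OF assms(1)] assms(2)] .

lemma T_measurable:
  assumes "t \<in> carrier (G m n)" "f \<in> borel_measurable (mu m n)"
  shows "T m n y t f \<in> borel_measurable (mu m n)"
  unfolding T_def
proof (intro borel_measurable_times S_char_hcoc_measurable compose_act_measurable assms)
  have "dmu m n t \<in> borel_measurable (mu m n)" unfolding dmu_def by measurable
  then show "(\<lambda>x. complex_of_real (sqrt (dmu m n t x))) \<in> borel_measurable (mu m n)" by measurable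
qed

lemma T_AE:
  assumes "t \<in> carrier (G m n)"
  shows "AE x in mu m n. T m n y t f x = S_char m n y (hcoc m n x t) * f (act m n x t)"
  using dmu_AE[OF assms] by eventually_elim (simp add: T_def)

lemma T_square_integral:
  assumes t: "t \<in> carrier (G m n)" and f: "f \<in> L2 (mu m n)"
  shows "T m n y t f \<in> L2 (mu m n)"
    and "(\<integral>x. (cmod (T m n y t f x))\<^sup>2 \<partial>mu m n) = (\<integral>x. (cmod (f x))\<^sup>2 \<partial>mu m n)"
proof -
  note f' = L2D[OF f]
  have eq: "AE x in mu m n. (cmod (T m n y t f x))\<^sup>2 = (cmod (f (act m n x t)))\<^sup>2"
    using T_AE[OF t, of y f] by eventually_elim (simp add: norm_mult)
  have int: "integrable (mu m n) (\<lambda>x. (cmod (f (act m n x t)))\<^sup>2)"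
    using measure_preserving_integrable_iff[OF distr_act[OF t] act_measurable[OF t], of "\<lambda>x. (cmod (f x))\<^sup>2"] f'
    by simp
  show "T m n y t f \<in> L2 (mu m n)"
    by (rule L2I[OF T_measurable[OF t f'(1)] int]) (use eq in auto)
  have "(\<integral>x. (cmod (T m n y t f x))\<^sup>2 \<partial>mu m n) = (\<integral>x. (cmod (f (act m n x t)))\<^sup>2 \<partial>mu m n)"
    using eq T_measurable[OF t f'(1)] compose_act_measurable[OF t f'(1)] by (intro integral_cong_AE) auto
  also have "\<dots> = (\<integral>x. (cmod (f x))\<^sup>2 \<partial>mu m n)"
    using f' by (intro measure_preserving_integral[OF distr_act[OF t] act_measurable[OF t]]) auto
  finally show "(\<integral>x. (cmod (T m n y t f x))\<^sup>2 \<partial>mu m n) = (\<integral>x. (cmod (f x))\<^sup>2 \<partial>mu m n)" .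
qed

lemma T_linear: "T m n y t (\<lambda>z. a * f z + b * g z) x = a * T m n y t f x + b * T m n y t g x"
  by (simp add: T_def algebra_simps)

lemma T_mult_AE:
  assumes s: "s \<in> carrier (G m n)" and t: "t \<in> carrier (G m n)"
  shows "AE x in mu m n. T m n y (s \<otimes>\<^bsub>G m n\<^esub> t) f x = T m n y s (T m n y t f) x"
proof -
  \<comment> \<open>The density is evaluated at the moved point xs; the exceptional null set pulls
    back to a null set because x \<mapsto> xs preserves \<mu>.\<close>
  have "AE x in mu m n. dmu m n t (act m n x s) = 1"
    by (rule AE_distrD[OF act_measurable[OF s]], unfold distr_act[OF s], rule dmu_AE[OF t])
  moreover have "AE x in mu m n. dmu m n (s \<otimes>\<^bsub>G m n\<^esub> t) x = 1"
    using s t by (intro dmu_AE) simp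
  ultimately show ?thesis
    using dmu_AE[OF s]
  proof eventually_elim
    case (elim x)
    have "S_char m n y (hcoc m n x (s \<otimes>\<^bsub>G m n\<^esub> t))
        = S_char m n y (hcoc m n x s) * S_char m n y (hcoc m n (act m n x s) t)"
      using S_char_mult[OF hcoc_in_B_rect[OF s] hcoc_in_B_rect[OF t]] hcoc_mult[OF s t]
      by (simp add: mult_G)
    then show ?case by (simp add: T_def elim act_mult[OF s t])
  qed
qed

lemma T_one_AE: "AE x in mu m n. T m n y (Imat m n) f x = f x"
proof -
  have "AE x in mu m n. x \<in> X m n" using AE_space[of "mu m n"] by (simp add: space_mu)
  with T_AE[OF Imat_in_carrier] show ?thesis
    by eventually_elim (simp add: hcoc_one act_one S_char_one)
qed

lemma unitary_T:
  assumes t: "t \<in> carrier (G m n)"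
  shows "unitary_on_L2 (mu m n) (T m n y t)"
  unfolding unitary_on_L2_def
proof (intro conjI ballI allI)
  fix f assume f: "f \<in> L2 (mu m n)"
  show "T m n y t f \<in> L2 (mu m n)" by (rule T_square_integral(1)[OF t f])
  fix g assume g: "g \<in> L2 (mu m n)"
  show "AE x in mu m n. T m n y t (\<lambda>z. a * f z + b * g z) x = a * T m n y t f x + b * T m n y t g x" for a b
    by (simp add: T_linear)
  have eq: "AE x in mu m n. T m n y t f x * cnj (T m n y t g x) = f (act m n x t) * cnj (g (act m n x t))"
    using T_AE[OF t, of y f] T_AE[OF t, of y g]
  proof eventually_elim
    case (elim x)
    have "S_char m n y (hcoc m n x t) * cnj (S_char m n y (hcoc m n x t)) = 1"
      by (simp add: complex_norm_square[symmetric])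
    then show ?case unfolding elim by (simp add: mult_ac)
  qed
  have meas: "(\<lambda>x. f x * cnj (g x)) \<in> borel_measurable (mu m n)"
    using L2D(1)[OF f] borel_measurable_cnj[OF L2D(1)[OF g]] by simp
  have "l2_inner (mu m n) (T m n y t f) (T m n y t g) = (\<integral>x. f (act m n x t) * cnj (g (act m n x t)) \<partial>mu m n)"
    unfolding l2_inner_def
    using T_measurable[OF t L2D(1)[OF f]] T_measurable[OF t L2D(1)[OF g]] compose_act_measurable[OF t meas] eq
    by (intro integral_cong_AE) (auto intro!: borel_measurable_times borel_measurable_cnj)
  also have "\<dots> = l2_inner (mu m n) f g"
    unfolding l2_inner_def
    by (rule measure_preserving_integral[OF distr_act[OF t] act_measurable[OF t] meas])
  finally show "l2_inner (mu m n) (T m n y t f) (T m n y t g) = l2_inner (mu m n) f g" .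
next
  fix g assume g: "g \<in> L2 (mu m n)"
  let ?t' = "inv\<^bsub>G m n\<^esub> t"
  have t': "?t' \<in> carrier (G m n)" using t by simp
  have "AE x in mu m n. T m n y t (T m n y ?t' g) x = g x"
    using T_mult_AE[OF t t', of y g] T_one_AE[of y g] unfolding G.r_inv[OF t] one_G
    by eventually_elim simp
  then show "\<exists>f\<in>L2 (mu m n). AE x in mu m n. T m n y t f x = g x"
    using T_square_integral(1)[OF t' g] by blast
qed

end

section \<open>Strong continuity and irreducibility\<close>

text \<open>Essential union of a family. A strictly positive integrable weight gives a finite
  measure with the same null sets; closure under countable unions yields a member of maximal
  measure, and adding B to it cannot increase that measure.\<close>

lemma sigma_finite_exhaustion:
  assumes M: "sigma_finite_measure M" and J: "J \<subseteq> sets M" "J \<noteq> {}"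
    and un: "\<And>A. (\<And>i::nat. A i \<in> J) \<Longrightarrow> (\<Union>i. A i) \<in> J"
  obtains U where "U \<in> J" "\<And>B. B \<in> J \<Longrightarrow> AE x in M. x \<notin> B - U"
proof -
  obtain h where h [measurable]: "h \<in> borel_measurable M" and h_pos: "\<And>x. h x > (0::real)" and h_int: "integrable M h"
    using sigma_finite_measure.obtain_positive_integrable_function[OF M] by metis
  define N where "N = density M (\<lambda>x. ennreal (h x))"
  have sets_N: "sets N = sets M" by (simp add: N_def)
  interpret N: finite_measure N
  proof
    have "emeasure N (space N) = (\<integral>\<^sup>+x. ennreal (h x) \<partial>M)"
      by (simp add: N_def emeasure_density cong: nn_integral_cong)
    also have "\<dots> < \<infinity>"
      using h_int h_pos by (simp add: nn_integral_eq_integral less_imp_le)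
    finally show "emeasure N (space N) \<noteq> \<infinity>" by simp
  qed
  define c where "c = (SUP A\<in>J. measure N A)"
  have bdd: "bdd_above (measure N ` J)"
    by (rule bdd_aboveI[of _ "measure N (space N)"]) (auto intro: N.bounded_measure)
  have "\<exists>A\<in>J. c - 1 / real (Suc k) < measure N A" for k
    using less_cSUP_iff[OF J(2) bdd, of "c - 1 / real (Suc k)"] by (simp add: c_def)
  then obtain A where A: "\<And>k. A k \<in> J" "\<And>k. c - 1 / real (Suc k) < measure N (A k)"
    by metis
  define U where "U = (\<Union>k. A k)"
  have UJ: "U \<in> J" unfolding U_def by (rule un[OF A(1)])
  have sets: "B \<in> sets N" if "B \<in> J" for B using that J(1) by (auto simp: sets_N)
  have "c - 1 / real (Suc k) \<le> measure N U" for k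
  proof -
    have "measure N (A k) \<le> measure N U"
      by (rule N.finite_measure_mono[OF _ sets[OF UJ]]) (auto simp: U_def)
    with A(2)[of k] show ?thesis by linarith
  qed
  note * = this
  have cU: "c \<le> measure N U"
  proof -
    have "(\<lambda>k. c - 1 / real (Suc k)) \<longlonglongrightarrow> c - 0"
      by (intro tendsto_diff tendsto_const LIMSEQ_Suc[OF lim_const_over_n])
    then have "c - 0 \<le> measure N U" by (rule LIMSEQ_le_const2) (use * in auto)
    then show ?thesis by simp
  qed
  show ?thesis
  proof (rule that[OF UJ])
    fix B assume B: "B \<in> J"
    have "(\<Union>i::nat. if i = 0 then B else U) \<in> J" by (rule un) (use B UJ in auto)
    also have "(\<Union>i::nat. if i = 0 then B else U) = B \<union> U"
      by (auto split: if_splits)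
    finally have BU: "B \<union> U \<in> J" .
    have "measure N (B \<union> U) \<le> c" unfolding c_def by (rule cSUP_upper[OF BU bdd])
    moreover have "measure N (B \<union> U) = measure N U + measure N (B - U)"
      using N.finite_measure_Union[of U "B - U"] sets[OF B] sets[OF UJ] by (simp add: Un_commute)
    ultimately have "measure N (B - U) = 0" using cU measure_nonneg[of N "B - U"] by linarith
    then have "B - U \<in> null_sets N"
      using sets[OF B] sets[OF UJ] by (simp add: null_sets_def N.emeasure_eq_measure)
    then have "AE x in M. x \<in> B - U \<longrightarrow> ennreal (h x) = 0"
      by (simp add: N_def null_sets_density_iff)
    then show "AE x in M. x \<notin> B - U"
    proof eventually_elim
      case (elim x)
      then show ?case using h_pos[of x] by auto
    qed
  qed
qed

section \<open>Subspaces on which all indicators act\<close>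

context
  fixes m :: int and n :: nat
begin

interpretation G: group "G m n" by (rule group_G)

text \<open>If the coordinates are measurable for the smaller \<sigma>-algebra, so is the identity
  map into the product space, and its preimages are the measurable sets themselves.\<close>

lemma mult_sets_full:
  assumes V: "closed_subspace_L2 (mu m n) V"
    and coord: "\<And>p. p \<in> Delta_X m n \<Longrightarrow> (\<lambda>x. x p) \<in> borel_measurable (mult_measure (mu m n) V)"
  shows "mult_sets (mu m n) V = sets (mu m n)"
proof
  show "mult_sets (mu m n) V \<subseteq> sets (mu m n)" by (auto simp: mult_sets_def)
  have id: "(\<lambda>x. x) \<in> measurable (mult_measure (mu m n) V) (mu m n)"
    by (rule measurable_muI[OF coord]) (simp_all add: space_mult_measure[OF V] space_mu)
  show "sets (mu m n) \<subseteq> mult_sets (mu m n) V"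
  proof
    fix A assume A: "A \<in> sets (mu m n)"
    from measurable_sets[OF id A] have "A \<inter> space (mu m n) \<in> mult_sets (mu m n) V"
      by (simp add: space_mult_measure[OF V] sets_mult_measure[OF V])
    then show "A \<in> mult_sets (mu m n) V" using sets.sets_into_space[OF A] by (simp add: inf_absorb1)
  qed
qed

text \<open>Nowhere vanishing, despite its name: with all indicators available, such a function
  generates L2. The factors 1 / (1 + t^2) are continuous and leave only an arctan integral to
  compute.\<close>

definition bump :: "coords \<Rightarrow> complex" where
  "bump x = of_real (\<Prod>p\<in>Delta_X m n. 1 / (1 + (x p)\<^sup>2))"

lemma bump_nonzero: "bump x \<noteq> 0"
proof -
  have "0 < (\<Prod>p\<in>Delta_X m n. 1 / (1 + (x p)\<^sup>2))"
    by (intro prod_pos divide_pos_pos add_pos_nonneg) auto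
  then show ?thesis unfolding bump_def of_real_eq_0_iff by (rule less_imp_neq[THEN not_sym])
qed

lemma bump_in_L2: "bump \<in> L2 (mu m n)"
proof (rule L2I)
  interpret product_sigma_finite "\<lambda>_::int \<times> int. lborel :: real measure" by standard
  show "bump \<in> borel_measurable (mu m n)"
    unfolding bump_def using coordinate_measurable[of _ m n] by simp
  show "integrable (mu m n) (\<lambda>x. \<Prod>p\<in>Delta_X m n. 1 / (1 + (x p)\<^sup>2))"
    unfolding mu_def by (rule product_integrable_prod) (auto simp: integrable_inverse_1_plus_square)
  have "(cmod (bump x))\<^sup>2 \<le> (\<Prod>p\<in>Delta_X m n. 1 / (1 + (x p)\<^sup>2))" for x
  proof -
    let ?P = "\<Prod>p\<in>Delta_X m n. 1 / (1 + (x p)\<^sup>2)"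
    have "0 \<le> ?P" by (intro prod_nonneg) simp
    moreover have "?P \<le> 1"
      by (intro prod_le_1 conjI divide_le_eq_1_pos[THEN iffD2]) (auto intro: add_pos_nonneg)
    ultimately have "?P\<^sup>2 \<le> ?P" by (simp add: power2_eq_square mult_left_le)
    then show ?thesis unfolding bump_def norm_of_real by simp
  qed
  then show "AE x in mu m n. (cmod (bump x))\<^sup>2 \<le> (\<Prod>p\<in>Delta_X m n. 1 / (1 + (x p)\<^sup>2))" by simp
qed

lemma emeasure_mu_nonzero: "emeasure (mu m n) (X m n) \<noteq> 0"
proof -
  interpret product_sigma_finite "\<lambda>_::int \<times> int. lborel :: real measure" by standard
  have "emeasure (mu m n) (X m n) = (\<Prod>p\<in>Delta_X m n. emeasure lborel (UNIV :: real set))"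
    unfolding mu_def X_def by (rule emeasure_PiM) auto
  then show ?thesis by simp
qed

lemma not_AE_False: "\<not> (AE x in mu m n. False)"
  using emeasure_mu_nonzero by (simp add: AE_iff_measurable[OF sets.top] space_mu)

text \<open>The function equals (g / f) f everywhere, by the convention that division by 0 gives 0;
  the quotient is measurable, possibly unbounded.\<close>

lemma closed_subspace_full:
  assumes V: "closed_subspace_L2 (mu m n) V" and full: "mult_sets (mu m n) V = sets (mu m n)"
    and f: "f \<in> V" and g: "g \<in> L2 (mu m n)"
  shows "(\<lambda>x. of_real (indicator {x. f x \<noteq> 0} x) * g x) \<in> V"
proof -
  have fL: "f \<in> L2 (mu m n)" using f closed_subspace_L2D(1)[OF V] by auto
  have eq: "g x / f x * f x = of_real (indicator {x. f x \<noteq> 0} x) * g x" for x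
    by (simp add: indicator_def)
  have m: "(\<lambda>x. g x / f x) \<in> borel_measurable (mu m n)"
    using L2D(1)[OF fL] L2D(1)[OF g] by measurable
  have "(\<lambda>x. g x / f x * f x) \<in> L2 (mu m n)"
  proof (rule L2I)
    show "(\<lambda>x. g x / f x * f x) \<in> borel_measurable (mu m n)"
      using m L2D(1)[OF fL] by measurable
    show "integrable (mu m n) (\<lambda>x. (cmod (g x))\<^sup>2)" by (rule L2D(2)[OF g])
  qed (simp add: eq indicator_def)
  from closed_subspace_mult_measurable[OF V full f m this] show ?thesis unfolding eq .
qed

section \<open>Strong continuity\<close>

lemma hcoc_pairing_tendsto:
  assumes Xs: "\<And>i::nat. t' i \<in> carrier (G m n)" and t: "t \<in> carrier (G m n)"
    and lim: "\<And>k l. (\<lambda>i. t' i k l) \<longlonglongrightarrow> t k l"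
  shows "(\<lambda>i. pairing m n y (\<lambda>k l. hcoc m n x (t' i) k l - Imat m n k l))
    \<longlonglongrightarrow> pairing m n y (\<lambda>k l. hcoc m n x t k l - Imat m n k l)"
proof -
  \<comment> \<open>The ring consists of functions of z that converge along \<open>t'\<close> to
    their value at \<open>t\<close>; truncation by \<open>a\<close> provides a group element for
    every z, as \<open>fun_algebra_hcoc\<close> demands.\<close>
  define a where "a z = (if z \<in> carrier (G m n) then z else Imat m n)" for z
  let ?C = "{f. (\<lambda>i. f (t' i)) \<longlonglongrightarrow> f t}"
  have "(\<lambda>z. pairing m n y (\<lambda>k l. hcoc m n x (a z) k l - Imat m n k l)) \<in> ?C"
  proof (rule fun_algebra_hcoc)
    show "fun_algebra ?C" by (auto simp: fun_algebra_def intro: tendsto_add tendsto_mult)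
    show "a z \<in> carrier (G m n)" for z by (simp add: a_def Imat_in_carrier)
    show "(\<lambda>z. a z k l) \<in> ?C" for k l using Xs t lim by (simp add: a_def)
  qed simp
  then show ?thesis using Xs t by (simp add: a_def)
qed

lemma act_tendsto:
  assumes Xs: "\<And>i::nat. t' i \<in> carrier (G m n)" and t: "t \<in> carrier (G m n)"
    and lim: "\<And>k l. (\<lambda>i. t' i k l) \<longlonglongrightarrow> t k l" and p: "p \<in> Delta_X m n"
  shows "(\<lambda>i. act m n x (t' i) p) \<longlonglongrightarrow> act m n x t p"
  using p by (simp add: act_eq_restrict Xs t) (intro tendsto_intros lim)

lemma T_strongly_continuous:
  assumes Xs: "\<And>i::nat. t' i \<in> carrier (G m n)" and t: "t \<in> carrier (G m n)"
    and lim: "\<And>k l. (\<lambda>i. t' i k l) \<longlonglongrightarrow> t k l" and f: "f \<in> L2 (mu m n)"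
  shows "(\<lambda>i. l2_norm (mu m n) (\<lambda>x. T m n y (t' i) f x - T m n y t f x)) \<longlonglongrightarrow> 0"
proof -
  let ?M = "mu m n" and ?T = "T m n y"
  define W where "W = {f \<in> L2 ?M. (\<lambda>i. l2_norm ?M (\<lambda>x. ?T (t' i) f x - ?T t f x)) \<longlonglongrightarrow> 0}"
  have TL: "?T u f \<in> L2 ?M" if "u \<in> carrier (G m n)" "f \<in> L2 ?M" for u f
    by (rule T_square_integral(1)[OF that])
  have dL: "(\<lambda>x. ?T (t' i) f x - ?T t f x) \<in> L2 ?M" if "f \<in> L2 ?M" for i f
    by (intro L2_diff TL Xs t that)
  have closed: "closed_subspace_L2 ?M W"
    unfolding closed_subspace_L2_def
  proof (intro conjI ballI allI impI)
    show "W \<subseteq> L2 ?M" by (auto simp: W_def)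
    show "(\<lambda>x. 0) \<in> W" by (simp add: W_def T_def l2_norm_def L2_def)
    show "(\<lambda>x. a * f x + b * g x) \<in> W" if "f \<in> W" "g \<in> W" for f g a b
    proof -
      have fg: "f \<in> L2 ?M" "g \<in> L2 ?M" using that by (auto simp: W_def)
      have sc: "(\<lambda>i. l2_norm ?M (\<lambda>x. c * (?T (t' i) h x - ?T t h x))) \<longlonglongrightarrow> 0" if "h \<in> W" for h c
      proof -
        have "l2_norm ?M (\<lambda>x. c * q x) = cmod c * l2_norm ?M q" for q
          by (simp add: l2_norm_def norm_mult power_mult_distrib real_sqrt_mult)
        then show ?thesis using that by (simp add: W_def tendsto_mult_right_zero)
      qed
      have "(\<lambda>i. l2_norm ?M (\<lambda>x. a * (?T (t' i) f x - ?T t f x) + b * (?T (t' i) g x - ?T t g x))) \<longlonglongrightarrow> 0"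
        using that by (intro l2_norm_tendsto_add always_eventually allI L2_scale dL fg sc)
      moreover have "a * (?T (t' i) f x - ?T t f x) + b * (?T (t' i) g x - ?T t g x)
          = ?T (t' i) (\<lambda>x. a * f x + b * g x) x - ?T t (\<lambda>x. a * f x + b * g x) x" for i x
        by (simp add: T_linear algebra_simps)
      ultimately show ?thesis using fg by (simp add: W_def L2_add L2_scale)
    qed
    fix F f assume *: "range F \<subseteq> W \<and> f \<in> L2 ?M \<and> (\<lambda>j::nat. l2_norm ?M (\<lambda>x. F j x - f x)) \<longlonglongrightarrow> 0"
    then have F: "F j \<in> W" "F j \<in> L2 ?M" for j by (auto simp: W_def)
    from * have fL: "f \<in> L2 ?M" by simp
    let ?n = "\<lambda>f. \<integral>x. (cmod (f x))\<^sup>2 \<partial>?M"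
    from * have lim_F: "(\<lambda>j. ?n (\<lambda>x. F j x - f x)) \<longlonglongrightarrow> 0" by (simp add: l2_norm_tendsto_0_iff)
    \<comment> \<open>With t' for \<open>t' i\<close>, the difference is T_t'(f - F_j) + (T_t' F_j -
      T_t F_j) - T_t(f - F_j). Applying \<open>l2_square_add_le\<close> twice, with unitarity, gives
      2 + 4 = 6 copies of the approximation error and 4 of the middle term.\<close>
    have est: "?n (\<lambda>x. ?T (t' i) f x - ?T t f x)
        \<le> 6 * ?n (\<lambda>x. F j x - f x) + 4 * ?n (\<lambda>x. ?T (t' i) (F j) x - ?T t (F j) x)" for i j
    proof -
      have d: "(\<lambda>x. f x - F j x) \<in> L2 ?M" by (rule L2_diff[OF fL F(2)])
      have Td: "?T u (\<lambda>x. f x - F j x) x = ?T u f x - ?T u (F j) x" for u x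
        using T_linear[of m n y u 1 f "-1" "F j" x] by simp
      have nd: "?n (\<lambda>x. c * ?T u (\<lambda>x. f x - F j x) x) = ?n (\<lambda>x. F j x - f x)"
        if "u \<in> carrier (G m n)" "cmod c = 1" for u c
        using T_square_integral(2)[OF that(1) d, of y] that(2) by (simp add: norm_mult norm_minus_commute)
      let ?D = "\<lambda>x. ?T (t' i) (F j) x - ?T t (F j) x"
      have "?n (\<lambda>x. ?T (t' i) f x - ?T t f x)
          = ?n (\<lambda>x. 1 * ?T (t' i) (\<lambda>x. f x - F j x) x + (?D x + (-1) * ?T t (\<lambda>x. f x - F j x) x))"
        by (simp add: Td)
      also have "\<dots> \<le> 2 * ?n (\<lambda>x. 1 * ?T (t' i) (\<lambda>x. f x - F j x) x)
          + 2 * ?n (\<lambda>x. ?D x + (-1) * ?T t (\<lambda>x. f x - F j x) x)"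
        by (intro l2_square_add_le L2_add L2_scale TL d Xs t dL F)
      also have "?n (\<lambda>x. ?D x + (-1) * ?T t (\<lambda>x. f x - F j x) x)
          \<le> 2 * ?n ?D + 2 * ?n (\<lambda>x. (-1) * ?T t (\<lambda>x. f x - F j x) x)"
        by (intro l2_square_add_le L2_scale TL d Xs t dL F)
      finally show ?thesis unfolding nd[OF Xs norm_one] using nd[OF t, of "-1"] by simp
    qed
    have "(\<lambda>i. ?n (\<lambda>x. ?T (t' i) f x - ?T t f x)) \<longlonglongrightarrow> 0"
    proof (rule LIMSEQ_I)
      fix e :: real assume e: "e > 0"
      \<comment> \<open>The choices are made for 6 e/12 + 4 e/8 = e.\<close>
      then obtain j where j: "?n (\<lambda>x. F j x - f x) < e / 12"
        using order_tendstoD(2)[OF lim_F, of "e / 12"] by (auto simp: eventually_sequentially)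
      have "(\<lambda>i. ?n (\<lambda>x. ?T (t' i) (F j) x - ?T t (F j) x)) \<longlonglongrightarrow> 0"
        using F(1)[of j] by (simp add: W_def l2_norm_tendsto_0_iff)
      then obtain N where N: "\<And>i. i \<ge> N \<Longrightarrow> ?n (\<lambda>x. ?T (t' i) (F j) x - ?T t (F j) x) < e / 8"
        using order_tendstoD(2)[of _ 0 sequentially "e / 8"] e by (auto simp: eventually_sequentially)
      have "norm (?n (\<lambda>x. ?T (t' i) f x - ?T t f x) - 0) < e" if "i \<ge> N" for i
        using est[of i j] j N[OF that] by simp
      then show "\<exists>N. \<forall>i\<ge>N. norm (?n (\<lambda>x. ?T (t' i) f x - ?T t f x) - 0) < e" by blast
    qed
    then show "f \<in> W" using fL by (simp add: W_def l2_norm_tendsto_0_iff)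
  qed
  have full: "mult_sets ?M W = sets ?M"
  proof (rule mult_sets_full[OF closed])
    fix p assume p: "p \<in> Delta_X m n"
    show "(\<lambda>x. x p) \<in> borel_measurable (mult_measure ?M W)"
    proof (rule borel_measurable_mult_measure[OF closed coordinate_measurable[OF p]])
      fix s
      define \<phi> where "\<phi> x = cis (s * x p)" for x :: coords
      have \<phi>_meas: "\<phi> \<in> borel_measurable ?M"
      proof -
        have "(\<lambda>x. s * x p) \<in> borel_measurable ?M" using coordinate_measurable[OF p] by simp
        moreover have "cis \<in> borel_measurable borel"
          by (intro borel_measurable_continuous_onI continuous_intros)
        ultimately show ?thesis unfolding \<phi>_def by (rule measurable_compose)
      qed
      have norm_\<phi>: "cmod (\<phi> x) = 1" for x by (simp add: \<phi>_def)
      have "(\<lambda>x. \<phi> x * f x) \<in> W" if f: "f \<in> W" for f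
      proof -
        have fL: "f \<in> L2 ?M" using f by (simp add: W_def)
        \<comment> \<open>Covariance of multiplication operators under T. The difference of orbit
          points of \<phi> f thus splits into a unimodular multiple of that of f and a term in which
          only \<phi> is evaluated at moving points; the latter is dominated by means of |T_t
          f|^2.\<close>
        have \<phi>T: "?T u (\<lambda>x. \<phi> x * f x) x = \<phi> (act m n x u) * ?T u f x" for u x
          by (simp add: T_def)
        have \<phi>a: "(\<lambda>x. \<phi> (act m n x u)) \<in> borel_measurable ?M" if "u \<in> carrier (G m n)" for u
          by (rule compose_act_measurable[OF that \<phi>_meas])
        have \<phi>aL: "(\<lambda>x. \<phi> (act m n x u) * q x) \<in> L2 ?M" if "u \<in> carrier (G m n)" "q \<in> L2 ?M" for u q
          by (rule L2_mult_bounded[OF \<phi>a[OF that(1)] _ that(2), of 1]) (simp add: norm_\<phi>)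
        have lim1: "(\<lambda>i. l2_norm ?M (\<lambda>x. \<phi> (act m n x (t' i)) * (?T (t' i) f x - ?T t f x))) \<longlonglongrightarrow> 0"
          using f by (simp add: W_def l2_norm_def norm_mult norm_\<phi>)
        have lim2: "(\<lambda>i. l2_norm ?M (\<lambda>x. \<phi> (act m n x (t' i)) * ?T t f x - \<phi> (act m n x t) * ?T t f x)) \<longlonglongrightarrow> 0"
        proof (rule l2_dominated_convergence[where w = "\<lambda>x. (cmod (?T t f x))\<^sup>2"])
          show "AE x in ?M. (\<lambda>i. \<phi> (act m n x (t' i)) * ?T t f x) \<longlonglongrightarrow> \<phi> (act m n x t) * ?T t f x"
            unfolding \<phi>_def by (intro AE_I2 tendsto_intros act_tendsto[OF Xs t lim p])
        qed (use L2D[OF \<phi>aL[OF t TL[OF t fL]]] L2D[OF \<phi>aL[OF Xs TL[OF t fL]]] L2D[OF TL[OF t fL]]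
            in \<open>auto simp: norm_mult norm_\<phi>\<close>)
        have "(\<lambda>i. l2_norm ?M (\<lambda>x. \<phi> (act m n x (t' i)) * (?T (t' i) f x - ?T t f x)
            + (\<phi> (act m n x (t' i)) * ?T t f x - \<phi> (act m n x t) * ?T t f x))) \<longlonglongrightarrow> 0"
          by (intro l2_norm_tendsto_add always_eventually allI \<phi>aL dL L2_diff TL Xs t fL lim1 lim2)
        then show ?thesis
          using L2_mult_bounded[OF \<phi>_meas _ fL, of 1] norm_\<phi>
          by (simp add: W_def \<phi>T algebra_simps)
      qed
      then show "(\<lambda>x. cis (s * x p)) \<in> multipliers ?M W"
        using \<phi>_meas norm_\<phi> by (auto simp: multipliers_def \<phi>_def[abs_def])
    qed
  qed
  have "bump \<in> W"
  proof -
    have "(\<lambda>i. l2_norm ?M (\<lambda>x. ?T (t' i) bump x - ?T t bump x)) \<longlonglongrightarrow> 0"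
    proof (rule l2_convergence_of_norms)
      have "AE x in ?M. \<forall>i. ?T (t' i) bump x = S_char m n y (hcoc m n x (t' i)) * bump (act m n x (t' i))"
        unfolding AE_all_countable by (intro allI T_AE Xs)
      with T_AE[OF t, of y bump]
      show "AE x in ?M. (\<lambda>i. ?T (t' i) bump x) \<longlonglongrightarrow> ?T t bump x"
      proof eventually_elim
        case (elim x)
        have "(\<lambda>i. bump (act m n x (t' i))) \<longlonglongrightarrow> bump (act m n x t)"
          unfolding bump_def
          by (intro tendsto_intros act_tendsto[OF Xs t lim]) (auto simp: add_nonneg_eq_0_iff)
        moreover have "(\<lambda>i. S_char m n y (hcoc m n x (t' i))) \<longlonglongrightarrow> S_char m n y (hcoc m n x t)"
          unfolding S_char_eq_cis by (intro tendsto_intros hcoc_pairing_tendsto Xs t lim)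
        ultimately show ?case unfolding elim(1) elim(2)[rule_format] by (rule tendsto_mult[rotated])
      qed
    qed (simp_all add: TL Xs t bump_in_L2 T_square_integral(2))
    then show ?thesis by (simp add: W_def bump_in_L2)
  qed
  from closed_subspace_full[OF closed full this f] have "f \<in> W"
    by (simp add: bump_nonzero)
  then show ?thesis by (simp add: W_def)
qed

lemma unitary_rep_T: "unitary_rep (G m n) (mu m n) (T m n y)"
  unfolding unitary_rep_def
proof (intro conjI ballI)
  show "group (G m n)" by (rule group_G)
  show "unitary_on_L2 (mu m n) (T m n y t)" if "t \<in> carrier (G m n)" for t
    by (rule unitary_T[OF that])
  show "AE x in mu m n. T m n y \<one>\<^bsub>G m n\<^esub> f x = f x" for f
    unfolding one_G by (rule T_one_AE)
  show "AE x in mu m n. T m n y (s \<otimes>\<^bsub>G m n\<^esub> t) f x = T m n y s (T m n y t f) x"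
    if "s \<in> carrier (G m n)" "t \<in> carrier (G m n)" for s t f
    by (rule T_mult_AE[OF that])
  fix f t assume f: "f \<in> L2 (mu m n)" and t: "t \<in> carrier (G m n)"
  show "((\<lambda>u. l2_norm (mu m n) (\<lambda>x. T m n y u f x - T m n y t f x)) \<longlongrightarrow> 0) (at t within carrier (G m n))"
    unfolding tendsto_at_iff_sequentially comp_def
  proof (intro allI impI)
    fix t' assume t': "\<forall>i::nat. t' i \<in> carrier (G m n) - {t}" and lim: "t' \<longlonglongrightarrow> t"
    \<comment> \<open>The topology on matrices is that of an iterated function space, so an entry is
      extracted by two evaluations.\<close>
    have "continuous_on UNIV (\<lambda>z::imat. z k l)" for k l
      by (rule continuous_on_compose2[OF continuous_on_product_coordinates continuous_on_product_coordinates]) simp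
    then have "(\<lambda>i. t' i k l) \<longlonglongrightarrow> t k l" for k l
      using continuous_on_tendsto_compose[OF _ lim] by fastforce
    then show "(\<lambda>i. l2_norm (mu m n) (\<lambda>x. T m n y (t' i) f x - T m n y t f x)) \<longlonglongrightarrow> 0"
      using t' by (intro T_strongly_continuous t f) auto
  qed
qed

section \<open>Invariant subspaces\<close>

lemma invariant_subspace_mult_sets:
  assumes y: "\<And>j. j \<le> n \<Longrightarrow> y (m + int j + 1) (m - int j) \<noteq> 0"
    and V: "closed_subspace_L2 (mu m n) V"
    and inv: "\<And>t f. t \<in> carrier (G m n) \<Longrightarrow> f \<in> V \<Longrightarrow> T m n (y_functional m n y) t f \<in> V"
  shows "mult_sets (mu m n) V = sets (mu m n)"
proof (rule mult_sets_full[OF V])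
  let ?M = "mu m n" and ?y = "y_functional m n y"
  fix p assume p: "p \<in> Delta_X m n"
  show "(\<lambda>x. x p) \<in> borel_measurable (mult_measure ?M V)"
  proof (rule coordinates_from_Phi[where C = "borel_measurable (mult_measure ?M V)" and y = y])
    show "fun_algebra (borel_measurable (mult_measure ?M V) :: (coords \<Rightarrow> real) set)"
      by (rule fun_algebra_borel_measurable)
    show "y (m + int j + 1) (m - int j) \<noteq> 0" if "j \<le> n" for j by (rule y[OF that])
    show "p \<in> Delta_X m n" by (rule p)
    fix k r assume kr: "(k, r) \<in> Delta_rect m n"
    have kr': "(k, r) \<in> Delta_all m n" using kr Delta_subset_Delta_all by auto
    have Phi: "(\<lambda>x. Phi m n ?y x r k) \<in> borel_measurable ?M"
      by (rule fun_algebra_Phi[OF fun_algebra_borel_measurable coordinate_measurable])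
    show "(\<lambda>x. Phi m n ?y x r k) \<in> borel_measurable (mult_measure ?M V)"
    proof (rule borel_measurable_mult_measure[OF V Phi])
      fix s
      have meas: "(\<lambda>x. cis (s * Phi m n ?y x r k)) \<in> borel_measurable ?M"
      proof -
        have "(\<lambda>x. s * Phi m n ?y x r k) \<in> borel_measurable ?M" using Phi by simp
        moreover have "cis \<in> borel_measurable borel"
          by (intro borel_measurable_continuous_onI continuous_intros)
        ultimately show ?thesis by (rule measurable_compose)
      qed
      have "(\<lambda>x. cis (s * Phi m n ?y x r k) * f x) \<in> V" if f: "f \<in> V" for f
      proof (rule closed_subspace_AE[OF V])
        \<comment> \<open>The parameter absorbs the 2\<pi> of the character, so that T acts as
          multiplication by cis(s S_kr).\<close>
        let ?t = "one_param m n k r (s / (2 * pi))"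
        have t: "?t \<in> carrier (G m n)" by (rule one_param_in_carrier[OF kr'])
        show "T m n ?y ?t f \<in> V" by (rule inv[OF t f])
        show "(\<lambda>x. cis (s * Phi m n ?y x r k) * f x) \<in> L2 ?M"
          using f closed_subspace_L2D(1)[OF V] by (intro L2_mult_bounded[OF meas, of 1]) auto
        have "AE x in ?M. x \<in> X m n" using AE_space[of ?M] by (simp add: space_mu)
        with T_AE[OF t, of ?y f] show "AE x in ?M. T m n ?y ?t f x = cis (s * Phi m n ?y x r k) * f x"
          by eventually_elim (simp add: S_char_eq_cis pairing_hcoc_one_param[OF kr] act_one_param_rect[OF kr])
      qed
      then show "(\<lambda>x. cis (s * Phi m n ?y x r k)) \<in> multipliers ?M V"
        using meas by (auto simp: multipliers_def)
    qed
  qed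
qed

text \<open>
  Since indicator functions act on \<open>V\<close>, it contains everything supported in the union \<open>U\<close> of the
  supports of its elements. This set is invariant under the transitive action, so it is conull as
  soon as it is not null.
\<close>

lemma invariant_subspace_trivial:
  assumes y: "\<And>j. j \<le> n \<Longrightarrow> y (m + int j + 1) (m - int j) \<noteq> 0"
    and V: "closed_subspace_L2 (mu m n) V"
    and inv: "\<And>t f. t \<in> carrier (G m n) \<Longrightarrow> f \<in> V \<Longrightarrow> T m n (y_functional m n y) t f \<in> V"
    and f0: "f0 \<in> V" and f0_nonzero: "\<not> (AE x in mu m n. f0 x = 0)" and g: "g \<in> L2 (mu m n)"
  shows "g \<in> V"
proof -
  let ?M = "mu m n" and ?T = "T m n (y_functional m n y)"
  have full: "mult_sets ?M V = sets ?M"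
    by (rule invariant_subspace_mult_sets[OF y V inv])
  \<comment> \<open>These sets are closed under countable unions, so an essentially largest one
    exists; the aim is to show that it is conull.\<close>
  define J where "J = {A \<in> sets ?M. \<forall>g\<in>L2 ?M. (\<lambda>x. of_real (indicator A x) * g x) \<in> V}"
  have meas_V: "h \<in> borel_measurable ?M" if "h \<in> V" for h
    using that closed_subspace_L2D(1)[OF V] by auto
  have supp: "{x \<in> space ?M. h x \<noteq> 0} \<in> J" if h: "h \<in> V" for h
  proof -
    have [measurable]: "h \<in> borel_measurable ?M" using meas_V[OF h] .
    have A: "{x \<in> space ?M. h x \<noteq> 0} \<in> sets ?M" by measurable
    moreover have "(\<lambda>x. of_real (indicator {x \<in> space ?M. h x \<noteq> 0} x) * g x) \<in> V" if g: "g \<in> L2 ?M" for g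
    proof (rule closed_subspace_AE[OF V closed_subspace_full[OF V full h g]])
      show "(\<lambda>x. of_real (indicator {x \<in> space ?M. h x \<noteq> 0} x) * g x) \<in> L2 ?M"
        using A by (intro L2_mult_bounded[OF _ _ g, of _ 1]) (auto simp: indicator_def)
    qed (auto simp: indicator_def)
    ultimately show ?thesis by (simp add: J_def)
  qed
  have un: "(\<Union>i. A i) \<in> J" if A: "\<And>i::nat. A i \<in> J" for A
  proof -
    have As: "A i \<in> sets ?M" for i using A by (auto simp: J_def)
    have "(\<lambda>x. of_real (indicator (\<Union>i. A i) x) * g x) \<in> V" if g: "g \<in> L2 ?M" for g
    proof -
      have "(\<lambda>x. of_real (indicator (\<Union>i<k. A i) x) * g x) \<in> V" for k
      proof (induction k)
        case 0
        show ?case using closed_subspace_L2D(2)[OF V] by simp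
      next
        case (Suc k)
        \<comment> \<open>The new set is added through the part of g off the previous union, so that
          the overlap is not counted twice.\<close>
        have "(\<lambda>x. of_real (indicator (- (\<Union>i<k. A i)) x) * g x) \<in> L2 ?M"
        proof (rule L2I[where w = "\<lambda>x. (cmod (g x))\<^sup>2"])
          have B: "(\<Union>i<k. A i) \<in> sets ?M" using As by auto
          have "(\<lambda>x. of_real (indicator (- (\<Union>i<k. A i)) x) * g x) = (\<lambda>x. (1 - of_real (indicator (\<Union>i<k. A i) x)) * g x)"
            by (auto simp: indicator_def)
          then show "(\<lambda>x. of_real (indicator (- (\<Union>i<k. A i)) x) * g x) \<in> borel_measurable ?M"
            using B L2D(1)[OF g] by simp
        qed (use L2D(2)[OF g] in \<open>auto simp: indicator_def\<close>)
        then have "(\<lambda>x. of_real (indicator (A k) x) * (of_real (indicator (- (\<Union>i<k. A i)) x) * g x)) \<in> V"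
          using A[of k] by (simp add: J_def)
        from closed_subspace_L2D(3)[OF V Suc this]
        show ?case
        proof (rule back_subst[where P = "\<lambda>h. h \<in> V"], intro ext)
          fix x
          show "complex_of_real (indicator (\<Union>i<k. A i) x) * g x
              + of_real (indicator (A k) x) * (of_real (indicator (- (\<Union>i<k. A i)) x) * g x)
            = of_real (indicator (\<Union>i<Suc k. A i) x) * g x"
            by (auto simp: indicator_def less_Suc_eq)
        qed
      qed
      then show ?thesis
      proof (rule closed_subspace_limit[OF V])
        show "(\<lambda>x. of_real (indicator (\<Union>i. A i) x) * g x) \<in> borel_measurable ?M"
          using As L2D(1)[OF g] by simp
        show "integrable ?M (\<lambda>x. (cmod (g x))\<^sup>2)" by (rule L2D(2)[OF g])
        show "AE x in ?M. (\<lambda>k. of_real (indicator (\<Union>i<k. A i) x) * g x)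
            \<longlonglongrightarrow> of_real (indicator (\<Union>i. A i) x) * g x"
          by (intro AE_I2 tendsto_mult tendsto_of_real LIMSEQ_indicator_UN tendsto_const)
      qed (auto simp: indicator_def)
    qed
    then show ?thesis using As by (auto simp: J_def)
  qed
  obtain U where U: "U \<in> J" and U_max: "\<And>B. B \<in> J \<Longrightarrow> AE x in ?M. x \<notin> B - U"
  proof -
    have "J \<subseteq> sets ?M" "J \<noteq> {}" using supp[OF f0] by (auto simp: J_def)
    from sigma_finite_exhaustion[OF sigma_finite_mu this un] that show thesis by blast
  qed
  have Us [measurable]: "U \<in> sets ?M" using U by (simp add: J_def)
  define A where "A = {x \<in> space ?M. f0 x \<noteq> 0}"
  have A_J: "A \<in> J" unfolding A_def by (rule supp[OF f0])
  then have As [measurable]: "A \<in> sets ?M" by (simp add: J_def)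
  have A_pos: "emeasure ?M A \<noteq> 0"
    using f0_nonzero AE_iff_measurable[OF As, of "\<lambda>x. f0 x = 0"] by (simp add: A_def)
  \<comment> \<open>The support of T_t f0 belongs to \<open>J\<close>, hence lies in U up to a null
    set, which depends on t.\<close>
  have null: "AE x in ?M. \<not> (x \<notin> U \<and> act m n x t \<in> A)" if t: "t \<in> carrier (G m n)" for t
  proof -
    \<comment> \<open>The representative of T_t f0 without the density factor: as the character
      never vanishes, its support is exactly the preimage of A.\<close>
    define h where "h x = S_char m n (y_functional m n y) (hcoc m n x t) * f0 (act m n x t)" for x
    have f0L: "f0 \<in> L2 ?M" using f0 closed_subspace_L2D(1)[OF V] by auto
    have h_meas: "h \<in> borel_measurable ?M" unfolding h_def
      by (intro borel_measurable_times S_char_hcoc_measurable compose_act_measurable t meas_V f0)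
    have TL: "?T t f0 \<in> L2 ?M" by (rule T_square_integral(1)[OF t f0L])
    have eq: "AE x in ?M. ?T t f0 x = h x" unfolding h_def by (rule T_AE[OF t])
    then have "AE x in ?M. (cmod (h x))\<^sup>2 \<le> (cmod (?T t f0 x))\<^sup>2" by eventually_elim simp
    from L2I[OF h_meas L2D(2)[OF TL] this] have "h \<in> V"
      by (rule closed_subspace_AE[OF V inv[OF t f0] _ eq])
    from U_max[OF supp[OF this]] AE_space show ?thesis
    proof eventually_elim
      case (elim x)
      have "h x \<noteq> 0 \<longleftrightarrow> f0 (act m n x t) \<noteq> 0"
        by (simp add: h_def S_char_def)
      with elim show ?case using act_in_X[OF t, of x] by (auto simp: A_def)
    qed
  qed
  interpret sf: sigma_finite_measure ?M by (rule sigma_finite_mu)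
  interpret pair_sigma_finite ?M ?M ..
  \<comment> \<open>Integrating over x first gives 0 by \<open>null\<close>; integrating over z
    first gives \<mu>(A) for each x outside U, since z \<mapsto> x s(z) preserves \<mu>. Hence
    \<mu>(A) \<mu>(X - U) = 0.\<close>
  let ?f = "\<lambda>x z. indicator (space ?M - U) x * indicator A (act m n x (sect m n z)) :: ennreal"
  have f_meas: "case_prod ?f \<in> borel_measurable (?M \<Otimes>\<^sub>M ?M)"
  proof -
    have "(\<lambda>w. indicator A ((\<lambda>(x, z). act m n x (sect m n z)) w) :: ennreal) \<in> borel_measurable (?M \<Otimes>\<^sub>M ?M)"
      by (rule measurable_compose[OF act_sect_measurable]) simp
    moreover have "(\<lambda>w. indicator (space ?M - U) (fst w) :: ennreal) \<in> borel_measurable (?M \<Otimes>\<^sub>M ?M)"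
      by measurable
    ultimately show ?thesis by (simp add: case_prod_beta')
  qed
  have "(\<integral>\<^sup>+x. \<integral>\<^sup>+z. ?f x z \<partial>?M \<partial>?M) = (\<integral>\<^sup>+z. \<integral>\<^sup>+x. ?f x z \<partial>?M \<partial>?M)"
    by (rule Fubini'[OF f_meas, symmetric])
  also have "\<dots> = (\<integral>\<^sup>+z. 0 \<partial>?M)"
  proof (rule nn_integral_cong)
    fix z
    have "AE x in ?M. ?f x z = 0"
      using null[OF sect_in_carrier, of z] by eventually_elim (auto simp: indicator_def)
    then have "(\<integral>\<^sup>+x. ?f x z \<partial>?M) = (\<integral>\<^sup>+x. 0 \<partial>?M)" by (rule nn_integral_cong_AE)
    then show "(\<integral>\<^sup>+x. ?f x z \<partial>?M) = 0" by simp
  qed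
  finally have zero: "(\<integral>\<^sup>+x. \<integral>\<^sup>+z. ?f x z \<partial>?M \<partial>?M) = 0" by simp
  have "(\<integral>\<^sup>+z. ?f x z \<partial>?M) = indicator (space ?M - U) x * emeasure ?M A" if x: "x \<in> space ?M" for x
  proof -
    have am: "(\<lambda>z. act m n x (sect m n z)) \<in> measurable ?M ?M"
      using measurable_compose_Pair1[OF x act_sect_measurable] by simp
    have "(\<integral>\<^sup>+z. indicator A (act m n x (sect m n z)) \<partial>?M) = (\<integral>\<^sup>+z. indicator A z \<partial>distr ?M ?M (\<lambda>z. act m n x (sect m n z)))"
      using am by (subst nn_integral_distr) auto
    also have "\<dots> = emeasure ?M A" by (simp add: distr_act_sect)
    finally show ?thesis
      using measurable_compose[OF am borel_measurable_indicator[OF As]] by (subst nn_integral_cmult) auto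
  qed
  then have "(\<integral>\<^sup>+x. indicator (space ?M - U) x * emeasure ?M A \<partial>?M) = (\<integral>\<^sup>+x. \<integral>\<^sup>+z. ?f x z \<partial>?M \<partial>?M)"
    by (intro nn_integral_cong) simp
  then have "(\<integral>\<^sup>+x. indicator (space ?M - U) x * emeasure ?M A \<partial>?M) = 0"
    unfolding zero .
  then have "emeasure ?M A * emeasure ?M (space ?M - U) = 0"
    by (subst (asm) nn_integral_multc) (auto simp: mult.commute)
  then have "emeasure ?M (space ?M - U) = 0" using A_pos by simp
  then have "AE x in ?M. x \<in> U"
    by (subst AE_iff_measurable[of "space ?M - U"]) auto
  then have "AE x in ?M. of_real (indicator U x) * g x = g x" by eventually_elim simp
  moreover have "(\<lambda>x. of_real (indicator U x) * g x) \<in> V" using U g by (simp add: J_def)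
  ultimately show "g \<in> V"
    by (intro closed_subspace_AE[OF V _ g])
qed

lemma irreducible_T:
  assumes y: "\<And>j. j \<le> n \<Longrightarrow> y (m + int j + 1) (m - int j) \<noteq> 0"
  shows "irreducible_unitary_rep (G m n) (mu m n) (T m n (y_functional m n y))"
  unfolding irreducible_unitary_rep_def
proof (intro conjI allI impI)
  show "unitary_rep (G m n) (mu m n) (T m n (y_functional m n y))" by (rule unitary_rep_T)
  show "\<exists>f\<in>L2 (mu m n). \<not> (AE x in mu m n. f x = 0)"
    using bump_in_L2 not_AE_False by (intro bexI[of _ bump]) (auto simp: bump_nonzero)
  fix V assume "closed_subspace_L2 (mu m n) V \<and> (\<forall>t\<in>carrier (G m n). \<forall>f\<in>V. T m n (y_functional m n y) t f \<in> V)"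
  then have V: "closed_subspace_L2 (mu m n) V"
    and inv: "\<And>t f. t \<in> carrier (G m n) \<Longrightarrow> f \<in> V \<Longrightarrow> T m n (y_functional m n y) t f \<in> V" by auto
  show "V = {f \<in> L2 (mu m n). AE x in mu m n. f x = 0} \<or> V = L2 (mu m n)"
  proof (cases "\<forall>f\<in>V. AE x in mu m n. f x = 0")
    case True
    have "f \<in> V" if "f \<in> L2 (mu m n)" "AE x in mu m n. f x = 0" for f
      by (rule closed_subspace_AE[OF V closed_subspace_L2D(2)[OF V] that(1)]) (use that(2) in auto)
    then show ?thesis using True closed_subspace_L2D(1)[OF V] by auto
  next
    case False
    then show ?thesis
      using invariant_subspace_trivial[OF y V inv] closed_subspace_L2D(1)[OF V] by blast
  qed
qed

end

section \<open>The generators of the one-parameter groups\<close>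

text \<open>The curve H t itself changes with t, so a derivative at the base point alone does not
  suffice: the mean value estimate on the segment from 0 to t v uses joint continuity of h at (0,
  0).\<close>

lemma moving_base_derivative:
  fixes H h :: "real \<Rightarrow> real \<Rightarrow> complex"
  assumes H: "\<And>t w. (H t has_vector_derivative h t w) (at w)"
    and h: "continuous_on UNIV (\<lambda>z. h (fst z) (snd z))"
  shows "((\<lambda>t. (H t (t * v) - H t 0) / of_real t) \<longlongrightarrow> of_real v * h 0 0) (at 0)"
proof (rule tendstoI)
  fix e :: real assume e: "e > 0"
  \<comment> \<open>The total error is 3 |v| e': 2 |v| e' from the linearisation and |v| e' from
    replacing \<open>h t 0\<close> by \<open>h 0 0\<close>. The summand 1 covers v = 0.\<close>
  define e' where "e' = e / (4 * (\<bar>v\<bar> + 1))"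
  have e': "e' > 0" using e by (auto simp: e'_def)
  have "4 * (\<bar>v\<bar> + 1) \<noteq> 0" by simp
  from nonzero_eq_divide_eq[THEN iffD1, OF this e'_def]
  have e_eq: "e = 4 * (\<bar>v\<bar> * e') + 4 * e'" by (simp add: algebra_simps)
  obtain d where d: "d > 0" "\<And>z. dist z (0, 0) < d \<Longrightarrow> dist (h (fst z) (snd z)) (h 0 0) < e'"
    using h[unfolded continuous_on_iff, rule_format, of "(0, 0)" e'] e' by auto
  \<comment> \<open>Then |t| and |t v| are below d/2, so all points (t, w) of the segment are within
    d of the origin.\<close>
  have "\<forall>\<^sub>F t in at 0. \<bar>t\<bar> < d / (2 * (\<bar>v\<bar> + 1)) \<and> t \<noteq> (0 :: real)"
    unfolding eventually_at using d(1) by (intro exI[of _ "d / (2 * (\<bar>v\<bar> + 1))"]) auto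
  then show "\<forall>\<^sub>F t in at 0. dist ((H t (t * v) - H t 0) / of_real t) (of_real v * h 0 0) < e"
  proof eventually_elim
    case (elim t)
    then have tv: "\<bar>t\<bar> * (\<bar>v\<bar> + 1) < d / 2" by (simp add: field_simps)
    have td: "\<bar>t\<bar> < d / 2"
      using tv mult_left_mono[of 1 "\<bar>v\<bar> + 1" "\<bar>t\<bar>"] by linarith
    have near: "dist (h t w) (h 0 0) < e'" if "w \<in> closed_segment 0 (t * v)" for w
    proof -
      have "\<bar>w\<bar> \<le> \<bar>t * v\<bar>" using that by (auto simp: closed_segment_eq_real_ivl split: if_splits)
      also have "\<dots> \<le> \<bar>t\<bar> * (\<bar>v\<bar> + 1)" by (simp add: abs_mult distrib_left)
      finally have "\<bar>w\<bar> < d / 2" using tv by linarith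
      have "dist (t, w) (0, 0) \<le> \<bar>t\<bar> + \<bar>w\<bar>"
        by (simp add: dist_Pair_Pair sqrt_sum_squares_le_sum_abs)
      then have "dist (t, w) (0, 0) < d" using td \<open>\<bar>w\<bar> < d / 2\<close> by linarith
      from d(2)[OF this] show ?thesis by simp
    qed
    have "norm (H t (t * v) - H t 0 - (t * v - 0) *\<^sub>R h t 0) \<le> norm (t * v - 0) * (2 * e')"
    proof (rule vector_differentiable_bound_linearization[where S = "closed_segment 0 (t * v)"])
      show "(H t has_vector_derivative h t w) (at w within closed_segment 0 (t * v))" for w
        by (rule has_vector_derivative_at_within[OF H])
      show "norm (h t w - h t 0) \<le> 2 * e'" if "w \<in> closed_segment 0 (t * v)" for w
        using near[OF that] near[of 0] dist_triangle2[of "h t w" "h t 0" "h 0 0"]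
        by (simp add: dist_norm)
    qed auto
    moreover have "(H t (t * v) - H t 0) / of_real t - of_real v * h 0 0
        = (H t (t * v) - H t 0 - (t * v) *\<^sub>R h t 0) / of_real t + of_real v * (h t 0 - h 0 0)"
      (is "?a = ?b + ?c")
      using elim by (simp add: scaleR_conv_of_real field_simps)
    then have "dist ((H t (t * v) - H t 0) / of_real t) (of_real v * h 0 0) \<le> norm ?b + norm ?c"
      unfolding dist_norm by (simp only: norm_triangle_ineq)
    then have "dist ((H t (t * v) - H t 0) / of_real t) (of_real v * h 0 0)
        \<le> norm (H t (t * v) - H t 0 - (t * v) *\<^sub>R h t 0) / \<bar>t\<bar> + \<bar>v\<bar> * norm (h t 0 - h 0 0)"
      by (simp only: norm_divide norm_mult norm_of_real)
    moreover have "norm (h t 0 - h 0 0) < e'" using near[of 0] by (simp add: dist_norm)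
    then have "\<bar>v\<bar> * norm (h t 0 - h 0 0) \<le> \<bar>v\<bar> * e'" by (intro mult_left_mono) auto
    ultimately have "dist ((H t (t * v) - H t 0) / of_real t) (of_real v * h 0 0)
        \<le> (\<bar>t * v\<bar> * (2 * e')) / \<bar>t\<bar> + \<bar>v\<bar> * e'"
      using elim divide_right_mono[of "norm (H t (t * v) - H t 0 - (t * v) *\<^sub>R h t 0)" "\<bar>t * v\<bar> * (2 * e')" "\<bar>t\<bar>"]
      by simp
    also have "\<dots> = 3 * (\<bar>v\<bar> * e')" using elim by (simp add: abs_mult)
    finally show ?case
      using e' e_eq mult_nonneg_nonneg[of "\<bar>v\<bar>" e'] by linarith
  qed
qed

lemma cis_difference_quotient: "((\<lambda>t. (cis (t * a) - 1) / of_real t) \<longlongrightarrow> \<i> * of_real a) (at 0)"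
proof -
  have "((\<lambda>z. exp (\<i> * of_real a * z)) has_field_derivative \<i> * of_real a) (at 0)"
    by (auto intro!: derivative_eq_intros)
  then have "((\<lambda>h. (exp (\<i> * of_real a * h) - 1) / h) \<longlongrightarrow> \<i> * of_real a) (at 0)"
    by (simp add: has_field_derivative_iff)
  moreover have "filterlim complex_of_real (at 0) (at 0)"
    unfolding filterlim_at
    by (intro conjI tendsto_of_real[where a = 0, simplified] tendsto_ident_at)
       (simp add: eventually_at_filter)
  ultimately have "((\<lambda>t. (exp (\<i> * of_real a * of_real t) - 1) / of_real t) \<longlongrightarrow> \<i> * of_real a) (at 0)"
    by (rule filterlim_compose)
  then show ?thesis by (simp add: cis_conv_exp mult_ac)
qed

text \<open>The chord, of length 2 |sin(a / 2)|, is no longer than the arc.\<close>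

lemma cmod_cis_minus_1_le: "cmod (cis a - 1) \<le> \<bar>a\<bar>"
  using dist_exp_i_1[of a] abs_sin_x_le_abs_x[of "a / 2"] by (simp add: cis_conv_exp)

text \<open>Dominated convergence concerns sequences, so t \<rightarrow> 0 is taken along arbitrary
  sequences, eventually inside |t| \<le> 1. The pointwise representative \<open>u\<close> has
  difference quotients that converge at single points, while \<open>U t f\<close> may differ from it
  on a null set for each t.\<close>

lemma l2_generatorI:
  assumes f: "f \<in> L2 M" and g: "g \<in> borel_measurable M" and U: "\<And>t. U t f \<in> L2 M"
    and w: "integrable M w"
    and lim: "AE x in M. ((\<lambda>t. (u t x - f x) / of_real t) \<longlongrightarrow> g x) (at 0)"
    and u: "\<And>t. AE x in M. U t f x = u t x"
    and bound: "\<And>t. t \<noteq> 0 \<Longrightarrow> \<bar>t\<bar> \<le> 1 \<Longrightarrow> AE x in M. (cmod ((u t x - f x) / of_real t))\<^sup>2 \<le> w x"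
  shows "l2_generator M U f g"
proof -
  let ?q = "\<lambda>t x. (U t f x - f x) / of_real t"
  have qm: "?q t \<in> borel_measurable M" for t
    using L2D(1)[OF f] L2D(1)[OF U] by measurable
  have main: "(\<lambda>i. l2_norm M (\<lambda>x. ?q (\<tau> i) x - g x)) \<longlonglongrightarrow> 0 \<and> (AE x in M. (cmod (g x))\<^sup>2 \<le> w x)"
    if \<tau>: "\<And>i::nat. \<tau> i \<noteq> 0" "\<And>i. \<bar>\<tau> i\<bar> \<le> 1" "\<tau> \<longlonglongrightarrow> 0" for \<tau>
  proof -
    have all: "AE x in M. \<forall>i. U (\<tau> i) f x = u (\<tau> i) x" using u by (simp add: AE_all_countable)
    have ptw: "AE x in M. (\<lambda>i. ?q (\<tau> i) x) \<longlonglongrightarrow> g x"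
      using lim all
    proof eventually_elim
      case (elim x)
      have "filterlim \<tau> (at 0) sequentially" using \<tau> by (auto simp: filterlim_at)
      from filterlim_compose[OF elim(1) this] show ?case by (simp add: elim(2))
    qed
    have bd: "AE x in M. (cmod (?q (\<tau> i) x))\<^sup>2 \<le> w x" for i
      using bound[OF \<tau>(1,2)] u[of "\<tau> i"] by eventually_elim simp
    have "AE x in M. \<forall>i. (cmod (?q (\<tau> i) x))\<^sup>2 \<le> w x" using bd by (simp add: AE_all_countable)
    with ptw have "AE x in M. (cmod (g x))\<^sup>2 \<le> w x"
    proof eventually_elim
      case (elim x)
      show ?case
        by (rule LIMSEQ_le_const2[OF tendsto_power[OF tendsto_norm[OF elim(1)]]]) (use elim in auto)
    qed
    with l2_dominated_convergence[OF g qm w ptw bd] show ?thesis by simp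
  qed
  \<comment> \<open>One admissible sequence is enough to see that g is square integrable.\<close>
  have "AE x in M. (cmod (g x))\<^sup>2 \<le> w x"
  proof (rule main[THEN conjunct2])
    show "(\<lambda>i. 1 / real (Suc i)) \<longlonglongrightarrow> 0" by (intro LIMSEQ_Suc[OF lim_const_over_n])
  qed auto
  then have gL: "g \<in> L2 M" by (rule L2I[OF g w])
  have "((\<lambda>t. l2_norm M (\<lambda>x. ?q t x - g x)) \<longlongrightarrow> 0) (at 0)"
    unfolding tendsto_at_iff_sequentially comp_def
  proof (intro allI impI)
    fix \<tau> :: "nat \<Rightarrow> real" assume \<tau>: "\<forall>i. \<tau> i \<in> UNIV - {0}" "\<tau> \<longlonglongrightarrow> 0"
    from tendsto_rabs_zero[OF \<tau>(2)] have "\<forall>\<^sub>F i in sequentially. \<bar>\<tau> i\<bar> < 1"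
      by (rule order_tendstoD) simp
    then obtain N where N: "\<And>i. i \<ge> N \<Longrightarrow> \<bar>\<tau> i\<bar> < 1" by (auto simp: eventually_sequentially)
    have "(\<lambda>i. l2_norm M (\<lambda>x. ?q (\<tau> (i + N)) x - g x)) \<longlonglongrightarrow> 0"
    proof (rule main[THEN conjunct1])
      show "\<bar>\<tau> (i + N)\<bar> \<le> 1" for i using N[of "i + N"] by simp
      show "(\<lambda>i. \<tau> (i + N)) \<longlonglongrightarrow> 0" by (rule LIMSEQ_ignore_initial_segment[OF \<tau>(2)])
    qed (use \<tau> in auto)
    then show "(\<lambda>i. l2_norm M (\<lambda>x. ?q (\<tau> i) x - g x)) \<longlonglongrightarrow> 0"
      by (rule LIMSEQ_offset)
  qed
  then show ?thesis using f gL U by (simp add: l2_generator_def)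
qed

section \<open>Smooth functions with compact support\<close>

context
  fixes m :: int and n :: nat
begin

interpretation G: group "G m n" by (rule group_G)

text \<open>The inclusion of X into the full function space is Borel measurable, as the coordinates
  off \<open>Delta_X\<close> are constantly \<open>undefined\<close> on X.\<close>

lemma continuous_on_X_measurable:
  fixes g :: "coords \<Rightarrow> complex"
  assumes "continuous_on (X m n) g"
  shows "g \<in> borel_measurable (mu m n)"
proof -
  have "(\<lambda>x. x) \<in> borel_measurable (mu m n)"
  proof (rule measurable_coordinatewise_then_product)
    fix p
    show "(\<lambda>x. x p) \<in> borel_measurable (mu m n)"
    proof (cases "p \<in> Delta_X m n")
      case False
      then have "(\<lambda>x. x p) \<in> borel_measurable (mu m n) \<longleftrightarrow> (\<lambda>x. undefined :: real) \<in> borel_measurable (mu m n)"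
        by (intro measurable_cong) (auto simp: space_mu X_def)
      then show ?thesis by simp
    qed (rule coordinate_measurable)
  qed
  then have "(\<lambda>x. x) \<in> measurable (mu m n) (restrict_space borel (X m n))"
    by (intro measurable_restrict_space2) (auto simp: space_mu)
  from measurable_compose[OF this borel_measurable_continuous_on_restrict[OF assms]] show ?thesis .
qed

lemma continuous_on_coordinate [continuous_intros]: "continuous_on S (\<lambda>x::coords. x p)"
  by (rule continuous_on_subset[OF continuous_on_product_coordinates]) simp

lemma compact_coordinate_bound:
  assumes "compact (K :: coords set)"
  obtains R where "R \<ge> 0" "\<And>x p. x \<in> K \<Longrightarrow> p \<in> Delta_X m n \<Longrightarrow> \<bar>x p\<bar> \<le> R"
proof -
  have "\<exists>R. \<forall>x\<in>K. \<bar>x p\<bar> \<le> R" for p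
    using compact_imp_bounded[OF compact_continuous_image[OF continuous_on_coordinate assms], of p]
    by (auto simp: bounded_iff)
  then obtain R where R: "\<And>p x. x \<in> K \<Longrightarrow> \<bar>x p\<bar> \<le> R p" by metis
  show ?thesis
  proof (rule that)
    show "(\<Sum>p\<in>Delta_X m n. \<bar>R p\<bar>) \<ge> 0" by (intro sum_nonneg) simp
    fix x p assume "x \<in> K" "p \<in> Delta_X m n"
    then have "\<bar>x p\<bar> \<le> \<bar>R p\<bar>" using R[of x p] by linarith
    also have "\<dots> \<le> (\<Sum>p\<in>Delta_X m n. \<bar>R p\<bar>)"
      using \<open>p \<in> Delta_X m n\<close> by (intro member_le_sum) auto
    finally show "\<bar>x p\<bar> \<le> (\<Sum>p\<in>Delta_X m n. \<bar>R p\<bar>)" .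
  qed
qed

definition box_X :: "real \<Rightarrow> coords set" where
  "box_X R = (\<Pi>\<^sub>E p\<in>Delta_X m n. {-R..R})"

lemma integrable_box_X: "integrable (mu m n) (\<lambda>x. c * indicator (box_X R) x :: real)"
proof -
  interpret product_sigma_finite "\<lambda>_::int \<times> int. lborel :: real measure" by standard
  have "box_X R \<in> sets (mu m n)"
    unfolding mu_def box_X_def by (rule sets_PiM_I_finite) auto
  moreover have "emeasure (mu m n) (box_X R) = (\<Prod>p\<in>Delta_X m n. emeasure lborel {-R..R})"
    unfolding mu_def box_X_def by (rule emeasure_PiM) auto
  then have "emeasure (mu m n) (box_X R) < \<infinity>"
    by (cases "R \<ge> 0") (auto simp: power_eq_top_ennreal less_top[symmetric] emeasure_lborel_Icc_eq)
  ultimately show ?thesis by simp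
qed

lemma continuous_compact_support_L2:
  assumes g: "continuous_on (X m n) g" and K: "compact K" "K \<subseteq> X m n"
    and zero: "\<And>x. x \<in> X m n - K \<Longrightarrow> g x = 0"
  shows "g \<in> L2 (mu m n)"
proof -
  obtain R where R: "R \<ge> 0" "\<And>x p. x \<in> K \<Longrightarrow> p \<in> Delta_X m n \<Longrightarrow> \<bar>x p\<bar> \<le> R"
    using compact_coordinate_bound[OF K(1)] by blast
  obtain C where C: "\<And>x. x \<in> K \<Longrightarrow> cmod (g x) \<le> C"
    using compact_imp_bounded[OF compact_continuous_image[OF continuous_on_subset[OF g K(2)] K(1)]]
    by (auto simp: bounded_iff)
  show ?thesis
  proof (rule L2I[OF continuous_on_X_measurable[OF g] integrable_box_X[of "C\<^sup>2" R]])
    show "AE x in mu m n. (cmod (g x))\<^sup>2 \<le> C\<^sup>2 * indicator (box_X R) x"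
    proof (rule AE_I2)
      fix x assume "x \<in> space (mu m n)"
      then have x: "x \<in> X m n" by (simp add: space_mu)
      show "(cmod (g x))\<^sup>2 \<le> C\<^sup>2 * indicator (box_X R) x"
      proof (cases "x \<in> K")
        case True
        then have "x \<in> box_X R" using R(2)[OF True] x by (fastforce simp: box_X_def X_def PiE_iff)
        then show ?thesis using power_mono[OF C[OF True], of 2] by simp
      qed (use x zero in simp)
    qed
  qed
qed

lemma upd_in_X: "x \<in> X m n \<Longrightarrow> p \<in> Delta_X m n \<Longrightarrow> x(p := u) \<in> X m n"
  by (auto simp: X_def PiE_iff extensional_def)

text \<open>The curve x + t v with only the coordinates in P moving, so that coordinates can be
  switched on one by one.\<close>

definition shift_on :: "(int \<times> int) set \<Rightarrow> coords \<Rightarrow> coords \<Rightarrow> real \<Rightarrow> coords" where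
  "shift_on P v x t = (\<lambda>p. if p \<in> P then x p + t * v p else x p)"

lemma shift_on_in_X: "P \<subseteq> Delta_X m n \<Longrightarrow> x \<in> X m n \<Longrightarrow> shift_on P v x t \<in> X m n"
  by (auto simp: shift_on_def X_def PiE_iff extensional_def)

lemma shift_on_insert:
  "p \<notin> P \<Longrightarrow> shift_on (insert p P) v x t = (shift_on P v x t)(p := x p + t * v p)"
  by (auto simp: shift_on_def fun_eq_iff)

context
  fixes f :: "coords \<Rightarrow> complex"
  assumes f: "f \<in> Cc_infty m n"
begin

lemma Cc_continuous: "continuous_on (X m n) f"
  and Cc_continuous_D: "p \<in> Delta_X m n \<Longrightarrow> continuous_on (X m n) (D (fst p) (snd p) f)"
  and Cc_differentiable: "p \<in> Delta_X m n \<Longrightarrow> x \<in> X m n \<Longrightarrow> (\<lambda>u. f (x(p := u))) differentiable (at (x p))"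
proof -
  have *: "\<And>ps. set ps \<subseteq> Delta_X m n \<Longrightarrow> continuous_on (X m n) (foldr (\<lambda>(k, r). D k r) ps f) \<and>
     (\<forall>p\<in>Delta_X m n. \<forall>x\<in>X m n. (\<lambda>u. (foldr (\<lambda>(k, r). D k r) ps f) (x(p := u))) differentiable (at (x p)))"
    using f unfolding Cc_infty_def Let_def by blast
  show "continuous_on (X m n) f" using *[of "[]"] by simp
  show "continuous_on (X m n) (D (fst p) (snd p) f)" if "p \<in> Delta_X m n"
    using *[of "[p]"] that by (simp add: case_prod_beta)
  show "(\<lambda>u. f (x(p := u))) differentiable (at (x p))" if "p \<in> Delta_X m n" "x \<in> X m n"
    using *[of "[]"] that by simp
qed

lemma Cc_derivative:
  assumes p: "p \<in> Delta_X m n" and x: "x \<in> X m n"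
  shows "((\<lambda>u. f (x(p := u))) has_vector_derivative D (fst p) (snd p) f (x(p := u))) (at u)"
proof -
  have "(\<lambda>u'. f ((x(p := u))(p := u'))) differentiable (at ((x(p := u)) p))"
    by (rule Cc_differentiable[OF p upd_in_X[OF x p]])
  then show ?thesis unfolding vector_derivative_works by (simp add: D_def)
qed

lemma Cc_support:
  obtains K where "compact K" "K \<subseteq> X m n" "\<And>x. x \<in> X m n - K \<Longrightarrow> f x = 0"
    "\<And>p x. p \<in> Delta_X m n \<Longrightarrow> x \<in> X m n - K \<Longrightarrow> D (fst p) (snd p) f x = 0"
proof -
  obtain K where K: "compact K" "K \<subseteq> X m n" and zero: "\<forall>x\<in>X m n - K. f x = 0"
    using f unfolding Cc_infty_def by blast
  have "D (fst p) (snd p) f x = 0" if p: "p \<in> Delta_X m n" and x: "x \<in> X m n - K" for p x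
  proof -
    have cont: "continuous_on UNIV (\<lambda>u. x(p := u))"
    proof (rule continuous_on_coordinatewise_then_product)
      show "continuous_on UNIV (\<lambda>u. (x(p := u)) q)" for q
        by (cases "q = p") (simp_all add: continuous_intros)
    qed
    \<comment> \<open>K is compact, hence closed: on a coordinate line through a point off K the
      function vanishes near that point, and so does the partial derivative.\<close>
    let ?S = "(\<lambda>u. x(p := u)) -` (- K)"
    have "open ?S"
      using open_vimage[OF _ cont, of "- K"] compact_imp_closed[OF K(1)] by (simp add: open_Compl)
    have "((\<lambda>u. f (x(p := u))) has_vector_derivative 0) (at (x p))"
      by (rule has_vector_derivative_transform_within_open[OF has_vector_derivative_const[of 0] \<open>open ?S\<close>])
         (use x upd_in_X[of x p] p zero in auto)
    then show ?thesis by (simp add: D_def vector_derivative_at)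
  qed
  with K zero show ?thesis using that by blast
qed

lemma Cc_in_L2: "f \<in> L2 (mu m n)"
  using Cc_support continuous_compact_support_L2[OF Cc_continuous] by metis

lemma Cc_D_bounded:
  obtains C where "C \<ge> 0" "\<And>p x. p \<in> Delta_X m n \<Longrightarrow> x \<in> X m n \<Longrightarrow> cmod (D (fst p) (snd p) f x) \<le> C"
proof -
  obtain K where K: "compact K" "K \<subseteq> X m n"
    and zero: "\<And>p x. p \<in> Delta_X m n \<Longrightarrow> x \<in> X m n - K \<Longrightarrow> D (fst p) (snd p) f x = 0"
    using Cc_support by metis
  have "\<exists>C. \<forall>x\<in>K. cmod (D (fst p) (snd p) f x) \<le> C" if "p \<in> Delta_X m n" for p
    using compact_imp_bounded[OF compact_continuous_image[OF continuous_on_subset[OF Cc_continuous_D[OF that] K(2)] K(1)]]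
    by (auto simp: bounded_iff)
  then obtain C where C: "\<And>p x. p \<in> Delta_X m n \<Longrightarrow> x \<in> K \<Longrightarrow> cmod (D (fst p) (snd p) f x) \<le> C p"
    by metis
  show ?thesis
  proof (rule that)
    show nn: "(\<Sum>p\<in>Delta_X m n. \<bar>C p\<bar>) \<ge> 0" by (intro sum_nonneg) simp
    fix p x assume p: "p \<in> Delta_X m n" and x: "x \<in> X m n"
    show "cmod (D (fst p) (snd p) f x) \<le> (\<Sum>p\<in>Delta_X m n. \<bar>C p\<bar>)"
    proof (cases "x \<in> K")
      case True
      then have "cmod (D (fst p) (snd p) f x) \<le> \<bar>C p\<bar>" using C[OF p True] by linarith
      also have "\<dots> \<le> (\<Sum>p\<in>Delta_X m n. \<bar>C p\<bar>)" using p by (intro member_le_sum) auto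
      finally show ?thesis .
    qed (use zero p x nn in simp)
  qed
qed

text \<open>
  Changing one coordinate at a time reduces the derivative along \<open>v\<close> to partial derivatives.
\<close>

lemma directional_derivative:
  assumes "finite P" "P \<subseteq> Delta_X m n" and x: "x \<in> X m n"
  shows "((\<lambda>t. (f (shift_on P v x t) - f x) / of_real t) \<longlongrightarrow>
      (\<Sum>p\<in>P. of_real (v p) * D (fst p) (snd p) f x)) (at 0)"
  using assms(1,2)
proof (induction P)
  case empty
  then show ?case by (simp add: shift_on_def)
next
  case (insert p P)
  then have p: "p \<in> Delta_X m n" and P: "P \<subseteq> Delta_X m n" by auto
  \<comment> \<open>The coordinates in P have already moved when p starts to move, so the base point
    of this partial derivative depends on t.\<close>
  define z where "z t w = (shift_on P v x t)(p := x p + w)" for t w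
  have zX: "z t w \<in> X m n" for t w
    unfolding z_def by (rule upd_in_X[OF shift_on_in_X[OF P x] p])
  have "((\<lambda>t. (f (z t (t * v p)) - f (z t 0)) / of_real t) \<longlongrightarrow> of_real (v p) * D (fst p) (snd p) f (z 0 0)) (at 0)"
  proof (rule moving_base_derivative[where H = "\<lambda>t w. f (z t w)" and h = "\<lambda>t w. D (fst p) (snd p) f (z t w)"])
    fix t w
    have "((\<lambda>u. f ((shift_on P v x t)(p := u))) \<circ> (\<lambda>w. x p + w) has_vector_derivative
        1 *\<^sub>R D (fst p) (snd p) f ((shift_on P v x t)(p := x p + w))) (at w)"
      by (rule vector_diff_chain_at[OF _ Cc_derivative[OF p shift_on_in_X[OF P x]]])
         (auto intro!: derivative_eq_intros)
    then show "((\<lambda>w. f (z t w)) has_vector_derivative D (fst p) (snd p) f (z t w)) (at w)"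
      by (simp add: z_def comp_def)
  next
    have "continuous_on UNIV (\<lambda>s. z (fst s) (snd s))"
    proof (rule continuous_on_coordinatewise_then_product)
      fix q
      show "continuous_on UNIV (\<lambda>s. z (fst s) (snd s) q)"
        by (cases "q = p"; cases "q \<in> P") (simp_all add: z_def shift_on_def continuous_intros)
    qed
    then show "continuous_on UNIV (\<lambda>s. D (fst p) (snd p) f (z (fst s) (snd s)))"
      by (rule continuous_on_compose2[OF Cc_continuous_D[OF p]]) (use zX in auto)
  qed
  from tendsto_add[OF this insert.IH[OF P]]
  have "((\<lambda>t. (f (z t (t * v p)) - f x) / of_real t + (f (shift_on P v x t) - f (z t 0)) / of_real t) \<longlongrightarrow>
      of_real (v p) * D (fst p) (snd p) f (z 0 0) + (\<Sum>p\<in>P. of_real (v p) * D (fst p) (snd p) f x)) (at 0)"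
    by (simp add: add_divide_distrib diff_divide_distrib algebra_simps)
  moreover have "z t 0 = shift_on P v x t" for t
    using insert.hyps(2) by (auto simp: z_def shift_on_def fun_eq_iff)
  moreover have "z 0 0 = x" by (auto simp: z_def shift_on_def fun_eq_iff)
  moreover have "z t (t * v p) = shift_on (insert p P) v x t" for t
    by (simp add: z_def shift_on_insert[OF insert.hyps(2)])
  ultimately show ?case using insert.hyps by simp
qed

text \<open>The constant 3 adds the bound C for the linear term to 2 C for the linearisation error,
  two derivatives differing by at most 2 C.\<close>

lemma shift_on_difference_bound:
  assumes C: "C \<ge> 0" "\<And>p x. p \<in> Delta_X m n \<Longrightarrow> x \<in> X m n \<Longrightarrow> cmod (D (fst p) (snd p) f x) \<le> C"
    and "finite P" "P \<subseteq> Delta_X m n" and x: "x \<in> X m n"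
  shows "cmod (f (shift_on P v x t) - f x) \<le> 3 * C * \<bar>t\<bar> * (\<Sum>p\<in>P. \<bar>v p\<bar>)"
  using assms(3,4)
proof (induction P)
  case empty
  then show ?case by (simp add: shift_on_def)
next
  case (insert p P)
  then have p: "p \<in> Delta_X m n" and P: "P \<subseteq> Delta_X m n" by auto
  let ?z = "shift_on P v x t"
  have z: "?z \<in> X m n" by (rule shift_on_in_X[OF P x])
  let ?d = "\<lambda>u. D (fst p) (snd p) f (?z(p := u))"
  have dC: "cmod (?d u) \<le> C" for u by (rule C(2)[OF p upd_in_X[OF z p]])
  let ?A = "f (?z(p := x p + t * v p)) - f (?z(p := x p))"
  have "norm (?A - (x p + t * v p - x p) *\<^sub>R ?d (x p)) \<le> norm (x p + t * v p - x p) * (2 * C)"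
  proof (rule vector_differentiable_bound_linearization[where S = UNIV])
    show "norm (?d u - ?d (x p)) \<le> 2 * C" for u
      using norm_triangle_ineq4[of "?d u" "?d (x p)"] dC[of u] dC[of "x p"] by linarith
    show "((\<lambda>u. f (?z(p := u))) has_vector_derivative ?d u) (at u within UNIV)" for u
      by (rule Cc_derivative[OF p z])
  qed simp_all
  then have lin: "norm (?A - (t * v p) *\<^sub>R ?d (x p)) \<le> \<bar>t * v p\<bar> * (2 * C)"
    by (simp only: add_diff_cancel_left' real_norm_def)
  have "norm ((t * v p) *\<^sub>R ?d (x p)) \<le> \<bar>t * v p\<bar> * C"
    unfolding norm_scaleR by (intro mult_left_mono dC) simp
  from add_mono[OF this lin] have "norm ?A \<le> \<bar>t * v p\<bar> * C + \<bar>t * v p\<bar> * (2 * C)"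
    by (rule order_trans[OF norm_triangle_sub])
  also have "\<dots> = 3 * C * \<bar>t\<bar> * \<bar>v p\<bar>" by (simp add: abs_mult)
  finally have A: "norm ?A \<le> 3 * C * \<bar>t\<bar> * \<bar>v p\<bar>" .
  have zp: "?z(p := x p) = ?z" using insert.hyps(2) by (auto simp: shift_on_def fun_eq_iff)
  have eq: "f (shift_on (insert p P) v x t) - f x = ?A + (f ?z - f x)"
    unfolding shift_on_insert[OF insert.hyps(2)] zp by simp
  show ?case
    unfolding eq sum.insert[OF insert.hyps] distrib_left
    by (rule norm_triangle_mono[OF A insert.IH[OF P]])
qed

end

section \<open>The two kinds of generators\<close>

lemma hcoc_block:
  assumes "t \<in> carrier (G m n)" "diag_part m t = t"
  shows "hcoc m n x t = Imat m n"
  using assms G.r_inv[of "mmul m n (sect m n x) t"]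
  by (simp add: hcoc_eq sect_act mult_G one_G mmul_in_carrier)

text \<open>Right multiplication by I + t E_kr adds t times column k to column r; the value 1 of v
  in row k stands for the diagonal entry.\<close>

lemma act_one_param:
  assumes kr: "(k, r) \<in> Delta_X m n" and x: "x \<in> X m n"
  defines "v \<equiv> \<lambda>p. if fst p = k then 1 else x (fst p, k)"
  shows "act m n x (one_param m n k r t) = shift_on {p \<in> Delta_X m n. snd p = r \<and> fst p \<le> k} v x t"
proof
  fix p :: "int \<times> int"
  obtain i j where p: "p = (i, j)" by (cases p)
  have t: "one_param m n k r t \<in> carrier (G m n)"
    by (rule one_param_in_carrier[OF subsetD[OF Delta_subset_Delta_all(4) kr]])
  show "act m n x (one_param m n k r t) p = shift_on {p \<in> Delta_X m n. snd p = r \<and> fst p \<le> k} v x t p"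
  proof (cases "p \<in> Delta_X m n")
    case False
    then have "act m n x (one_param m n k r t) p = undefined" "x p = undefined"
      using act_in_X[OF t, of x] x False unfolding X_def by (auto intro: PiE_arb)
    then show ?thesis using False by (simp add: shift_on_def)
  next
    case True
    then have ij: "i < j" by (simp add: p mem_Delta_X)
    have "(\<Sum>l\<in>{i<..<j}. x (i, l) * one_param m n k r t l j)
        = (\<Sum>l\<in>{i<..<j}. if l = k then (if j = r then t * x (i, k) else 0) else 0)"
      by (intro sum.cong) (auto simp: one_param_def Imat_def E_def)
    also have "\<dots> = (if i < k \<and> k < j \<and> j = r then t * x (i, k) else 0)"
      by (simp add: sum.delta)
    finally show ?thesis
      using True ij kr unfolding p act_apply[OF t True[unfolded p]]
      by (auto simp: shift_on_def v_def one_param_def Imat_def E_def mem_Delta_X)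
  qed
qed

lemma diag_part_one_param:
  assumes "(k, r) \<in> Delta_X m n"
  shows "diag_part m (one_param m n k r t) = one_param m n k r t"
  using assms by (auto simp: diag_part_def one_param_def E_def Imat_def mem_Delta_X fun_eq_iff)

text \<open>The parameter \<open>lo\<close> is the first row of the diagonal block containing (k,
  r), which treats both blocks at once. Column k differs from column r, so the velocity is constant
  along the curve and the action is affine in t.\<close>

lemma generator_block:
  assumes f: "f \<in> Cc_infty m n" and kr: "(k, r) \<in> Delta_X m n"
    and lo: "\<And>i. i \<le> k \<Longrightarrow> (i, r) \<in> Delta_X m n \<longleftrightarrow> lo \<le> i"
  shows "l2_generator (mu m n) (\<lambda>t. T m n y (one_param m n k r t)) f
    (\<lambda>x. (\<Sum>s = lo..k - 1. of_real (x (s, k)) * D s r f x) + D k r f x)"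
proof -
  define P where "P = {p \<in> Delta_X m n. snd p = r \<and> fst p \<le> k}"
  define v :: "coords \<Rightarrow> coords" where "v x = (\<lambda>p. if fst p = k then 1 else x (fst p, k))" for x
  have P_sub: "P \<subseteq> Delta_X m n" and fin: "finite P"
    by (auto simp: P_def intro: finite_subset[of _ "Delta_X m n"])
  have lok: "lo \<le> k" using lo[of k] kr by simp
  have P_eq: "P = (\<lambda>s. (s, r)) ` {lo..k}"
    using lo by (auto simp: P_def image_iff)
  have g_eq: "(\<Sum>s = lo..k - 1. of_real (x (s, k)) * D s r f x) + D k r f x
      = (\<Sum>p\<in>P. of_real (v x p) * D (fst p) (snd p) f x)" for x
  proof -
    have "(\<Sum>p\<in>P. of_real (v x p) * D (fst p) (snd p) f x) = (\<Sum>s = lo..k. of_real (v x (s, r)) * D s r f x)"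
      unfolding P_eq by (subst sum.reindex) (auto simp: inj_on_def)
    also have "{lo..k} = insert k {lo..k - 1}" using lok by auto
    also have "(\<Sum>s\<in>insert k {lo..k - 1}. of_real (v x (s, r)) * D s r f x)
        = D k r f x + (\<Sum>s = lo..k - 1. of_real (v x (s, r)) * D s r f x)"
      by (subst sum.insert) (auto simp: v_def)
    also have "(\<Sum>s = lo..k - 1. of_real (v x (s, r)) * D s r f x) = (\<Sum>s = lo..k - 1. of_real (x (s, k)) * D s r f x)"
      by (intro sum.cong) (auto simp: v_def)
    finally show ?thesis by simp
  qed
  have t: "one_param m n k r t \<in> carrier (G m n)" for t
    by (rule one_param_in_carrier[OF subsetD[OF Delta_subset_Delta_all(4) kr]])
  have act: "act m n x (one_param m n k r t) = shift_on P (v x) x t" if "x \<in> X m n" for x t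
    unfolding P_def v_def by (rule act_one_param[OF kr that])
  \<comment> \<open>Off row k the velocity is an entry of column k, which the motion leaves
    fixed.\<close>
  have v_index: "(fst p, k) \<in> Delta_X m n - P" if "p \<in> P" "fst p \<noteq> k" for p
    using that kr by (cases p) (auto simp: P_def mem_Delta_X)
  obtain C where C: "C \<ge> 0" "\<And>p x. p \<in> Delta_X m n \<Longrightarrow> x \<in> X m n \<Longrightarrow> cmod (D (fst p) (snd p) f x) \<le> C"
    using Cc_D_bounded[OF f] by metis
  obtain K where K: "compact K" "K \<subseteq> X m n" "\<And>x. x \<in> X m n - K \<Longrightarrow> f x = 0"
    using Cc_support[OF f] by metis
  obtain R where R: "R \<ge> 0" "\<And>x p. x \<in> K \<Longrightarrow> p \<in> Delta_X m n \<Longrightarrow> \<bar>x p\<bar> \<le> R"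
    using compact_coordinate_bound[OF K(1)] by blast
  \<comment> \<open>In the box of radius 2R + 1 each of the \<open>card P\<close> velocity
    components is at most 2R + 2.\<close>
  define c where "c = 3 * C * (real (card P) * (2 * R + 2))"
  have bound: "cmod ((f (shift_on P (v x) x t) - f x) / of_real t) \<le> c * indicator (box_X (2 * R + 1)) x"
    if x: "x \<in> X m n" and t0: "t \<noteq> 0" "\<bar>t\<bar> \<le> 1" for x t
  proof (cases "x \<in> box_X (2 * R + 1)")
    case True
    then have xp: "\<bar>x p\<bar> \<le> 2 * R + 1" if "p \<in> Delta_X m n" for p
      using that by (fastforce simp: box_X_def PiE_iff)
    have "\<bar>v x p\<bar> \<le> 2 * R + 2" if "p \<in> P" for p
      using xp[of "(fst p, k)"] v_index[OF that] R(1) by (auto simp: v_def)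
    then have sum: "(\<Sum>p\<in>P. \<bar>v x p\<bar>) \<le> real (card P) * (2 * R + 2)"
      using sum_bounded_above[of P "\<lambda>p. \<bar>v x p\<bar>" "2 * R + 2"] by simp
    have "cmod ((f (shift_on P (v x) x t) - f x) / of_real t) = cmod (f (shift_on P (v x) x t) - f x) / \<bar>t\<bar>"
      by (simp add: norm_divide)
    also have "\<dots> \<le> 3 * C * \<bar>t\<bar> * (\<Sum>p\<in>P. \<bar>v x p\<bar>) / \<bar>t\<bar>"
      by (intro divide_right_mono shift_on_difference_bound[OF f C fin P_sub x] abs_ge_zero)
    also have "\<dots> = 3 * C * (\<Sum>p\<in>P. \<bar>v x p\<bar>)" using t0 by simp
    also have "\<dots> \<le> c" unfolding c_def using C(1) by (intro mult_left_mono[OF sum]) simp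
    finally show ?thesis using True by simp
  next
    case False
    let ?z = "shift_on P (v x) x t"
    have "x \<notin> K"
    proof
      assume "x \<in> K"
      then have "\<bar>x p\<bar> \<le> 2 * R + 1" if "p \<in> Delta_X m n" for p
        using R(2)[OF \<open>x \<in> K\<close> that] R(1) by linarith
      with x False show False by (fastforce simp: box_X_def X_def PiE_iff)
    qed
    \<comment> \<open>Origin of the radius: if the moved point lies in K, the fixed column k is
      bounded by R and the velocity by R + 1; as |t| \<le> 1, the old coordinates are at most R + (R
      + 1).\<close>
    moreover have "?z \<notin> K"
    proof
      assume z: "?z \<in> K"
      have "\<bar>x p\<bar> \<le> 2 * R + 1" if p: "p \<in> Delta_X m n" for p
      proof (cases "p \<in> P")
        case True
        have "\<bar>v x p\<bar> \<le> R + 1"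
        proof (cases "fst p = k")
          case False
          then have "?z (fst p, k) = x (fst p, k)" using v_index[OF True] by (simp add: shift_on_def)
          then show ?thesis using R(2)[OF z, of "(fst p, k)"] v_index[OF True False] False by (simp add: v_def)
        qed (use R(1) in \<open>simp add: v_def\<close>)
        then have "\<bar>t * v x p\<bar> \<le> R + 1"
          using mult_mono[of "\<bar>t\<bar>" 1 "\<bar>v x p\<bar>" "R + 1"] t0(2) by (simp add: abs_mult)
        moreover have "?z p = x p + t * v x p" using True by (simp add: shift_on_def)
        ultimately show ?thesis using R(2)[OF z p] by linarith
      next
        case False
        then have "?z p = x p" by (simp add: shift_on_def)
        then show ?thesis using R(2)[OF z p] R(1) by linarith
      qed
      with x False show False by (fastforce simp: box_X_def X_def PiE_iff)
    qed
    ultimately show ?thesis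
      using K(3)[of x] K(3)[of ?z] x shift_on_in_X[OF P_sub x] False by simp
  qed
  show ?thesis
    unfolding g_eq
  proof (rule l2_generatorI[where u = "\<lambda>t x. f (act m n x (one_param m n k r t))"
        and w = "\<lambda>x. c\<^sup>2 * indicator (box_X (2 * R + 1)) x"])
    show fL: "f \<in> L2 (mu m n)" by (rule Cc_in_L2[OF f])
    have v_cont: "continuous_on (X m n) (\<lambda>x. complex_of_real (v x p))" for p
      by (cases "fst p = k") (simp_all add: v_def continuous_intros)
    show "(\<lambda>x. \<Sum>p\<in>P. of_real (v x p) * D (fst p) (snd p) f x) \<in> borel_measurable (mu m n)"
      using P_sub by (intro continuous_on_X_measurable continuous_on_sum continuous_on_mult
          v_cont Cc_continuous_D[OF f]) auto
    show "T m n y (one_param m n k r s) f \<in> L2 (mu m n)" for s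
      by (rule T_square_integral(1)[OF t fL])
    show "integrable (mu m n) (\<lambda>x. c\<^sup>2 * indicator (box_X (2 * R + 1)) x)"
      by (rule integrable_box_X)
    show "AE x in mu m n. ((\<lambda>s. (f (act m n x (one_param m n k r s)) - f x) / of_real s) \<longlongrightarrow>
        (\<Sum>p\<in>P. of_real (v x p) * D (fst p) (snd p) f x)) (at 0)"
      by (rule AE_I2) (simp add: space_mu act directional_derivative[OF f fin P_sub])
    show "AE x in mu m n. T m n y (one_param m n k r s) f x = f (act m n x (one_param m n k r s))" for s
      using T_AE[OF t, of y s f]
      by eventually_elim (simp add: hcoc_block[OF t diag_part_one_param[OF kr]] S_char_one)
    show "AE x in mu m n. (cmod ((f (act m n x (one_param m n k r s)) - f x) / of_real s))\<^sup>2
        \<le> c\<^sup>2 * indicator (box_X (2 * R + 1)) x" if s: "s \<noteq> 0" "\<bar>s\<bar> \<le> 1" for s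
    proof (rule AE_I2)
      fix x assume "x \<in> space (mu m n)"
      then have x: "x \<in> X m n" by (simp add: space_mu)
      from power_mono[OF bound[OF x s] norm_ge_zero, of 2]
      show "(cmod ((f (act m n x (one_param m n k r s)) - f x) / of_real s))\<^sup>2
          \<le> c\<^sup>2 * indicator (box_X (2 * R + 1)) x"
        by (cases "x \<in> box_X (2 * R + 1)") (simp_all add: act[OF x])
    qed
  qed
qed

text \<open>The operators are multiplications, and |cis a - 1| \<le> |a| bounds the modulus of every
  difference quotient by that of the limit, whose square is therefore the dominating
  function.\<close>

lemma generator_rect:
  assumes f: "f \<in> Cc_infty m n" and kr: "(k, r) \<in> Delta_rect m n"
  shows "l2_generator (mu m n) (\<lambda>t. T m n y (one_param m n k r t)) f
    (\<lambda>x. 2 * of_real pi * \<i> * of_real (S_coord m n y k r x) * f x)"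
proof -
  let ?\<phi> = "\<lambda>x. Phi m n y x r k"
  let ?g = "\<lambda>x. \<i> * of_real (2 * pi * ?\<phi> x) * f x"
  have t: "one_param m n k r t \<in> carrier (G m n)" for t
    by (rule one_param_in_carrier[OF subsetD[OF Delta_subset_Delta_all(1) kr]])
  have "continuous_on (X m n) ?\<phi>"
    using fun_algebra_Phi[OF fun_algebra_continuous_on, of m n "X m n" y r k] continuous_on_coordinate by simp
  then have g_cont: "continuous_on (X m n) ?g"
    by (intro continuous_intros Cc_continuous[OF f])
  obtain K where K: "compact K" "K \<subseteq> X m n" "\<And>x. x \<in> X m n - K \<Longrightarrow> f x = 0"
    using Cc_support[OF f] by metis
  have gL: "?g \<in> L2 (mu m n)"
    by (rule continuous_compact_support_L2[OF g_cont K(1,2)]) (simp add: K(3))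
  have g_eq: "2 * of_real pi * \<i> * of_real (S_coord m n y k r x) * f x = ?g x" if "x \<in> X m n" for x
    by (simp add: S_coord_eq_Phi[OF kr that])
  show ?thesis
  proof (rule l2_generatorI[where u = "\<lambda>t x. cis (t * (2 * pi * ?\<phi> x)) * f x" and w = "\<lambda>x. (cmod (?g x))\<^sup>2"])
    show fL: "f \<in> L2 (mu m n)" by (rule Cc_in_L2[OF f])
    show "(\<lambda>x. 2 * of_real pi * \<i> * of_real (S_coord m n y k r x) * f x) \<in> borel_measurable (mu m n)"
      by (rule measurable_cong[THEN iffD2, OF _ L2D(1)[OF gL]]) (simp only: space_mu g_eq)
    show "T m n y (one_param m n k r s) f \<in> L2 (mu m n)" for s
      by (rule T_square_integral(1)[OF t fL])
    show "integrable (mu m n) (\<lambda>x. (cmod (?g x))\<^sup>2)" by (rule L2D(2)[OF gL])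
    have factor: "(cis b * f x - f x) / of_real s = (cis b - 1) / of_real s * f x" for b s x
      by (simp add: algebra_simps diff_divide_distrib)
    show "AE x in mu m n. ((\<lambda>s. (cis (s * (2 * pi * ?\<phi> x)) * f x - f x) / of_real s) \<longlongrightarrow>
        2 * of_real pi * \<i> * of_real (S_coord m n y k r x) * f x) (at 0)"
      unfolding factor
      by (rule AE_I2) (simp only: space_mu g_eq tendsto_mult[OF cis_difference_quotient tendsto_const])
    have "AE x in mu m n. x \<in> X m n" using AE_space[of "mu m n"] by (simp add: space_mu)
    then show "AE x in mu m n. T m n y (one_param m n k r s) f x = cis (s * (2 * pi * ?\<phi> x)) * f x" for s
      using T_AE[OF t, of y s f]
      by eventually_elim (simp add: S_char_eq_cis pairing_hcoc_one_param[OF kr] act_one_param_rect[OF kr] mult_ac)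
    show "AE x in mu m n. (cmod ((cis (s * (2 * pi * ?\<phi> x)) * f x - f x) / of_real s))\<^sup>2 \<le> (cmod (?g x))\<^sup>2"
      if "s \<noteq> 0" for s
    proof (rule AE_I2, rule power_mono)
      fix x
      have "cmod (cis (s * (2 * pi * ?\<phi> x)) - 1) / \<bar>s\<bar> \<le> \<bar>s * (2 * pi * ?\<phi> x)\<bar> / \<bar>s\<bar>"
        by (rule divide_right_mono[OF cmod_cis_minus_1_le]) simp
      also have "\<dots> = \<bar>2 * pi * ?\<phi> x\<bar>" using that by (simp add: abs_mult)
      finally show "cmod ((cis (s * (2 * pi * ?\<phi> x)) * f x - f x) / of_real s) \<le> cmod (?g x)"
        unfolding factor norm_mult norm_divide by (intro mult_right_mono) (simp_all add: norm_mult abs_mult)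
    qed simp
  qed
qed

end

theorem theorem2p16:
  fixes m :: int and n :: nat and y :: "int \<Rightarrow> int \<Rightarrow> real" and yn :: imat
  assumes yn: "yn = y_functional m n y"
    and y_nonzero: "\<forall>r\<in>{0..n}. y (m + int r + 1) (m - int r) \<noteq> 0"
  shows "irreducible_unitary_rep (G m n) (mu m n) (T m n yn) \<and>
    (\<forall>(k, r)\<in>Delta_sup m n. \<forall>f\<in>Cc_infty m n.
       l2_generator (mu m n) (\<lambda>t. T m n yn (one_param m n k r t)) f
         (\<lambda>x. (\<Sum>s = m - int n..k - 1. of_real (x (s, k)) * D s r f x) + D k r f x)) \<and>
    (\<forall>(k, r)\<in>Delta_sub m n. \<forall>f\<in>Cc_infty m n.
       l2_generator (mu m n) (\<lambda>t. T m n yn (one_param m n k r t)) f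
         (\<lambda>x. (\<Sum>s = m + 1..k - 1. of_real (x (s, k)) * D s r f x) + D k r f x)) \<and>
    (\<forall>(k, r)\<in>Delta_rect m n. \<forall>f\<in>Cc_infty m n.
       l2_generator (mu m n) (\<lambda>t. T m n yn (one_param m n k r t)) f
         (\<lambda>x. 2 * of_real pi * \<i> * of_real (S_coord m n yn k r x) * f x)) \<and>
    (\<forall>(k, r)\<in>Delta_rect m n. \<forall>x\<in>X m n.
       S_coord m n yn k r x =
         mmul m n (mmul m n (inv\<^bsub>G m n\<^esub> (x_sub m n x)) yn) (x_sup m n x) r k)"
proof (intro conjI)
  show "irreducible_unitary_rep (G m n) (mu m n) (T m n yn)"
    unfolding yn by (rule irreducible_T) (use y_nonzero in simp)
  show "\<forall>(k, r)\<in>Delta_sup m n. \<forall>f\<in>Cc_infty m n.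
       l2_generator (mu m n) (\<lambda>t. T m n yn (one_param m n k r t)) f
         (\<lambda>x. (\<Sum>s = m - int n..k - 1. of_real (x (s, k)) * D s r f x) + D k r f x)"
    by (clarify, rule generator_block) (auto simp: mem_Delta_sup mem_Delta_X)
  show "\<forall>(k, r)\<in>Delta_sub m n. \<forall>f\<in>Cc_infty m n.
       l2_generator (mu m n) (\<lambda>t. T m n yn (one_param m n k r t)) f
         (\<lambda>x. (\<Sum>s = m + 1..k - 1. of_real (x (s, k)) * D s r f x) + D k r f x)"
    by (clarify, rule generator_block) (auto simp: mem_Delta_sub mem_Delta_X)
  show "\<forall>(k, r)\<in>Delta_rect m n. \<forall>f\<in>Cc_infty m n.
       l2_generator (mu m n) (\<lambda>t. T m n yn (one_param m n k r t)) f
         (\<lambda>x. 2 * of_real pi * \<i> * of_real (S_coord m n yn k r x) * f x)"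
    by (clarify, rule generator_rect)
  show "\<forall>(k, r)\<in>Delta_rect m n. \<forall>x\<in>X m n.
       S_coord m n yn k r x =
         mmul m n (mmul m n (inv\<^bsub>G m n\<^esub> (x_sub m n x)) yn) (x_sup m n x) r k"
    by (clarify, simp add: S_coord_eq_Phi Phi_eq_block[OF _ yn])
qed

end
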